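(* Consider $$-\left(\varphi_p(u')\right)'+q(x)\varphi_p(u)=\lambda m(x)f(u),\quad 0<x<T,\qquad u(0)=u(T),\ u'(0)=u'(T).\qquad (N)$$ Assume that $f:[0,+\infty)\to[0,+\infty)$ is continuous with $f(s)>0$ for $s>0$, that $m:[0,T]\to[0,+\infty)$ is continuous with $m\not\equiv0$, that $f(s)/\varphi_p(s)$ is strictly decreasing in $(0,+\infty)$, and that $f_0=+\infty$ and $f_\infty=0$. Then, for any $\lambda\in(0,+\infty)$, problem (N) has a unique positive solution $u_\lambda(x)$. Furthermore, such a solution satisfies the following properties: (i) $u_\lambda$ lies on $\mathscr{C}^+$ (that is, $(\lambda,u_\lambda)\in\mathscr{C}^+$); (ii) $u_\lambda$ is continuous in $\lambda$, that is, if $\lambda\to\lambda_0$, then $\|u_\lambda-u_{\lambda_0}\|\to0$ (for $\lambda,\lambda_0\in(0,+\infty)$).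
   Context: Here $T>0$, $1<p<+\infty$, $\varphi_p(s)=|s|^{p-2}s$ (with $\varphi_p(0)=0$), $q\in C([0,T];[0,+\infty))$ with $q\not\equiv0$. $X=\{u\in W^{1,p}(0,T)\mid u(0)=u(T)\}$ with norm $\|u\|=(\int_0^T(|u'|^p+q|u|^p)\,dx)^{1/p}$. $f_0=\lim_{s\to0^+}f(s)/\varphi_p(s)$ and $f_\infty=\lim_{s\to+\infty}f(s)/\varphi_p(s)$. A positive solution is one positive on $[0,T]$. $\mathscr{C}^+$ denotes the unbounded component (connected set) in $\mathbb{R}\times X$ of positive solutions $(\lambda,u)$ of (N) which emanates from $(0,0)$ (its closure contains $(0,0)$) and joins to $(+\infty,+\infty)$ (it contains points $(\lambda_n,u_n)$ with $\lambda_n\to+\infty$ and $\|u_n\|\to+\infty$); such a component is known to exist under the stated hypotheses. *)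

theory Defs
  imports "HOL-Analysis.Analysis"
begin

definition phi :: "real \<Rightarrow> real \<Rightarrow> real" where
  "phi p s = \<bar>s\<bar> powr (p - 2) * s"

section \<open>The space of periodic Sobolev functions\<close>

definition C1c :: "real \<Rightarrow> (real \<Rightarrow> real) set" where
  "C1c T = {\<psi>. (\<forall>x. \<psi> differentiable (at x)) \<and> continuous_on UNIV (deriv \<psi>) \<and>
                (\<exists>a b. 0 < a \<and> b < T \<and> (\<forall>x. x \<notin> {a..b} \<longrightarrow> \<psi> x = 0))}"

definition Lp_fun :: "real \<Rightarrow> real \<Rightarrow> (real \<Rightarrow> real) \<Rightarrow> bool" where
  "Lp_fun T p g \<longleftrightarrow> set_borel_measurable lborel {0<..<T} g \<and>
                    set_integrable lborel {0<..<T} (\<lambda>x. \<bar>g x\<bar> powr p)"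

definition has_weak_deriv :: "real \<Rightarrow> (real \<Rightarrow> real) \<Rightarrow> (real \<Rightarrow> real) \<Rightarrow> bool" where
  "has_weak_deriv T u g \<longleftrightarrow>
     (\<forall>\<psi>\<in>C1c T. (LINT x:{0<..<T}|lborel. u x * deriv \<psi> x) =
                 - (LINT x:{0<..<T}|lborel. g x * \<psi> x))"

text \<open>
  Every class in \<open>W\<^sup>1\<^sup>,\<^sup>p(0,T)\<close> has exactly one representative that is continuous on
  \<open>[0,T]\<close>; this is the representative meant in \<open>u(0) = u(T)\<close>.  Classes are therefore
  represented by these functions, with the values outside \<open>[0,T]\<close> fixed by
  \<open>extensional\<close>, so that equality in HOL is equality in \<open>W\<^sup>1\<^sup>,\<^sup>p(0,T)\<close>.
\<close>

definition X_per :: "real \<Rightarrow> real \<Rightarrow> (real \<Rightarrow> real) set" where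
  "X_per T p = {u \<in> extensional {0..T}. continuous_on {0..T} u \<and> Lp_fun T p u \<and>
                  (\<exists>g. Lp_fun T p g \<and> has_weak_deriv T u g) \<and> u 0 = u T}"

text \<open>The choice is unique up to a null set, so integrals do not depend on it.\<close>

definition wderiv :: "real \<Rightarrow> real \<Rightarrow> (real \<Rightarrow> real) \<Rightarrow> (real \<Rightarrow> real)" where
  "wderiv T p u = (SOME g. Lp_fun T p g \<and> has_weak_deriv T u g)"

definition X_norm :: "real \<Rightarrow> real \<Rightarrow> (real \<Rightarrow> real) \<Rightarrow> (real \<Rightarrow> real) \<Rightarrow> real" where
  "X_norm T p q u =
     (LINT x:{0<..<T}|lborel. \<bar>wderiv T p u x\<bar> powr p + q x * \<bar>u x\<bar> powr p) powr (1 / p)"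

text \<open>The pointwise difference need not be extensional, but \<open>X_norm\<close> only
  depends on the values on \<open>(0,T)\<close>.\<close>

definition X_dist ::
    "real \<Rightarrow> real \<Rightarrow> (real \<Rightarrow> real) \<Rightarrow> (real \<Rightarrow> real) \<Rightarrow> (real \<Rightarrow> real) \<Rightarrow> real" where
  "X_dist T p q u v = X_norm T p q (\<lambda>x. u x - v x)"

definition RX_top ::
    "real \<Rightarrow> real \<Rightarrow> (real \<Rightarrow> real) \<Rightarrow> (real \<times> (real \<Rightarrow> real)) topology" where
  "RX_top T p q =
     prod_topology euclideanreal (Metric_space.mtopology (X_per T p) (X_dist T p q))"

section \<open>Positive solutions\<close>

text \<open>Classical solutions: \<open>u\<close> is continuously differentiable on \<open>[0,T]\<close> (one-sided
  derivatives at the endpoints) and \<open>\<phi>\<^sub>p(u')\<close> is differentiable on \<open>(0,T)\<close>; there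
  \<open>du\<close> is \<open>u'\<close> and \<open>w\<close> is \<open>(\<phi>\<^sub>p(u'))'\<close>.\<close>

definition solution_N ::
    "real \<Rightarrow> real \<Rightarrow> (real \<Rightarrow> real) \<Rightarrow> (real \<Rightarrow> real) \<Rightarrow> (real \<Rightarrow> real) \<Rightarrow> real \<Rightarrow>
     (real \<Rightarrow> real) \<Rightarrow> bool" where
  "solution_N T p q m f \<mu> u \<longleftrightarrow> u \<in> X_per T p \<and>
     (\<exists>du w. (\<forall>x\<in>{0..T}. (u has_real_derivative du x) (at x within {0..T})) \<and>
        continuous_on {0..T} du \<and>
        (\<forall>x\<in>{0<..<T}. ((\<lambda>y. phi p (du y)) has_real_derivative w x) (at x) \<and>
           - w x + q x * phi p (u x) = \<mu> * m x * f (u x)) \<and>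
        u 0 = u T \<and> du 0 = du T)"

definition positive_solution ::
    "real \<Rightarrow> real \<Rightarrow> (real \<Rightarrow> real) \<Rightarrow> (real \<Rightarrow> real) \<Rightarrow> (real \<Rightarrow> real) \<Rightarrow> real \<Rightarrow>
     (real \<Rightarrow> real) \<Rightarrow> bool" where
  "positive_solution T p q m f \<mu> u \<longleftrightarrow>
     solution_N T p q m f \<mu> u \<and> (\<forall>x\<in>{0..T}. u x > 0)"

definition positive_set ::
    "real \<Rightarrow> real \<Rightarrow> (real \<Rightarrow> real) \<Rightarrow> (real \<Rightarrow> real) \<Rightarrow> (real \<Rightarrow> real) \<Rightarrow>
     (real \<times> (real \<Rightarrow> real)) set" where
  "positive_set T p q m f = {(\<mu>, u). positive_solution T p q m f \<mu> u}"

section \<open>The component of positive solutions\<close>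

definition is_C_plus ::
    "real \<Rightarrow> real \<Rightarrow> (real \<Rightarrow> real) \<Rightarrow> (real \<Rightarrow> real) \<Rightarrow> (real \<Rightarrow> real) \<Rightarrow>
     (real \<times> (real \<Rightarrow> real)) set \<Rightarrow> bool" where
  "is_C_plus T p q m f C \<longleftrightarrow>
     C \<in> connected_components_of (subtopology (RX_top T p q) (positive_set T p q m f)) \<and>
     (\<forall>B. \<exists>(\<mu>, u)\<in>C. \<bar>\<mu>\<bar> + X_norm T p q u > B) \<and>
     (0, restrict (\<lambda>x. 0) {0..T}) \<in> (RX_top T p q) closure_of C \<and>
     (\<exists>\<mu> u. (\<forall>n::nat. (\<mu> n, u n) \<in> C) \<and> filterlim \<mu> at_top sequentially \<and>
            filterlim (\<lambda>n. X_norm T p q (u n)) at_top sequentially)"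

end

theory Submission
  imports Defs "HOL-Complex_Analysis.Great_Picard"
begin

text \<open>For a positive solution put \<open>z = ln u\<close> and \<open>y = \<phi>\<^sub>p(z')\<close>. Then
  \<open>y' = q - \<lambda> m G(z) - (p - 1) \<bar>y\<bar>\<^sup>p\<^sup>'\<close> with \<open>p' = p / (p - 1)\<close>, where
  \<open>G = f / \<phi>\<^sub>p\<close> is decreasing. A one-dimensional maximum principle for the difference of two
  logarithms therefore gives a comparison of solutions with positive sub- and supersolutions, and
  with it uniqueness. For \<open>\<nu>\<close> close to \<open>\<lambda>\<close> the multiples \<open>u\<^sub>\<lambda> / c\<close> and \<open>c u\<^sub>\<lambda>\<close>
  with \<open>c > 1\<close> are a sub- and a supersolution of the problem for \<open>\<nu>\<close>, so \<open>u\<^sub>\<nu>\<close> is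
  uniformly close to \<open>u\<^sub>\<lambda>\<close>; the equation transfers this to the derivatives.

  For existence the nonlinearity is truncated between explicit sub- and supersolutions. The resulting
  planar system has a periodic solution: the Euler scheme has periodic orbits by Brouwer's theorem, and
  these converge by the Arzela--Ascoli theorem.

  Positive solutions exist for \<open>\<lambda> > 0\<close> only, so the set of all positive solutions is the graph of
  the continuous map \<open>\<lambda> \<mapsto> u\<^sub>\<lambda>\<close> on \<open>(0, \<infinity>)\<close>. It is connected and hence is its only
  component.\<close>

section \<open>The function \<open>\<phi>\<^sub>p\<close>\<close>

text \<open>The nonlinearity is merely continuous in \<open>u\<close>, and the inverse of
  \<open>phi p\<close> is not Lipschitz at 0 when p > 2. Initial value problems may branch, so there
  is no Poincare map to which a fixed point theorem could be applied. The Euler scheme is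
  single-valued and continuous in the initial value; periodicity is therefore imposed on it, before
  passing to the limit. Logarithms enter because of homogeneity: after division by
  \<open>phi p u\<close> the operator no longer sees constant factors, and only \<open>G\<close>
  depends on the size of u. The borderline case of the maximum principle is a pair of proportional
  functions, and strict monotonicity of \<open>G\<close> excludes it at a single point with m > 0.
  The truncation keeps the system away from u = 0, where \<open>G\<close> is unbounded. The norm
  refers to a weak derivative picked by \<open>SOME\<close>. Its uniqueness almost everywhere allows
  the norm to be computed with classical derivatives; definiteness and the triangle inequality have
  to be established before the topology on X is that of a metric.\<close>

lemma phi_0 [simp]: "phi p 0 = 0"
  by (simp add: phi_def)

lemma phi_minus [simp]: "phi p (- s) = - phi p s"
  by (simp add: phi_def)

lemma phi_mult: "phi p (a * b) = phi p a * phi p b"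
  by (simp add: phi_def abs_mult powr_mult)

lemma phi_sgn: "phi p s = sgn s * \<bar>s\<bar> powr (p - 1)"
proof (cases "s = 0")
  case False
  have "\<bar>s\<bar> powr (p - 1) = \<bar>s\<bar> powr (p - 2) * \<bar>s\<bar> powr 1"
    unfolding powr_add[symmetric] by simp
  also have "\<dots> = \<bar>s\<bar> powr (p - 2) * \<bar>s\<bar>"
    by simp
  finally show ?thesis
    by (simp add: phi_def sgn_mult_abs mult.left_commute[of "sgn s"])
qed simp

lemma phi_pos_eq: "0 < s \<Longrightarrow> phi p s = s powr (p - 1)"
  by (simp add: phi_sgn)

lemma phi_pos: "0 < s \<Longrightarrow> 0 < phi p s"
  by (simp add: phi_def)

lemma sgn_phi [simp]: "sgn (phi p s) = sgn s"
  by (cases "s = 0") (auto simp: phi_def sgn_mult sgn_1_pos)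

lemma abs_phi: "\<bar>phi p s\<bar> = \<bar>s\<bar> powr (p - 1)"
  by (cases "s = 0") (auto simp: phi_sgn abs_mult abs_sgn_eq)

lemma phi_mult_self: "phi p s * s = \<bar>s\<bar> powr p"
proof (cases "s = 0")
  case False
  have "\<bar>s\<bar> powr p = \<bar>s\<bar> powr (p - 2) * \<bar>s\<bar> powr 2"
    unfolding powr_add[symmetric] by simp
  also have "\<bar>s\<bar> powr 2 = s * s"
    using False by (simp add: powr_numeral power2_eq_square)
  finally show ?thesis
    by (simp add: phi_def mult.assoc)
qed simp

text \<open>The conjugate exponent: \<open>phi (conj_exp p)\<close> inverts \<open>phi p\<close> and
  so recovers the derivative u' from the flux \<open>phi p\<close> u'.\<close>

definition conj_exp :: "real \<Rightarrow> real" where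
  "conj_exp p = p / (p - 1)"

lemma conj_exp_gt_1: "1 < p \<Longrightarrow> 1 < conj_exp p"
  by (simp add: conj_exp_def)

lemma conj_exp_conj_exp: "1 < p \<Longrightarrow> conj_exp (conj_exp p) = p"
  by (simp add: conj_exp_def divide_simps)

lemma phi_conj_phi [simp]:
  assumes "1 < p" shows "phi (conj_exp p) (phi p s) = s"
proof -
  have "phi (conj_exp p) (phi p s) = sgn s * (\<bar>s\<bar> powr (p - 1)) powr (conj_exp p - 1)"
    by (simp add: phi_sgn[of "conj_exp p"] abs_phi)
  also have "(p - 1) * (conj_exp p - 1) = 1"
    using assms by (simp add: conj_exp_def field_simps)
  then have "(\<bar>s\<bar> powr (p - 1)) powr (conj_exp p - 1) = \<bar>s\<bar>"
    by (simp add: powr_powr)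
  finally show ?thesis
    by (simp add: sgn_mult_abs)
qed

lemma phi_phi_conj [simp]:
  assumes "1 < p" shows "phi p (phi (conj_exp p) s) = s"
  using phi_conj_phi[OF conj_exp_gt_1[OF assms], of s] assms by (simp add: conj_exp_conj_exp)

lemma abs_powr_conj_phi:
  assumes "1 < p" shows "\<bar>phi p s\<bar> powr conj_exp p = \<bar>s\<bar> powr p"
proof -
  have "(p - 1) * conj_exp p = p"
    using assms by (simp add: conj_exp_def)
  then show ?thesis
    by (simp add: abs_phi powr_powr)
qed

lemma phi_strict_mono:
  assumes "1 < p" "s < t" shows "phi p s < phi p t"
proof -
  consider "0 \<le> s" | "s < 0" "0 \<le> t" | "t < 0"
    using assms by linarith
  then show ?thesis
  proof cases
    case 1
    then show ?thesis
      using assms powr_less_mono2[of "p - 1" s t]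
      by (cases "s = 0") (auto simp: phi_sgn sgn_if)
  next
    case 2
    then have "phi p s < 0"
      using phi_pos[of "- s" p] by simp
    moreover have "0 \<le> phi p t"
      using 2 by (simp add: phi_def)
    ultimately show ?thesis by simp
  next
    case 3
    then show ?thesis
      using assms powr_less_mono2[of "p - 1" "- t" "- s"] by (auto simp: phi_sgn sgn_if)
  qed
qed

lemma phi_less_iff [simp]: "1 < p \<Longrightarrow> phi p s < phi p t \<longleftrightarrow> s < t"
  by (metis phi_strict_mono linorder_neqE less_asym)

lemma phi_le_iff [simp]: "1 < p \<Longrightarrow> phi p s \<le> phi p t \<longleftrightarrow> s \<le> t"
  by (meson not_le phi_less_iff)

lemma phi_eq_iff [simp]: "1 < p \<Longrightarrow> phi p s = phi p t \<longleftrightarrow> s = t"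
  by (metis phi_conj_phi)

text \<open>The maximum principle relates a difference of derivatives to a difference of fluxes
  through their signs alone; monotonicity of \<open>phi p\<close> supplies this link.\<close>

lemma sgn_phi_diff: "1 < p \<Longrightarrow> sgn (phi p s - phi p t) = sgn (s - t)"
  using phi_less_iff[of p s t] phi_less_iff[of p t s] phi_eq_iff[of p s t]
  by (simp add: sgn_if del: phi_less_iff phi_eq_iff)

text \<open>For p < 2 the factor \<open>\<bar>s\<bar> powr (p - 2)\<close> is unbounded near 0, so
  the product form does not help there. Each half-line carries a power with the positive exponent p
  - 1, and the two are glued at 0.\<close>

lemma continuous_on_phi:
  assumes "1 < p" shows "continuous_on S (phi p)"
proof -
  have "continuous_on UNIV (phi p)"
  proof -
    have "continuous_on ({0..} \<union> {..0}) (phi p)"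
    proof (rule continuous_on_closed_Un)
      have "continuous_on {0..} (\<lambda>s. s powr (p - 1))"
        using assms by (intro continuous_on_powr' continuous_intros) auto
      moreover have "s powr (p - 1) = phi p s" if "s \<in> {0..}" for s
        using that by (cases "s = 0") (auto simp: phi_sgn)
      ultimately show "continuous_on {0..} (phi p)"
        using continuous_on_eq by blast
      have "continuous_on {..0} (\<lambda>s. - ((- s) powr (p - 1)))"
        using assms by (intro continuous_on_powr' continuous_intros) auto
      moreover have "- ((- s) powr (p - 1)) = phi p s" if "s \<in> {..0}" for s
        using that by (cases "s = 0") (auto simp: phi_sgn)
      ultimately show "continuous_on {..0} (phi p)"
        using continuous_on_eq by blast
    qed auto
    moreover have "{0..} \<union> {..0::real} = UNIV" by auto
    ultimately show ?thesis by simp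
  qed
  then show ?thesis
    using continuous_on_subset by blast
qed

lemma continuous_on_phi_comp [continuous_intros]:
  "1 < p \<Longrightarrow> continuous_on S g \<Longrightarrow> continuous_on S (\<lambda>x. phi p (g x))"
  by (rule continuous_on_compose2[OF continuous_on_phi[of p UNIV]]) auto

text \<open>Mean value theorem for t^r, whose derivative is bounded on [0, R]. It makes |y|^{p'}
  Lipschitz on bounded sets for every p > 1, although \<open>phi (conj_exp p)\<close> itself need
  not be Lipschitz.\<close>

lemma abs_powr_lipschitz:
  fixes a b r R :: real
  assumes "1 < r" "\<bar>a\<bar> \<le> R" "\<bar>b\<bar> \<le> R"
  shows "\<bar>\<bar>a\<bar> powr r - \<bar>b\<bar> powr r\<bar> \<le> r * R powr (r - 1) * \<bar>a - b\<bar>"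
proof -
  have main: "t powr r - s powr r \<le> r * R powr (r - 1) * (t - s)"
    if "0 \<le> s" "s \<le> t" "t \<le> R" for s t
  proof (cases "s = t")
    case False
    then have "s < t" using that by linarith
    moreover have "continuous_on {s..t} (\<lambda>x. x powr r)"
      using assms that by (intro continuous_on_powr' continuous_intros) auto
    moreover have "((\<lambda>x. x powr r) has_real_derivative r * x powr (r - 1)) (at x)"
      if "s < x" "x < t" for x
      using that \<open>0 \<le> s\<close> by (auto intro!: derivative_eq_intros simp: powr_diff)
    ultimately obtain x where x: "s < x" "x < t"
      "t powr r - s powr r = (t - s) * (r * x powr (r - 1))"
      using MVT[of s t "\<lambda>x. x powr r"] DERIV_unique
      by (metis real_differentiable_def)
    have "x powr (r - 1) \<le> R powr (r - 1)"
      using assms x that by (intro powr_mono2) auto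
    then show ?thesis
      using x assms that by (simp add: mult.commute mult_left_mono)
  qed simp
  have "0 \<le> R" using assms by linarith
  have *: "\<bar>\<bar>a\<bar> powr r - \<bar>b\<bar> powr r\<bar> \<le> r * R powr (r - 1) * \<bar>\<bar>a\<bar> - \<bar>b\<bar>\<bar>"
  proof (cases "\<bar>a\<bar> \<le> \<bar>b\<bar>")
    case True
    then show ?thesis
      using main[of "\<bar>a\<bar>" "\<bar>b\<bar>"] assms powr_mono2[of r "\<bar>a\<bar>" "\<bar>b\<bar>"] by simp
  next
    case False
    then show ?thesis
      using main[of "\<bar>b\<bar>" "\<bar>a\<bar>"] assms powr_mono2[of r "\<bar>b\<bar>" "\<bar>a\<bar>"] by simp
  qed
  also have "\<dots> \<le> r * R powr (r - 1) * \<bar>a - b\<bar>"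
    using assms by (intro mult_left_mono) auto
  finally show ?thesis .
qed

section \<open>Maximum principle and comparison\<close>

text \<open>\<open>D\<close> is a difference of functions and \<open>d\<close> the corresponding
  difference of fluxes; only \<open>d\<close> satisfies a differential inequality, and
  \<open>D'\<close> is known by its sign. At a positive maximum of \<open>D\<close> the function
  \<open>d\<close> vanishes, a Gronwall argument keeps it nonnegative to the right, so the maximal
  value spreads to T and by periodicity to all of [0, T].\<close>

lemma maximum_principle_periodic:
  fixes D D' d :: "real \<Rightarrow> real"
  assumes "0 < T"
    and D: "\<And>x. x \<in> {0..T} \<Longrightarrow> (D has_real_derivative D' x) (at x within {0..T})"
    and d: "continuous_on {0..T} d"
    and sgn: "\<And>x. x \<in> {0..T} \<Longrightarrow> sgn (D' x) = sgn (d x)"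
    and ineq: "\<And>x. x \<in> {0<..<T} \<Longrightarrow> 0 < D x \<Longrightarrow>
                 \<exists>e. (d has_real_derivative e) (at x) \<and> - K * \<bar>d x\<bar> \<le> e"
    and per: "D 0 = D T" "d 0 = d T"
    and pos: "\<exists>x\<in>{0..T}. 0 < D x"
  shows "\<exists>M>0. \<forall>x\<in>{0..T}. D x = M \<and> d x = 0"
proof -
  have contD: "continuous_on {0..T} D"
    using D by (meson DERIV_continuous continuous_on_eq_continuous_within)
  obtain x0 where x0: "x0 \<in> {0..T}" and max: "\<And>x. x \<in> {0..T} \<Longrightarrow> D x \<le> D x0"
    using continuous_attains_sup[OF compact_Icc _ contD] \<open>0 < T\<close> by (auto simp: atLeastAtMost_iff)
  define M where "M = D x0"
  have "0 < M"
    using pos max M_def by force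
  have D_le: "D x \<le> M" if "x \<in> {0..T}" for x
    using max that M_def by simp
  have right: "d x \<le> 0" if x: "x \<in> {0..<T}" "D x = M" for x
  proof (rule ccontr)
    assume "\<not> d x \<le> 0"
    then have "0 < D' x"
      using sgn[of x] that by (auto simp: sgn_if split: if_splits)
    then obtain e where e: "0 < e" "\<forall>h>0. x + h \<in> {0..T} \<longrightarrow> h < e \<longrightarrow> D x < D (x + h)"
      using has_real_derivative_pos_inc_right[OF D[of x]] x by auto
    define h where "h = min (e / 2) (T - x)"
    have "D x < D (x + h)"
      using e(1) that by (intro e(2)[rule_format]) (auto simp: h_def min_def)
    then show False
      using D_le[of "x + h"] that e(1) by (auto simp: h_def min_def split: if_splits)
  qed
  have left: "0 \<le> d x" if x: "x \<in> {0<..T}" "D x = M" for x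
  proof (rule ccontr)
    assume "\<not> 0 \<le> d x"
    then have "D' x < 0"
      using sgn[of x] that by (auto simp: sgn_if split: if_splits)
    then obtain e where e: "0 < e" "\<forall>h>0. x - h \<in> {0..T} \<longrightarrow> h < e \<longrightarrow> D x < D (x - h)"
      using has_real_derivative_neg_dec_left[OF D[of x]] x by auto
    define h where "h = min (e / 2) x"
    have "D x < D (x - h)"
      using e(1) that by (intro e(2)[rule_format]) (auto simp: h_def min_def)
    then show False
      using D_le[of "x - h"] that e(1) by (auto simp: h_def min_def split: if_splits)
  qed
  \<comment> \<open>At an endpoint the one-sided derivative gives only one inequality; the other
    comes from the opposite endpoint, where \<open>D\<close> and \<open>d\<close> take the same
    values.\<close>
  have d0: "d x = 0" if x: "x \<in> {0..T}" "D x = M" for x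
  proof -
    consider "x \<in> {0<..<T}" | "x = 0" | "x = T"
      using x by force
    then show ?thesis
      using right[of x] left[of x] right[of 0] left[of T] x per \<open>0 < T\<close>
      by cases auto
  qed
  have propagate: "D x = M" if "y \<in> {0..T}" "D y = M" "x \<in> {y..T}" for x y
  proof (rule ccontr)
    assume "D x \<noteq> M"
    \<comment> \<open>The maximum of \<open>S\<close> is the last point \<open>s\<close> up to
      \<open>x\<close> at which \<open>D\<close> equals \<open>M\<close>; the contradiction will be
      a point \<open>r\<close> beyond it with the same value.\<close>
    define S where "S = {y..x} \<inter> D -` {M}"
    have sub: "{y..x} \<subseteq> {0..T}" using that by auto
    have "closed S"
      unfolding S_def using contD sub
      by (intro continuous_closed_preimage) (auto intro: continuous_on_subset)
    moreover have "bounded S"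
      unfolding S_def by (rule bounded_subset[of "{y..x}"]) auto
    ultimately have "compact S"
      by (simp add: compact_eq_bounded_closed)
    moreover have "y \<in> S" using that by (simp add: S_def)
    ultimately obtain s where s: "s \<in> S" "\<And>t. t \<in> S \<Longrightarrow> t \<le> s"
      using compact_attains_sup[of S] by blast
    have "s < x" "s \<in> {0..T}" "D s = M" "y \<le> s"
      using s \<open>D x \<noteq> M\<close> sub by (auto simp: S_def less_le)
    then have "d s = 0" using d0 by blast
    obtain e where e: "0 < e" "\<And>t. t \<in> {0..T} \<Longrightarrow> \<bar>t - s\<bar> < e \<Longrightarrow> \<bar>D t - D s\<bar> < M"
      using contD \<open>s \<in> {0..T}\<close> \<open>0 < M\<close> unfolding continuous_on_iff dist_real_def by blast
    \<comment> \<open>So near to \<open>s\<close> that \<open>D\<close> stays positive up to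
      \<open>r\<close>; the differential inequality is available only where \<open>D\<close> is
      positive.\<close>
    define r where "r = min x (s + e / 2)"
    have r: "s < r" "r \<le> x" "r - s < e"
      using e \<open>s < x\<close> by (auto simp: r_def)
    then have "r \<in> {0..T}" using sub \<open>s \<in> {0..T}\<close> that by auto
    have Dpos: "0 < D t" if "t \<in> {s..r}" for t
      using e(2)[of t] that r \<open>r \<in> {0..T}\<close> \<open>s \<in> {0..T}\<close> \<open>D s = M\<close> by (auto simp: abs_less_iff)
    have dnn: "0 \<le> d t" if t: "t \<in> {s..r}" for t
    proof (rule ccontr)
      assume "\<not> 0 \<le> d t"
      \<comment> \<open>After the last point \<open>a\<close> with \<open>d a\<close> nonnegative,
        \<open>d\<close> is negative, the inequality reads d' >= K d, and
        \<open>d u * exp (- K * u)\<close> does not decrease; so \<open>d\<close> could not have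
        become negative.\<close>
      define P where "P = {s..t} \<inter> d -` {0..}"
      have sub': "{s..t} \<subseteq> {0..T}" using t r \<open>r \<in> {0..T}\<close> \<open>s \<in> {0..T}\<close> by auto
      have "closed P"
        unfolding P_def using d sub'
        by (intro continuous_closed_preimage) (auto intro: continuous_on_subset)
      moreover have "bounded P"
        unfolding P_def by (rule bounded_subset[of "{s..t}"]) auto
      ultimately have "compact P"
        by (simp add: compact_eq_bounded_closed)
      moreover have "s \<in> P" using t \<open>d s = 0\<close> by (simp add: P_def)
      ultimately obtain a where a: "a \<in> P" "\<And>u. u \<in> P \<Longrightarrow> u \<le> a"
        using compact_attains_sup[of P] by blast
      have "a < t" "0 \<le> d a" "s \<le> a"
        using a \<open>\<not> 0 \<le> d t\<close> by (auto simp: P_def less_le)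
      have neg: "d u < 0" if "a < u" "u \<le> t" for u
        using a(2)[of u] that \<open>s \<le> a\<close> by (force simp: P_def)
      have "d a * exp (- K * a) \<le> d t * exp (- K * t)"
      proof (rule DERIV_nonneg_imp_increasing_open[where f = "\<lambda>u. d u * exp (- K * u)"])
        show "a \<le> t" using \<open>a < t\<close> by simp
        show "continuous_on {a..t} (\<lambda>u. d u * exp (- K * u))"
          using sub' \<open>s \<le> a\<close> by (intro continuous_intros continuous_on_subset[OF d]) auto
        fix u assume u: "a < u" "u < t"
        then have "u \<in> {0<..<T}" "u \<in> {s..r}"
          using t \<open>s \<le> a\<close> \<open>s \<in> {0..T}\<close> \<open>r \<in> {0..T}\<close> by auto
        then obtain v where v: "(d has_real_derivative v) (at u)" "- K * \<bar>d u\<bar> \<le> v"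
          using ineq Dpos by blast
        have "((\<lambda>u. d u * exp (- K * u)) has_real_derivative (v - K * d u) * exp (- K * u)) (at u)"
          using v(1) by (auto intro!: derivative_eq_intros simp: algebra_simps)
        moreover have "0 \<le> (v - K * d u) * exp (- K * u)"
          using neg[of u] u v(2) by simp
        ultimately show "\<exists>y. ((\<lambda>u. d u * exp (- K * u)) has_real_derivative y) (at u) \<and> 0 \<le> y"
          by blast
      qed
      moreover have "0 \<le> d a * exp (- K * a)" using \<open>0 \<le> d a\<close> by simp
      ultimately have "0 \<le> d t"
        by (smt (verit) exp_gt_zero mult_neg_pos)
      then show False using \<open>\<not> 0 \<le> d t\<close> by simp
    qed
    have "D s \<le> D r"
    proof (rule DERIV_nonneg_imp_increasing_open[where f = D])
      show "s \<le> r" using r by simp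
      show "continuous_on {s..r} D"
        using \<open>s \<in> {0..T}\<close> \<open>r \<in> {0..T}\<close> by (intro continuous_on_subset[OF contD]) auto
      fix u assume u: "s < u" "u < r"
      then have "u \<in> {0<..<T}" using \<open>s \<in> {0..T}\<close> \<open>r \<in> {0..T}\<close> by auto
      then have "(D has_real_derivative D' u) (at u)"
        using D[of u] at_within_interior[of u "{0..T}"] by simp
      moreover have "0 \<le> D' u"
        using sgn[of u] dnn[of u] u \<open>u \<in> {0<..<T}\<close> by (auto simp: sgn_if split: if_splits)
      ultimately show "\<exists>y. (D has_real_derivative y) (at u) \<and> 0 \<le> y" by blast
    qed
    then have "r \<in> S"
      using D_le[of r] r \<open>D s = M\<close> \<open>y \<le> s\<close> \<open>r \<in> {0..T}\<close> by (simp add: S_def)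
    then show False using s(2)[of r] r by simp
  qed
  have "D T = M"
    using propagate[OF x0 M_def[symmetric], of T] x0 by simp
  then have "D x = M" if "x \<in> {0..T}" for x
    using propagate[of 0 x] that per(1) \<open>0 < T\<close> by simp
  then show ?thesis
    using \<open>0 < M\<close> d0 by blast
qed

section \<open>Comparison of positive periodic functions through their logarithms\<close>

lemma phi_divide: "phi p (a / b) = phi p a / phi p b"
  by (simp add: phi_def abs_divide powr_divide)

lemma has_real_derivative_phi:
  assumes "0 < s"
  shows "(phi p has_real_derivative (p - 1) * s powr (p - 2)) (at s)"
proof -
  have "((\<lambda>s. s powr (p - 1)) has_real_derivative (p - 1) * s powr (p - 1 - 1)) (at s)"
    using assms by (rule has_real_derivative_powr)
  then have "((\<lambda>s. s powr (p - 1)) has_real_derivative (p - 1) * s powr (p - 2)) (at s)"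
    by (simp add: algebra_simps)
  then show ?thesis
    by (rule has_field_derivative_transform_within_open[where S = "{0<..}"])
      (use assms in \<open>auto simp: phi_pos_eq\<close>)
qed

text \<open>The regularity of a classical solution without the equation: \<open>w\<close> is the
  derivative of the flux, so solutions, subsolutions and supersolutions share this format and differ
  only in the relation between \<open>w\<close> and \<open>u\<close>.\<close>

definition periodic_C1 ::
    "real \<Rightarrow> real \<Rightarrow> (real \<Rightarrow> real) \<Rightarrow> (real \<Rightarrow> real) \<Rightarrow> (real \<Rightarrow> real) \<Rightarrow> bool" where
  "periodic_C1 T p u du w \<longleftrightarrow>
     (\<forall>x\<in>{0..T}. (u has_real_derivative du x) (at x within {0..T})) \<and>
     continuous_on {0..T} du \<and>
     (\<forall>x\<in>{0<..<T}. ((\<lambda>y. phi p (du y)) has_real_derivative w x) (at x)) \<and>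
     u 0 = u T \<and> du 0 = du T"

lemma periodic_C1D:
  assumes "periodic_C1 T p u du w"
  shows "\<And>x. x \<in> {0..T} \<Longrightarrow> (u has_real_derivative du x) (at x within {0..T})"
    and "continuous_on {0..T} du"
    and "\<And>x. x \<in> {0<..<T} \<Longrightarrow> ((\<lambda>y. phi p (du y)) has_real_derivative w x) (at x)"
    and "u 0 = u T" "du 0 = du T"
    and "continuous_on {0..T} u"
  using assms unfolding periodic_C1_def
  by (auto simp: continuous_on_eq_continuous_within intro: DERIV_continuous)

lemma periodic_C1_deriv_at:
  assumes "periodic_C1 T p u du w" "x \<in> {0<..<T}"
  shows "(u has_real_derivative du x) (at x)"
  using periodic_C1D(1)[OF assms(1), of x] assms(2) at_within_interior[of x "{0..T}"] by simp

text \<open>Homogeneity turns the flux of \<open>ln u\<close> into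
  \<open>phi p (du) / phi p (u)\<close>. Only \<open>phi p\<close> at the positive value
  \<open>u x\<close> is differentiated, so zeros of \<open>du\<close> do no harm even if p <
  2.\<close>

lemma has_real_derivative_log_flux:
  assumes "1 < p" "0 < u x" "(u has_real_derivative du x) (at x)"
    "((\<lambda>y. phi p (du y)) has_real_derivative w) (at x)"
  shows "((\<lambda>y. phi p (du y / u y)) has_real_derivative
      w / phi p (u x) - (p - 1) * \<bar>phi p (du x / u x)\<bar> powr conj_exp p) (at x)"
proof -
  have "((\<lambda>y. phi p (u y)) has_real_derivative (p - 1) * u x powr (p - 2) * du x) (at x)"
    using DERIV_chain2[OF has_real_derivative_phi assms(3)] assms(2) by simp
  then have "((\<lambda>y. phi p (du y) / phi p (u y)) has_real_derivative
     (w * phi p (u x) - phi p (du x) * ((p - 1) * u x powr (p - 2) * du x))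
       / (phi p (u x) * phi p (u x))) (at x)"
    using assms(2,4) phi_pos[of "u x" p] by (intro DERIV_divide) auto
  moreover have "(w * phi p (u x) - phi p (du x) * ((p - 1) * u x powr (p - 2) * du x))
       / (phi p (u x) * phi p (u x)) =
      w / phi p (u x) - (p - 1) * (phi p (du x) * du x) * (u x powr (p - 2) / (phi p (u x) * phi p (u x)))"
    using phi_pos[OF assms(2), of p] by (simp add: field_simps)
  moreover have "u x powr (p - 2) / (phi p (u x) * phi p (u x)) = 1 / u x powr p"
  proof -
    have "u x powr (p - 2) * u x powr p = phi p (u x) * phi p (u x)"
      using assms(2) by (simp add: phi_pos_eq powr_add[symmetric] algebra_simps)
    then show ?thesis
      using assms(2) phi_pos[OF assms(2), of p] by (simp add: field_simps)
  qed
  moreover have "\<bar>phi p (du x / u x)\<bar> powr conj_exp p = \<bar>du x\<bar> powr p / u x powr p"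
    using assms(1,2) by (simp add: abs_powr_conj_phi abs_divide powr_divide)
  ultimately show ?thesis
    by (simp add: phi_divide phi_mult_self)
qed

text \<open>With \<open>z = ln u\<close> the operator \<open>(\<phi>\<^sub>p(u'))' / \<phi>\<^sub>p(u)\<close> becomes
  \<open>(\<phi>\<^sub>p(z'))' + (p - 1) \<bar>z'\<bar>\<^sup>p\<close>, which contains no undifferentiated \<open>z\<close> and is locally
  Lipschitz in \<open>\<phi>\<^sub>p(z')\<close>; so the maximum principle applies to \<open>ln u - ln v\<close>.\<close>

lemma comparison:
  assumes T: "0 < T" and p: "1 < p"
    and u: "periodic_C1 T p u du w" and v: "periodic_C1 T p v dv z"
    and upos: "\<And>x. x \<in> {0..T} \<Longrightarrow> 0 < u x" and vpos: "\<And>x. x \<in> {0..T} \<Longrightarrow> 0 < v x"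
    and ineq: "\<And>x. x \<in> {0<..<T} \<Longrightarrow> v x < u x \<Longrightarrow> z x / phi p (v x) \<le> w x / phi p (u x)"
  shows "(\<forall>x\<in>{0..T}. u x \<le> v x) \<or>
         (\<forall>x\<in>{0..T}. v x < u x) \<and> (\<forall>x\<in>{0<..<T}. w x / phi p (u x) = z x / phi p (v x))"
proof (cases "\<forall>x\<in>{0..T}. u x \<le> v x")
  case False
  define D where "D = (\<lambda>x. ln (u x) - ln (v x))"
  define a where "a = (\<lambda>x. phi p (du x / u x))"
  define b where "b = (\<lambda>x. phi p (dv x / v x))"
  have conta: "continuous_on {0..T} a" and contb: "continuous_on {0..T} b"
    unfolding a_def b_def using periodic_C1D[OF u] periodic_C1D[OF v] upos vpos p
    by (auto intro!: continuous_intros simp: less_imp_neq[symmetric])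
  have "bounded (a ` {0..T} \<union> b ` {0..T})"
    using conta contb by (intro compact_imp_bounded compact_Un compact_continuous_image) auto
  then obtain R where "\<forall>y\<in>a ` {0..T} \<union> b ` {0..T}. \<bar>y\<bar> \<le> R"
    unfolding bounded_iff real_norm_def by blast
  then have R: "\<bar>a x\<bar> \<le> R" "\<bar>b x\<bar> \<le> R" if "x \<in> {0..T}" for x
    using that by blast+
  \<comment> \<open>A Lipschitz constant of (p - 1) |y|^{p'} on an interval that contains the fluxes
    of both logarithms.\<close>
  define K where "K = (p - 1) * (conj_exp p * R powr (conj_exp p - 1))"
  have der: "((\<lambda>x. a x - b x) has_real_derivative
       (w x / phi p (u x) - z x / phi p (v x))
        - (p - 1) * (\<bar>a x\<bar> powr conj_exp p - \<bar>b x\<bar> powr conj_exp p)) (at x)"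
    if "x \<in> {0<..<T}" for x
  proof -
    have "((\<lambda>x. a x - b x) has_real_derivative
       (w x / phi p (u x) - (p - 1) * \<bar>a x\<bar> powr conj_exp p) -
       (z x / phi p (v x) - (p - 1) * \<bar>b x\<bar> powr conj_exp p)) (at x)"
      unfolding a_def b_def
      using that upos[of x] vpos[of x] periodic_C1_deriv_at[OF u that] periodic_C1_deriv_at[OF v that]
        periodic_C1D(3)[OF u that] periodic_C1D(3)[OF v that] p
      by (intro DERIV_diff has_real_derivative_log_flux) auto
    then show ?thesis by (simp add: algebra_simps)
  qed
  have "\<exists>M>0. \<forall>x\<in>{0..T}. D x = M \<and> a x - b x = 0"
  proof (rule maximum_principle_periodic[where D' = "\<lambda>x. du x / u x - dv x / v x" and K = K])
    show "0 < T" by fact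
    show "(D has_real_derivative du x / u x - dv x / v x) (at x within {0..T})" if "x \<in> {0..T}" for x
      unfolding D_def using periodic_C1D(1)[OF u that] periodic_C1D(1)[OF v that] upos[OF that] vpos[OF that]
      by (auto intro!: derivative_eq_intros simp: field_simps)
    show "continuous_on {0..T} (\<lambda>x. a x - b x)"
      using conta contb by (intro continuous_intros)
    show "sgn (du x / u x - dv x / v x) = sgn (a x - b x)" for x
      unfolding a_def b_def using p by (simp add: sgn_phi_diff)
    show "\<exists>e. ((\<lambda>x. a x - b x) has_real_derivative e) (at x) \<and> - K * \<bar>a x - b x\<bar> \<le> e"
      if x: "x \<in> {0<..<T}" and "0 < D x" for x
    proof -
      have "v x < u x"
        using x \<open>0 < D x\<close> upos[of x] vpos[of x] by (simp add: D_def)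
      then have "0 \<le> w x / phi p (u x) - z x / phi p (v x)"
        using ineq[OF x] by simp
      moreover have "\<bar>a x\<bar> powr conj_exp p - \<bar>b x\<bar> powr conj_exp p
          \<le> conj_exp p * R powr (conj_exp p - 1) * \<bar>a x - b x\<bar>"
        using abs_powr_lipschitz[OF conj_exp_gt_1[OF p] R(1)[of x] R(2)[of x]] x by simp
      then have "(p - 1) * (\<bar>a x\<bar> powr conj_exp p - \<bar>b x\<bar> powr conj_exp p) \<le> K * \<bar>a x - b x\<bar>"
        using p unfolding K_def mult.assoc by (intro mult_left_mono) auto
      ultimately show ?thesis
        using der[OF x] by (intro exI conjI) (assumption, simp)
    qed
    show "D 0 = D T" "a 0 - b 0 = a T - b T"
      using periodic_C1D(4,5)[OF u] periodic_C1D(4,5)[OF v] by (auto simp: D_def a_def b_def)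
    show "\<exists>x\<in>{0..T}. 0 < D x"
    proof -
      obtain x where "x \<in> {0..T}" "v x < u x"
        using False by (auto simp: not_le)
      then show ?thesis
        using upos[of x] vpos[of x] by (intro bexI[of _ x]) (auto simp: D_def)
    qed
  qed
  then obtain M where M: "0 < M" "\<And>x. x \<in> {0..T} \<Longrightarrow> D x = M" "\<And>x. x \<in> {0..T} \<Longrightarrow> a x = b x"
    by auto
  have "v x < u x" if "x \<in> {0..T}" for x
    using M(1) M(2)[OF that] ln_less_cancel_iff[OF vpos[OF that] upos[OF that]] by (simp add: D_def)
  \<comment> \<open>The two fluxes coincide on [0, T], so the derivative of their difference is 0,
    and in the formula \<open>der\<close> only the two quotients remain.\<close>
  moreover have "w x / phi p (u x) = z x / phi p (v x)" if x: "x \<in> {0<..<T}" for x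
  proof -
    have "((\<lambda>x. a x - b x) has_real_derivative 0) (at x)"
      by (rule has_field_derivative_transform_within_open[of "\<lambda>_. 0", where S = "{0<..<T}"])
        (use x M(3) in auto)
    then have "(w x / phi p (u x) - z x / phi p (v x))
        - (p - 1) * (\<bar>a x\<bar> powr conj_exp p - \<bar>b x\<bar> powr conj_exp p) = 0"
      using DERIV_unique[OF der[OF x]] by blast
    then show ?thesis using M(3)[of x] x by simp
  qed
  ultimately show ?thesis by blast
qed simp

section \<open>Weak derivatives\<close>

lemma continuous_on_Icc_bounded:
  fixes f :: "real \<Rightarrow> real"
  assumes "continuous_on {a..b} f"
  obtains B where "0 < B" "\<And>x. x \<in> {a..b} \<Longrightarrow> \<bar>f x\<bar> \<le> B"
proof -
  have "bounded (f ` {a..b})"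
    using assms by (intro compact_imp_bounded compact_continuous_image) auto
  then obtain B where "0 < B" "\<forall>y\<in>f ` {a..b}. \<bar>y\<bar> \<le> B"
    unfolding bounded_pos real_norm_def by blast
  then show ?thesis
    using that[of B] by blast
qed

section \<open>Spline step functions and mollification\<close>

lemma has_real_derivative_max_square:
  "((\<lambda>t. (max 0 t)\<^sup>2) has_real_derivative 2 * max 0 t) (at (t :: real))"
proof -
  consider "t < 0" | "t > 0" | "t = 0" by linarith
  then show ?thesis
  proof cases
    case 1
    have "((\<lambda>t. (max 0 t)\<^sup>2) has_real_derivative 0) (at t)"
      by (rule has_field_derivative_transform_within_open[of "\<lambda>_. 0", where S = "{..<0}"])
        (use 1 in auto)
    then show ?thesis using 1 by simp
  next
    case 2
    have "((\<lambda>t. t\<^sup>2) has_real_derivative 2 * t) (at t)"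
      by (auto intro!: derivative_eq_intros)
    then have "((\<lambda>t. (max 0 t)\<^sup>2) has_real_derivative 2 * t) (at t)"
      by (rule has_field_derivative_transform_within_open[where S = "{0<..}"]) (use 2 in auto)
    then show ?thesis using 2 by simp
  next
    case 3
    have "((\<lambda>h. (max 0 h)\<^sup>2 / h) \<longlongrightarrow> 0) (at (0::real))"
    proof (rule Lim_null_comparison)
      show "\<forall>\<^sub>F h in at 0. norm ((max 0 h)\<^sup>2 / h) \<le> \<bar>h::real\<bar>"
        by (auto simp: eventually_at_filter power2_eq_square max_def)
      show "((\<lambda>h. \<bar>h\<bar>) \<longlongrightarrow> 0) (at (0::real))"
        using tendsto_rabs[OF tendsto_ident_at[of "0::real" UNIV]] by simp
    qed
    then show ?thesis using 3 by (simp add: DERIV_def)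
  qed
qed

text \<open>A tent of integral 1 supported on [0, 1]; \<open>smooth_step\<close> is its primitive.
  Membership in \<open>C1c\<close> asks for one continuous derivative, so quadratic splines suffice,
  and writing both through \<open>max 0\<close> reduces differentiation to a single
  computation.\<close>

definition hat :: "real \<Rightarrow> real" where
  "hat t = 4 * max 0 t - 8 * max 0 (t - 1/2) + 4 * max 0 (t - 1)"

definition smooth_step :: "real \<Rightarrow> real" where
  "smooth_step t = 2 * (max 0 t)\<^sup>2 - 4 * (max 0 (t - 1/2))\<^sup>2 + 2 * (max 0 (t - 1))\<^sup>2"

lemma hat_nonneg: "0 \<le> hat t"
  by (auto simp: hat_def max_def)

lemma hat_le: "hat t \<le> 2"
  by (auto simp: hat_def max_def)

lemma hat_eq_0: "t \<notin> {0..1} \<Longrightarrow> hat t = 0"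
  by (auto simp: hat_def max_def)

lemma continuous_on_hat: "continuous_on S hat"
  unfolding hat_def by (intro continuous_intros)

lemma smooth_step_left: "t \<le> 0 \<Longrightarrow> smooth_step t = 0"
  by (auto simp: smooth_step_def max_def)

lemma smooth_step_right: "1 \<le> t \<Longrightarrow> smooth_step t = 1"
  by (auto simp: smooth_step_def max_def power2_eq_square algebra_simps)

lemma has_real_derivative_smooth_step:
  "(smooth_step has_real_derivative hat t) (at t)"
proof -
  have *: "((\<lambda>t. (max 0 (t - a))\<^sup>2) has_real_derivative 2 * max 0 (t - a)) (at t)" for a
    by (rule DERIV_chain2[where g = "\<lambda>t. t - a" and Db = 1, OF has_real_derivative_max_square, simplified])
      (auto intro!: derivative_eq_intros)
  have "(smooth_step has_real_derivative
      2 * (2 * max 0 t) - 4 * (2 * max 0 (t - 1/2)) + 2 * (2 * max 0 (t - 1))) (at t)"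
    unfolding smooth_step_def[abs_def]
    by (intro DERIV_add DERIV_diff DERIV_cmult * has_real_derivative_max_square)
  then show ?thesis
    by (simp add: hat_def)
qed

lemma smooth_step_bounds: "0 \<le> smooth_step t" "smooth_step t \<le> 1"
proof -
  have mono: "smooth_step s \<le> smooth_step t" if "s \<le> t" for s t
  proof (rule DERIV_nonneg_imp_nondecreasing[OF that])
    fix x
    show "\<exists>y. (smooth_step has_real_derivative y) (at x) \<and> 0 \<le> y"
      using has_real_derivative_smooth_step[of x] hat_nonneg[of x] by blast
  qed
  show "0 \<le> smooth_step t"
    using mono[of "min t 0" t] smooth_step_left[of "min t 0"] by simp
  show "smooth_step t \<le> 1"
    using mono[of t "max t 1"] smooth_step_right[of "max t 1"] by simp
qed

lemma integral_hat: "integral\<^sup>L lborel hat = 1"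
proof -
  have "integral\<^sup>L lborel (\<lambda>t. hat t * indicator {0..1} t) = smooth_step 1 - smooth_step 0"
    using has_real_derivative_smooth_step continuous_on_hat[of UNIV]
    by (intro integral_FTC_Icc_real) (auto simp: continuous_on_eq_continuous_at)
  also have "(\<lambda>t. hat t * indicator {0..1} t) = hat"
    using hat_eq_0 by (auto simp: indicator_def fun_eq_iff)
  finally show ?thesis
    by (simp add: smooth_step_left smooth_step_right)
qed

text \<open>The substitution x = a + s / (n + 1) turns the weight into the fixed function
  \<open>hat\<close> and moves n into the argument of \<open>u\<close>; dominated convergence and
  continuity of \<open>u\<close> at the interior point \<open>a\<close> do the rest.\<close>

lemma mollify:
  assumes u: "continuous_on {0..T} u" and a: "a \<in> {0<..<T}"
  shows "(\<lambda>n. LINT x:{0<..<T}|lborel. u x * (real (Suc n) * hat (real (Suc n) * (x - a)))) \<longlonglongrightarrow> u a"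
proof -
  \<comment> \<open>Extension by 0 lets the substitution take place on the whole line.\<close>
  define g where "g = (\<lambda>x. indicator {0<..<T} x * u x)"
  have g: "g \<in> borel_measurable borel"
    using borel_measurable_continuous_on_indicator[of "{0<..<T}" u] continuous_on_subset[OF u]
    by (simp add: g_def greaterThanLessThan_subseteq_atLeastAtMost_iff)
  obtain B where "0 < B" and B: "\<And>x. x \<in> {0..T} \<Longrightarrow> \<bar>u x\<bar> \<le> B"
    using continuous_on_Icc_bounded[OF u] by blast
  then have "0 \<le> B" by simp
  then have gB: "\<bar>g x\<bar> \<le> B" for x
    using B[of x] by (auto simp: g_def indicator_def)
  have hat_meas: "hat \<in> borel_measurable borel"
    by (rule borel_measurable_continuous_onI[OF continuous_on_hat])
  have "isCont u a"
    using u a by (simp add: continuous_on_interior)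
  have "(\<lambda>n. \<integral>s. g (a + s / real (Suc n)) * hat s \<partial>lborel) \<longlonglongrightarrow> (\<integral>s. u a * hat s \<partial>lborel)"
  proof (rule integral_dominated_convergence[where w = "\<lambda>s. indicator {0..1} s *\<^sub>R (B * 2)"])
    show "(\<lambda>s. u a * hat s) \<in> borel_measurable lborel"
      using hat_meas by measurable
    show "(\<lambda>s. g (a + s / real (Suc n)) * hat s) \<in> borel_measurable lborel" for n
      using hat_meas g by measurable
    show "integrable lborel (\<lambda>s::real. indicator {0..1} s *\<^sub>R (B * 2))"
      using borel_integrable_atLeastAtMost'[of 0 1 "\<lambda>_. B * 2"] by (simp add: set_integrable_def)
    show "AE s in lborel. (\<lambda>n. g (a + s / real (Suc n)) * hat s) \<longlonglongrightarrow> u a * hat s"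
    proof (rule AE_I2)
      fix s :: real
      have lim: "(\<lambda>n. a + s / real (Suc n)) \<longlonglongrightarrow> a"
        using tendsto_add[OF tendsto_const[of a] tendsto_mult[OF tendsto_const[of s] LIMSEQ_inverse_real_of_nat]]
        by (simp add: divide_inverse)
      have "\<forall>\<^sub>F n in sequentially. a + s / real (Suc n) \<in> {0<..<T}"
        by (rule topological_tendstoD[OF lim]) (use a in auto)
      then have "\<forall>\<^sub>F n in sequentially. u (a + s / real (Suc n)) = g (a + s / real (Suc n))"
        by eventually_elim (simp add: g_def)
      moreover have "(\<lambda>n. u (a + s / real (Suc n))) \<longlonglongrightarrow> u a"
        using isCont_tendsto_compose[OF \<open>isCont u a\<close> lim] .
      ultimately have "(\<lambda>n. g (a + s / real (Suc n))) \<longlonglongrightarrow> u a"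
        by (rule Lim_transform_eventually[rotated])
      then show "(\<lambda>n. g (a + s / real (Suc n)) * hat s) \<longlonglongrightarrow> u a * hat s"
        by (intro tendsto_intros)
    qed
    show "AE s in lborel. norm (g (a + s / real (Suc n)) * hat s) \<le> indicator {0..1} s *\<^sub>R (B * 2)" for n
    proof (rule AE_I2)
      fix s :: real
      show "norm (g (a + s / real (Suc n)) * hat s) \<le> indicator {0..1} s *\<^sub>R (B * 2)"
      proof (cases "s \<in> {0..1}")
        case True
        then show ?thesis
          using mult_mono[OF gB[of "a + s / real (Suc n)"] hat_le[of s]] hat_nonneg[of s] \<open>0 \<le> B\<close>
          by (simp add: abs_mult)
      qed (simp add: hat_eq_0)
    qed
  qed
  moreover have "(\<integral>s. u a * hat s \<partial>lborel) = u a"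
    by (simp add: integral_hat)
  moreover have "(LINT x:{0<..<T}|lborel. u x * (real (Suc n) * hat (real (Suc n) * (x - a))))
      = (\<integral>s. g (a + s / real (Suc n)) * hat s \<partial>lborel)" for n
  proof -
    have "(LINT x:{0<..<T}|lborel. u x * (real (Suc n) * hat (real (Suc n) * (x - a))))
       = (\<integral>x. g x * (real (Suc n) * hat (real (Suc n) * (x - a))) \<partial>lborel)"
      by (simp add: set_lebesgue_integral_def g_def mult.assoc)
    also have "\<dots> = \<bar>1 / real (Suc n)\<bar> *\<^sub>R (\<integral>s. g (a + 1 / real (Suc n) * s) *
        (real (Suc n) * hat (real (Suc n) * (a + 1 / real (Suc n) * s - a))) \<partial>lborel)"
      by (rule lborel_integral_real_affine) simp
    also have "\<dots> = (\<integral>s. \<bar>1 / real (Suc n)\<bar> *\<^sub>R (g (a + 1 / real (Suc n) * s) *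
        (real (Suc n) * hat (real (Suc n) * (a + 1 / real (Suc n) * s - a)))) \<partial>lborel)"
      by (rule integral_scaleR_right[symmetric])
    also have "\<dots> = (\<integral>s. g (a + s / real (Suc n)) * hat s \<partial>lborel)"
      by (intro Bochner_Integration.integral_cong) (simp_all add: field_simps del: of_nat_Suc)
    finally show ?thesis .
  qed
  ultimately show ?thesis
    by (simp only:)
qed

text \<open>Dynkin's argument: half-open intervals are stable under intersection and generate the
  Borel sets, so the integral of \<open>f\<close> vanishes over every Borel set, which forces
  \<open>f\<close> to be 0 almost everywhere.\<close>

lemma AE_eq_0_if_integral_Ioc_eq_0:
  fixes f :: "real \<Rightarrow> real"
  assumes f: "integrable lborel f"
    and Ioc: "\<And>c d. (LINT x:{c<..d}|lborel. f x) = 0"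
  shows "AE x in lborel. f x = 0"
proof (rule sigma_finite_measure.density_zero[OF lborel.sigma_finite_measure_axioms f])
  have int: "set_integrable lborel A f" if "A \<in> sets borel" for A
    unfolding set_integrable_def using f that by (intro integrable_mult_indicator) auto
  \<comment> \<open>The step for complements requires the integral over the whole line to
    vanish.\<close>
  have "(LINT x:(\<Union>n. {- real n<..real n})|lborel. f x) = 0"
  proof (rule LIMSEQ_unique)
    show "(\<lambda>n. LINT x:{- real n<..real n}|lborel. f x)
        \<longlonglongrightarrow> (LINT x:(\<Union>n. {- real n<..real n})|lborel. f x)"
      by (rule set_integral_cont_up) (auto simp: incseq_def intro!: int)
    show "(\<lambda>n. LINT x:{- real n<..real n}|lborel. f x) \<longlonglongrightarrow> 0"
      by (simp add: Ioc)
  qed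
  moreover have "(\<Union>n. {- real n<..real n}) = UNIV"
  proof (intro equalityI subsetI)
    fix x :: real
    obtain n :: nat where "\<bar>x\<bar> < real n" using reals_Archimedean2 by blast
    then have "x \<in> {- real n<..real n}" by auto
    then show "x \<in> (\<Union>n. {- real n<..real n})" by blast
  qed auto
  ultimately have UNIV: "(LINT x:UNIV|lborel. f x) = 0" by simp
  fix A :: "real set" assume "A \<in> sets lborel"
  then have A: "A \<in> sigma_sets UNIV (range (\<lambda>(a, b). {a<..b::real}))"
    by (simp add: borel_sigma_sets_Ioc)
  have "Int_stable (range (\<lambda>(a, b). {a<..b::real}))"
    by (auto simp: Int_stable_def)
  moreover have "range (\<lambda>(a, b). {a<..b::real}) \<subseteq> Pow UNIV"
    by auto
  ultimately show "(LINT x:A|lborel. f x) = 0"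
    using A
  proof (induction rule: sigma_sets_induct_disjoint)
    case (basic A)
    then show ?case using Ioc by auto
  next
    case empty
    then show ?case by (simp add: set_lebesgue_integral_def)
  next
    case (compl A)
    then have A: "A \<in> sets borel" by (simp add: borel_sigma_sets_Ioc)
    have "(LINT x:A \<union> (UNIV - A)|lborel. f x) =
        (LINT x:A|lborel. f x) + (LINT x:UNIV - A|lborel. f x)"
      using A by (intro set_integral_Un int) auto
    then show ?case using compl UNIV by simp
  next
    case (union F)
    then have F: "F i \<in> sets borel" for i by (auto simp: borel_sigma_sets_Ioc)
    have "(LINT x:(\<Union>i. F i)|lborel. f x) = (\<Sum>i. (LINT x:F i|lborel. f x))"
      using F union(1) by (intro lebesgue_integral_countable_add int) (auto simp: disjoint_family_on_def)
    then show ?case using union by simp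
  qed
qed

lemma Lp_fun_integrable:
  assumes "1 \<le> p" "Lp_fun T p g"
  shows "set_integrable lborel {0<..<T} g"
proof (rule set_integrable_bound)
  have "set_integrable lborel {0<..<T} (\<lambda>x. 1 :: real)"
    by (rule set_integrable_subset[OF borel_integrable_atLeastAtMost'[of 0 T]]) auto
  then show "set_integrable lborel {0<..<T} (\<lambda>x. 1 + \<bar>g x\<bar> powr p)"
    using assms(2) by (intro set_integral_add) (auto simp: Lp_fun_def)
  show "set_borel_measurable lborel {0<..<T} g"
    using assms(2) by (simp add: Lp_fun_def)
  have "\<bar>g x\<bar> \<le> 1 + \<bar>g x\<bar> powr p" for x
  proof (cases "\<bar>g x\<bar> \<le> 1")
    case False
    then show ?thesis
      using powr_mono[of 1 p "\<bar>g x\<bar>"] assms(1) by simp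
  qed (simp add: add_increasing2)
  then show "AE x in lborel. x \<in> {0<..<T} \<longrightarrow> norm (g x) \<le> norm (1 + \<bar>g x\<bar> powr p)"
    by (intro AE_I2) (simp add: order.trans)
qed

text \<open>The test functions \<open>smooth_step (n (x - a)) - smooth_step (n (x - b))\<close> tend boundedly to
  the indicator function of \<open>(a, b]\<close>, and their derivatives to the difference of the point masses
  at \<open>a\<close> and \<open>b\<close>.\<close>

lemma weak_deriv_increment:
  assumes u: "continuous_on {0..T} u" and g: "set_integrable lborel {0<..<T} g"
    and weak: "has_weak_deriv T u g" and ab: "0 < a" "a < b" "b < T"
  shows "u b - u a = (LINT x:{a<..b}|lborel. g x)"
proof -
  define \<psi> where "\<psi> = (\<lambda>n x. smooth_step (real (Suc n) * (x - a)) - smooth_step (real (Suc n) * (x - b)))"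
  define \<delta> where "\<delta> = (\<lambda>c n x. real (Suc n) * hat (real (Suc n) * (x - c)))"
  have der: "(\<psi> n has_real_derivative \<delta> a n x - \<delta> b n x) (at x)" for n x
    unfolding \<psi>_def \<delta>_def
    by (auto intro!: derivative_eq_intros DERIV_chain2[OF has_real_derivative_smooth_step]
        simp del: of_nat_Suc)
  then have deriv: "deriv (\<psi> n) = (\<lambda>x. \<delta> a n x - \<delta> b n x)" for n
    by (intro ext DERIV_imp_deriv)
  have cont_\<delta>: "continuous_on S (\<delta> c n)" for S c n
    unfolding \<delta>_def
    by (intro continuous_intros continuous_on_compose2[OF continuous_on_hat[of UNIV]]) auto
  \<comment> \<open>The second step is complete only at b + 1 / (n + 1); this point has to lie below
    T for the support to be compact in (0, T).\<close>
  have test: "\<forall>\<^sub>F n in sequentially. \<psi> n \<in> C1c T"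
  proof -
    have "\<forall>\<^sub>F n in sequentially. inverse (real (Suc n)) < T - b"
      using ab order_tendstoD(2)[OF LIMSEQ_inverse_real_of_nat, of "T - b"] by simp
    then show ?thesis
    proof eventually_elim
      case (elim n)
      have n: "0 < real (Suc n)" by simp
      have "\<psi> n x = 0" if x: "x \<notin> {a..b + inverse (real (Suc n))}" for x
      proof (cases "x < a")
        case True
        then have "real (Suc n) * (x - a) \<le> 0" "real (Suc n) * (x - b) \<le> 0"
          using ab by (auto simp: mult_le_0_iff)
        then show ?thesis
          by (simp add: \<psi>_def smooth_step_left del: of_nat_Suc)
      next
        case False
        then have "inverse (real (Suc n)) \<le> x - b" using x by auto
        then have "1 \<le> real (Suc n) * (x - b)"
          using n by (simp add: field_simps del: of_nat_Suc)
        moreover have "real (Suc n) * (x - b) \<le> real (Suc n) * (x - a)"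
          using ab by (intro mult_left_mono) auto
        ultimately have "1 \<le> real (Suc n) * (x - b)" "1 \<le> real (Suc n) * (x - a)"
          by linarith+
        then show ?thesis
          by (simp add: \<psi>_def smooth_step_right del: of_nat_Suc)
      qed
      moreover have "\<psi> n differentiable at x" for x
        using der real_differentiable_def by blast
      moreover have "continuous_on UNIV (deriv (\<psi> n))"
        unfolding deriv by (intro continuous_intros cont_\<delta>)
      ultimately show ?case
        using ab elim unfolding C1c_def by (intro CollectI conjI allI exI[of _ a]
            exI[of _ "b + inverse (real (Suc n))"]) auto
    qed
  qed
  have int_\<delta>: "set_integrable lborel {0<..<T} (\<lambda>x. u x * \<delta> c n x)" for c n
    by (rule set_integrable_subset[OF borel_integrable_atLeastAtMost'[of 0 T]])
      (auto intro!: continuous_intros u cont_\<delta>)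
  have "\<forall>\<^sub>F n in sequentially. (LINT x:{0<..<T}|lborel. u x * \<delta> a n x) - (LINT x:{0<..<T}|lborel. u x * \<delta> b n x)
      = - (LINT x:{0<..<T}|lborel. g x * \<psi> n x)"
    using test
  proof eventually_elim
    case (elim n)
    then have "(LINT x:{0<..<T}|lborel. u x * deriv (\<psi> n) x) = - (LINT x:{0<..<T}|lborel. g x * \<psi> n x)"
      using weak by (simp add: has_weak_deriv_def)
    then show ?case
      using set_integral_diff(2)[OF int_\<delta>[of a n] int_\<delta>[of b n]]
      by (simp add: deriv right_diff_distrib)
  qed
  moreover have "(\<lambda>n. (LINT x:{0<..<T}|lborel. u x * \<delta> a n x) - (LINT x:{0<..<T}|lborel. u x * \<delta> b n x))
      \<longlonglongrightarrow> u a - u b"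
    unfolding \<delta>_def using ab by (intro tendsto_diff mollify u) auto
  ultimately have 1: "(\<lambda>n. - (LINT x:{0<..<T}|lborel. g x * \<psi> n x)) \<longlonglongrightarrow> u a - u b"
    using Lim_transform_eventually by fast
  have gm: "(\<lambda>x. indicator {0<..<T} x * g x) \<in> borel_measurable borel"
    using g by (auto simp: set_integrable_def dest: borel_measurable_integrable)
  have \<psi>m: "\<psi> n \<in> borel_measurable borel" for n
    using der by (intro borel_measurable_continuous_onI continuous_at_imp_continuous_on ballI DERIV_isCont) blast
  have "(\<lambda>n. \<integral>x. (indicator {0<..<T} x * g x) * \<psi> n x \<partial>lborel)
      \<longlonglongrightarrow> (\<integral>x. (indicator {0<..<T} x * g x) * indicator {a<..b} x \<partial>lborel)"
  proof (rule integral_dominated_convergence[where w = "\<lambda>x. \<bar>indicator {0<..<T} x * g x\<bar>"])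
    show "(\<lambda>x. (indicator {0<..<T} x * g x) * indicator {a<..b} x) \<in> borel_measurable lborel"
      using gm by measurable
    show "(\<lambda>x. (indicator {0<..<T} x * g x) * \<psi> n x) \<in> borel_measurable lborel" for n
      using gm \<psi>m by measurable
    show "integrable lborel (\<lambda>x. \<bar>indicator {0<..<T} x * g x\<bar>)"
      using g by (simp add: set_integrable_def)
    show "AE x in lborel. (\<lambda>n. (indicator {0<..<T} x * g x) * \<psi> n x)
        \<longlonglongrightarrow> (indicator {0<..<T} x * g x) * indicator {a<..b} x"
    proof (intro AE_I2 tendsto_mult tendsto_const)
      fix x :: real
      \<comment> \<open>At x = c the step still has the value 0; hence the limiting interval is open
        at \<open>a\<close> and closed at \<open>b\<close>.\<close>
      have step: "(\<lambda>n. smooth_step (real (Suc n) * (x - c))) \<longlonglongrightarrow> (if c < x then 1 else 0)" for c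
      proof (cases "c < x")
        case True
        have "\<forall>\<^sub>F n in sequentially. inverse (real (Suc n)) < x - c"
          using True order_tendstoD(2)[OF LIMSEQ_inverse_real_of_nat, of "x - c"] by simp
        then have "\<forall>\<^sub>F n in sequentially. smooth_step (real (Suc n) * (x - c)) = 1"
          by eventually_elim (simp add: smooth_step_right field_simps del: of_nat_Suc)
        then show ?thesis using True by (simp add: tendsto_eventually)
      next
        case False
        then have "smooth_step (real (Suc n) * (x - c)) = 0" for n
          by (intro smooth_step_left) (simp add: mult_nonneg_nonpos)
        then show ?thesis using False by simp
      qed
      have "(\<lambda>n. \<psi> n x) \<longlonglongrightarrow> (if a < x then 1 else 0) - (if b < x then 1 else 0)"
        unfolding \<psi>_def by (intro tendsto_diff step)
      also have "(if a < x then 1 else 0) - (if b < x then 1 else 0) = indicat_real {a<..b} x"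
        using ab by auto
      finally show "(\<lambda>n. \<psi> n x) \<longlonglongrightarrow> indicat_real {a<..b} x" .
    qed
    show "AE x in lborel. norm ((indicator {0<..<T} x * g x) * \<psi> n x) \<le> \<bar>indicator {0<..<T} x * g x\<bar>" for n
    proof (rule AE_I2)
      fix x
      have "\<bar>\<psi> n x\<bar> \<le> 1"
        using smooth_step_bounds[of "real (Suc n) * (x - a)"] smooth_step_bounds[of "real (Suc n) * (x - b)"]
        unfolding \<psi>_def abs_le_iff by linarith
      then show "norm ((indicator {0<..<T} x * g x) * \<psi> n x) \<le> \<bar>indicator {0<..<T} x * g x\<bar>"
        using mult_left_mono[of "\<bar>\<psi> n x\<bar>" 1 "\<bar>indicator {0<..<T} x * g x\<bar>"] by (simp add: abs_mult)
    qed
  qed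
  moreover have "(indicator {0<..<T} x * g x) * indicator {a<..b} x = indicator {a<..b} x * g x" for x
    using ab by (auto simp: indicator_def)
  ultimately have "(\<lambda>n. \<integral>x. (indicator {0<..<T} x * g x) * \<psi> n x \<partial>lborel)
      \<longlonglongrightarrow> (\<integral>x. indicator {a<..b} x * g x \<partial>lborel)"
    by (simp only:)
  then have "(\<lambda>n. - (LINT x:{0<..<T}|lborel. g x * \<psi> n x)) \<longlonglongrightarrow> - (LINT x:{a<..b}|lborel. g x)"
    by (intro tendsto_minus) (simp add: set_lebesgue_integral_def mult.assoc)
  from LIMSEQ_unique[OF 1 this] show ?thesis by simp
qed

lemma C1cD:
  assumes "\<psi> \<in> C1c T"
  shows "continuous_on S \<psi>" "continuous_on S (deriv \<psi>)"
    and "(\<psi> has_real_derivative deriv \<psi> x) (at x)"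
proof -
  have \<psi>: "(\<psi> has_real_derivative deriv \<psi> x) (at x)" for x
    using assms by (simp add: C1c_def DERIV_deriv_iff_real_differentiable)
  then show "(\<psi> has_real_derivative deriv \<psi> x) (at x)" .
  show "continuous_on S \<psi>"
    using \<psi> by (intro continuous_at_imp_continuous_on ballI DERIV_isCont)
  show "continuous_on S (deriv \<psi>)"
    using assms by (auto simp: C1c_def intro: continuous_on_subset)
qed

lemma set_integrable_mult_continuous:
  fixes g h :: "real \<Rightarrow> real"
  assumes g: "set_integrable lborel {0<..<T} g" and h: "continuous_on {0..T} h"
  shows "set_integrable lborel {0<..<T} (\<lambda>x. g x * h x)"
proof -
  obtain B where "0 < B" and B: "\<And>x. x \<in> {0..T} \<Longrightarrow> \<bar>h x\<bar> \<le> B"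
    using continuous_on_Icc_bounded[OF h] by blast
  show ?thesis
  proof (rule set_integrable_bound[where f = "\<lambda>x. B * g x"])
    show "set_integrable lborel {0<..<T} (\<lambda>x. B * g x)"
      using g by simp
    have "(\<lambda>x. indicator {0<..<T} x * g x) \<in> borel_measurable borel"
      using g by (auto simp: set_integrable_def dest: borel_measurable_integrable)
    moreover have "(\<lambda>x. indicator {0<..<T} x * h x) \<in> borel_measurable borel"
      using borel_measurable_continuous_on_indicator[of "{0<..<T}" h] continuous_on_subset[OF h]
      by (simp add: greaterThanLessThan_subseteq_atLeastAtMost_iff)
    ultimately have "(\<lambda>x. (indicator {0<..<T} x * g x) * (indicator {0<..<T} x * h x)) \<in> borel_measurable borel"
      by measurable
    moreover have "(indicator {0<..<T} x * g x) * (indicator {0<..<T} x * h x) = indicator {0<..<T} x * (g x * h x)" for x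
      by (simp add: indicator_def)
    ultimately show "set_borel_measurable lborel {0<..<T} (\<lambda>x. g x * h x)"
      by (simp add: set_borel_measurable_def)
    show "AE x in lborel. x \<in> {0<..<T} \<longrightarrow> norm (g x * h x) \<le> norm (B * g x)"
      using B \<open>0 < B\<close> by (intro AE_I2) (auto simp: abs_mult mult.commute[of B] intro!: mult_left_mono)
  qed
qed

lemma set_integrable_continuous_Ioo:
  "continuous_on {0..T} h \<Longrightarrow> set_integrable lborel {0<..<T} (h :: real \<Rightarrow> real)"
  by (rule set_integrable_subset[OF borel_integrable_atLeastAtMost'[of 0 T]]) auto

lemma has_weak_deriv_diff:
  assumes "set_integrable lborel {0<..<T} u" "set_integrable lborel {0<..<T} v"
    and "set_integrable lborel {0<..<T} g" "set_integrable lborel {0<..<T} h"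
    and "has_weak_deriv T u g" "has_weak_deriv T v h"
  shows "has_weak_deriv T (\<lambda>x. u x - v x) (\<lambda>x. g x - h x)"
  unfolding has_weak_deriv_def
proof
  fix \<psi> assume \<psi>: "\<psi> \<in> C1c T"
  note int = set_integrable_mult_continuous[OF _ C1cD(1)[OF \<psi>]] set_integrable_mult_continuous[OF _ C1cD(2)[OF \<psi>]]
  have "(LINT x:{0<..<T}|lborel. (u x - v x) * deriv \<psi> x) =
     (LINT x:{0<..<T}|lborel. u x * deriv \<psi> x) - (LINT x:{0<..<T}|lborel. v x * deriv \<psi> x)"
    using int(2)[OF assms(1)] int(2)[OF assms(2)] by (simp add: left_diff_distrib)
  moreover have "(LINT x:{0<..<T}|lborel. (g x - h x) * \<psi> x) =
     (LINT x:{0<..<T}|lborel. g x * \<psi> x) - (LINT x:{0<..<T}|lborel. h x * \<psi> x)"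
    using int(1)[OF assms(3)] int(1)[OF assms(4)] by (simp add: left_diff_distrib)
  ultimately show "(LINT x:{0<..<T}|lborel. (u x - v x) * deriv \<psi> x) =
      - (LINT x:{0<..<T}|lborel. (g x - h x) * \<psi> x)"
    using assms(5,6) \<psi> by (simp add: has_weak_deriv_def)
qed

lemma has_weak_deriv_minus:
  assumes "has_weak_deriv T u g"
  shows "has_weak_deriv T (\<lambda>x. - u x) (\<lambda>x. - g x)"
  using assms by (simp add: has_weak_deriv_def set_lebesgue_integral_def)

lemma Lp_fun_minus [simp]: "Lp_fun T p (\<lambda>x. - g x) = Lp_fun T p g"
  by (simp add: Lp_fun_def set_borel_measurable_def)

text \<open>Increments of the zero function vanish, hence so do the integrals of \<open>g\<close>
  over intervals well inside (0, T). As the increment formula demands interior endpoints,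
  \<open>g\<close> is cut off to intervals that exhaust (0, T).\<close>

lemma weak_deriv_0_AE:
  assumes g: "set_integrable lborel {0<..<T} g" and weak: "has_weak_deriv T (\<lambda>_. 0) g"
  shows "AE x in lborel. x \<in> {0<..<T} \<longrightarrow> g x = 0"
proof -
  define a where "a = (\<lambda>n::nat. inverse (real (Suc n)))"
  have a_pos: "0 < a n" for n by (simp add: a_def)
  have "AE x in lborel. indicator {a n<..T - a n} x * g x = 0" for n
  proof (rule AE_eq_0_if_integral_Ioc_eq_0)
    have "set_integrable lborel {a n<..T - a n} g"
      using a_pos[of n] by (intro set_integrable_subset[OF g]) auto
    then show "integrable lborel (\<lambda>x. indicator {a n<..T - a n} x * g x)"
      by (simp add: set_integrable_def)
    fix c d :: real
    define c' d' where "c' = max c (a n)" and "d' = min d (T - a n)"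
    have "(LINT x:{c<..d}|lborel. indicator {a n<..T - a n} x * g x) = (LINT x:{c'<..d'}|lborel. g x)"
      unfolding set_lebesgue_integral_def c'_def d'_def
      by (intro Bochner_Integration.integral_cong) (auto simp: indicator_def)
    also have "\<dots> = 0"
    proof (cases "c' < d'")
      case True
      then show ?thesis
        using weak_deriv_increment[OF _ g weak, of c' d'] a_pos[of n]
        by (auto simp: c'_def d'_def)
    qed (simp add: set_lebesgue_integral_def)
    finally show "(LINT x:{c<..d}|lborel. indicator {a n<..T - a n} x * g x) = 0" .
  qed
  then have "AE x in lborel. \<forall>n. indicator {a n<..T - a n} x * g x = 0"
    unfolding AE_all_countable by blast
  then show ?thesis
  proof (rule AE_mp, intro AE_I2 impI)
    fix x assume *: "\<forall>n. indicator {a n<..T - a n} x * g x = 0" and x: "x \<in> {0<..<T}"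
    have "\<forall>\<^sub>F n in sequentially. a n < min x (T - x)"
      unfolding a_def using x by (intro order_tendstoD(2)[OF LIMSEQ_inverse_real_of_nat]) auto
    then obtain n where "a n < min x (T - x)"
      by (meson eventually_happens' sequentially_bot)
    then have "x \<in> {a n<..T - a n}" by auto
    then show "g x = 0" using *[rule_format, of n] by simp
  qed
qed

lemma weak_deriv_unique:
  assumes "1 \<le> p" "Lp_fun T p g" "Lp_fun T p h"
    and "has_weak_deriv T u g" "has_weak_deriv T u h"
  shows "AE x in lborel. x \<in> {0<..<T} \<longrightarrow> g x = h x"
proof -
  have gh: "set_integrable lborel {0<..<T} g" "set_integrable lborel {0<..<T} h"
    using assms Lp_fun_integrable by blast+
  have "has_weak_deriv T (\<lambda>_. 0) (\<lambda>x. g x - h x)"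
    unfolding has_weak_deriv_def
  proof
    fix \<psi> assume \<psi>: "\<psi> \<in> C1c T"
    note int = set_integrable_mult_continuous[OF _ C1cD(1)[OF \<psi>]]
    have "(LINT x:{0<..<T}|lborel. (g x - h x) * \<psi> x) =
     (LINT x:{0<..<T}|lborel. g x * \<psi> x) - (LINT x:{0<..<T}|lborel. h x * \<psi> x)"
      using int[OF gh(1)] int[OF gh(2)] by (simp add: left_diff_distrib)
    then show "(LINT x:{0<..<T}|lborel. 0 * deriv \<psi> x) = - (LINT x:{0<..<T}|lborel. (g x - h x) * \<psi> x)"
      using assms(4,5) \<psi> by (simp add: has_weak_deriv_def)
  qed
  from weak_deriv_0_AE[OF _ this] gh show ?thesis
    by (simp add: set_integral_diff)
qed

text \<open>The locale \<open>Metric_space\<close> demands symmetry of the distance for arbitrary functions, so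
  the integrands compared in \<open>X_norm_eq\<close> need not be measurable.\<close>

lemma integral_cong_AE_measurable_diff:
  fixes f g :: "'a \<Rightarrow> real"
  assumes "(\<lambda>x. f x - g x) \<in> borel_measurable M" "AE x in M. f x = g x"
  shows "integral\<^sup>L M f = integral\<^sup>L M g"
proof (cases "f \<in> borel_measurable M")
  case True
  then have "(\<lambda>x. f x - (f x - g x)) \<in> borel_measurable M"
    using assms(1) by (rule borel_measurable_diff)
  then show ?thesis
    using True assms(2) by (intro integral_cong_AE) auto
next
  case False
  have "g \<notin> borel_measurable M"
  proof
    assume "g \<in> borel_measurable M"
    then have "(\<lambda>x. (f x - g x) + g x) \<in> borel_measurable M"
      using assms(1) by (intro borel_measurable_add)
    then show False using False by simp
  qed
  then show ?thesis
    using False borel_measurable_integrable not_integrable_integral_eq by metis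
qed

section \<open>The metric space of periodic Sobolev functions\<close>

text \<open>The p-th power of the norm with the weak derivative as an explicit argument, which takes
  the choice in \<open>wderiv\<close> out of all estimates.\<close>

definition X_energy ::
    "real \<Rightarrow> real \<Rightarrow> (real \<Rightarrow> real) \<Rightarrow> (real \<Rightarrow> real) \<Rightarrow> (real \<Rightarrow> real) \<Rightarrow> real" where
  "X_energy T p q u g = (LINT x:{0<..<T}|lborel. \<bar>g x\<bar> powr p + q x * \<bar>u x\<bar> powr p)"

lemma X_norm_eq:
  assumes "1 \<le> p" "Lp_fun T p g" "has_weak_deriv T u g"
  shows "X_norm T p q u = X_energy T p q u g powr (1 / p)"
proof -
  define h where "h = wderiv T p u"
  have h: "Lp_fun T p h \<and> has_weak_deriv T u h"
    unfolding h_def wderiv_def by (rule someI[of _ g]) (use assms in auto)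
  then have AE: "AE x in lborel. x \<in> {0<..<T} \<longrightarrow> h x = g x"
    using weak_deriv_unique assms by blast
  have meas: "(\<lambda>x. indicator {0<..<T} x * \<bar>k x\<bar> powr p) \<in> borel_measurable lborel"
    if "Lp_fun T p k" for k
    using that by (auto simp: Lp_fun_def set_integrable_def dest: borel_measurable_integrable)
  have "(LINT x:{0<..<T}|lborel. \<bar>h x\<bar> powr p + q x * \<bar>u x\<bar> powr p) = X_energy T p q u g"
    unfolding X_energy_def set_lebesgue_integral_def
  proof (rule integral_cong_AE_measurable_diff)
    have "(\<lambda>x. indicator {0<..<T} x * \<bar>h x\<bar> powr p - indicator {0<..<T} x * \<bar>g x\<bar> powr p)
        \<in> borel_measurable lborel"
      using meas h assms(2) by (intro borel_measurable_diff) auto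
    then show "(\<lambda>x. indicator {0<..<T} x *\<^sub>R (\<bar>h x\<bar> powr p + q x * \<bar>u x\<bar> powr p) -
        indicator {0<..<T} x *\<^sub>R (\<bar>g x\<bar> powr p + q x * \<bar>u x\<bar> powr p)) \<in> borel_measurable lborel"
      by (simp add: algebra_simps)
    show "AE x in lborel. indicator {0<..<T} x *\<^sub>R (\<bar>h x\<bar> powr p + q x * \<bar>u x\<bar> powr p) =
        indicator {0<..<T} x *\<^sub>R (\<bar>g x\<bar> powr p + q x * \<bar>u x\<bar> powr p)"
      using AE by eventually_elim (auto simp: indicator_def)
  qed
  then show ?thesis by (simp add: X_norm_def h_def)
qed

lemma X_norm_minus:
  assumes "1 \<le> p" shows "X_norm T p q (\<lambda>x. - w x) = X_norm T p q w"
proof (cases "\<exists>g. Lp_fun T p g \<and> has_weak_deriv T w g")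
  case True
  then obtain g where g: "Lp_fun T p g" "has_weak_deriv T w g" by blast
  then show ?thesis
    using X_norm_eq[OF assms g] X_norm_eq[OF assms _ has_weak_deriv_minus[OF g(2)]]
    by (simp add: X_energy_def)
next
  case False
  then have "\<not> (Lp_fun T p g \<and> has_weak_deriv T (\<lambda>x. - w x) g)" for g
    using has_weak_deriv_minus[of T "\<lambda>x. - w x" g] Lp_fun_minus[of T p g] by auto
  \<comment> \<open>Without a weak derivative both predicates are everywhere false, so
    \<open>SOME\<close> returns the same function in both cases and the integrands agree.\<close>
  then have "(\<lambda>g. Lp_fun T p g \<and> has_weak_deriv T (\<lambda>x. - w x) g) =
      (\<lambda>g. Lp_fun T p g \<and> has_weak_deriv T w g)"
    using False by auto
  then have "wderiv T p (\<lambda>x. - w x) = wderiv T p w"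
    unfolding wderiv_def by (rule arg_cong)
  then show ?thesis by (simp add: X_norm_def)
qed

text \<open>Convexity of \<open>t\<^sup>p\<close> with the weights \<open>A / (A + B)\<close> and \<open>B / (A + B)\<close>. Integrated with
  \<open>A\<close> and \<open>B\<close> slightly above the norms of two functions it becomes Minkowski's inequality.\<close>

lemma powr_add_le:
  fixes a b :: real
  assumes "1 \<le> p" "0 < A" "0 < B"
  shows "\<bar>a + b\<bar> powr p \<le> (A + B) powr (p - 1) *
    (\<bar>a\<bar> powr p / A powr (p - 1) + \<bar>b\<bar> powr p / B powr (p - 1))"
proof -
  have single: "t powr p \<le> (C + D) powr (p - 1) * (t powr p / C powr (p - 1))"
    if "0 < C" "0 < D" for t C D :: real
  proof -
    have "C powr (p - 1) \<le> (C + D) powr (p - 1)"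
      using that assms by (intro powr_mono2) auto
    then have "t powr p * C powr (p - 1) \<le> t powr p * (C + D) powr (p - 1)"
      by (intro mult_left_mono) auto
    then show ?thesis
      using that by (simp add: field_simps)
  qed
  \<comment> \<open>Convexity is applied at the positive points \<open>\<bar>a\<bar> / A\<close> and
    \<open>\<bar>b\<bar> / B\<close>; a zero summand is settled by monotonicity of the
    power.\<close>
  consider "a = 0" | "b = 0" | "a \<noteq> 0" "b \<noteq> 0" by blast
  then show ?thesis
  proof cases
    case 1
    then show ?thesis
      using single[of B A "\<bar>b\<bar>"] assms by (simp add: add.commute)
  next
    case 2
    then show ?thesis
      using single[of A B "\<bar>a\<bar>"] assms by simp
  next
    case 3
    define t where "t = B / (A + B)"
    have t: "0 \<le> t" "t \<le> 1" "1 - t = A / (A + B)"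
      using assms by (auto simp: t_def field_simps)
    have part: "0 < C \<Longrightarrow> (\<bar>c\<bar> / C) powr p = \<bar>c\<bar> powr p / (C powr (p - 1) * C)"
      "0 < C \<Longrightarrow> C powr (p - 1) \<noteq> 0" for c C :: real
      by (simp_all add: powr_divide powr_diff)
    have eq: "(1 - t) * (\<bar>a\<bar> / A) + t * (\<bar>b\<bar> / B) = (\<bar>a\<bar> + \<bar>b\<bar>) / (A + B)"
      unfolding t(3) using assms by (simp add: t_def add_divide_distrib)
    have "((\<bar>a\<bar> + \<bar>b\<bar>) / (A + B)) powr p \<le> (1 - t) * (\<bar>a\<bar> / A) powr p + t * (\<bar>b\<bar> / B) powr p"
      using convex_onD[OF powr_convex[OF assms(1)] t(1,2), of "\<bar>a\<bar> / A" "\<bar>b\<bar> / B"] 3 assms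
      unfolding eq[symmetric] by simp
    also have "\<dots> = (\<bar>a\<bar> powr p / A powr (p - 1) + \<bar>b\<bar> powr p / B powr (p - 1)) / (A + B)"
      unfolding t(3) part(1)[OF assms(2)] part(1)[OF assms(3)]
      using assms part(2)[of A] part(2)[of B] by (simp add: t_def add_divide_distrib mult.commute)
    finally have "(\<bar>a\<bar> + \<bar>b\<bar>) powr p / (A + B) powr p
        \<le> (\<bar>a\<bar> powr p / A powr (p - 1) + \<bar>b\<bar> powr p / B powr (p - 1)) / (A + B)"
      using assms by (simp add: powr_divide)
    then have "(\<bar>a\<bar> + \<bar>b\<bar>) powr p
        \<le> (A + B) powr p * ((\<bar>a\<bar> powr p / A powr (p - 1) + \<bar>b\<bar> powr p / B powr (p - 1)) / (A + B))"
      using assms by (simp add: divide_le_eq mult.commute)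
    also have "\<dots> = (A + B) powr (p - 1) * (\<bar>a\<bar> powr p / A powr (p - 1) + \<bar>b\<bar> powr p / B powr (p - 1))"
      using assms by (simp add: powr_diff)
    finally have "(\<bar>a\<bar> + \<bar>b\<bar>) powr p
        \<le> (A + B) powr (p - 1) * (\<bar>a\<bar> powr p / A powr (p - 1) + \<bar>b\<bar> powr p / B powr (p - 1))" .
    moreover have "\<bar>a + b\<bar> powr p \<le> (\<bar>a\<bar> + \<bar>b\<bar>) powr p"
      using assms by (intro powr_mono2) auto
    ultimately show ?thesis by linarith
  qed
qed

lemma Lp_fun_add:
  assumes "1 \<le> p" "Lp_fun T p g" "Lp_fun T p h"
  shows "Lp_fun T p (\<lambda>x. g x + h x)"
proof -
  have m: "(\<lambda>x. indicator {0<..<T} x * g x) \<in> borel_measurable borel"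
    "(\<lambda>x. indicator {0<..<T} x * h x) \<in> borel_measurable borel"
    using assms by (auto simp: Lp_fun_def set_borel_measurable_def)
  have m': "(\<lambda>x. indicator {0<..<T} x * g x + indicator {0<..<T} x * h x) \<in> borel_measurable borel"
    using m by measurable
  then have sm: "set_borel_measurable lborel {0<..<T} (\<lambda>x. g x + h x)"
    by (simp add: set_borel_measurable_def distrib_left)
  have "(\<lambda>x. \<bar>indicator {0<..<T} x * g x + indicator {0<..<T} x * h x\<bar> powr p) \<in> borel_measurable borel"
    using m' by measurable
  moreover have "\<bar>indicator {0<..<T} x * g x + indicator {0<..<T} x * h x\<bar> powr p
      = indicator {0<..<T} x * \<bar>g x + h x\<bar> powr p" for x
    by (simp add: indicator_def)
  ultimately have sm': "set_borel_measurable lborel {0<..<T} (\<lambda>x. \<bar>g x + h x\<bar> powr p)"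
    by (simp add: set_borel_measurable_def)
  have "set_integrable lborel {0<..<T} (\<lambda>x. 2 powr (p - 1) * (\<bar>g x\<bar> powr p + \<bar>h x\<bar> powr p))"
    using assms by (intro set_integrable_mult_right set_integral_add) (auto simp: Lp_fun_def)
  then have "set_integrable lborel {0<..<T} (\<lambda>x. \<bar>g x + h x\<bar> powr p)"
    by (rule set_integrable_bound[OF _ sm'])
      (use powr_add_le[OF assms(1), of 1 1] in \<open>auto simp: order.trans[OF _ abs_ge_self]\<close>)
  with sm show ?thesis by (simp add: Lp_fun_def)
qed

lemma Lp_fun_diff:
  assumes "1 \<le> p" "Lp_fun T p g" "Lp_fun T p h"
  shows "Lp_fun T p (\<lambda>x. g x - h x)"
  using Lp_fun_add[OF assms(1,2), of "\<lambda>x. - h x"] assms(3) by simp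

lemma Lp_fun_continuous:
  assumes "0 < p" "continuous_on {0..T} g" shows "Lp_fun T p g"
proof -
  have "continuous_on {0..T} (\<lambda>x. \<bar>g x\<bar> powr p)"
    using assms by (intro continuous_on_powr' continuous_intros) auto
  then show ?thesis
    using set_integrable_continuous_Ioo[of T] assms(2)
    by (auto simp: Lp_fun_def set_borel_measurable_def set_integrable_def dest: borel_measurable_integrable)
qed

lemma set_integrable_X_energy:
  assumes "0 < p" "continuous_on {0..T} q" "continuous_on {0..T} u" "Lp_fun T p g"
  shows "set_integrable lborel {0<..<T} (\<lambda>x. \<bar>g x\<bar> powr p + q x * \<bar>u x\<bar> powr p)"
proof -
  have "continuous_on {0..T} (\<lambda>x. q x * \<bar>u x\<bar> powr p)"
    using assms by (intro continuous_on_powr' continuous_intros) auto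
  then show ?thesis
    using assms(4) set_integral_add(1)[OF _ set_integrable_continuous_Ioo] by (simp add: Lp_fun_def)
qed

lemma X_energy_nonneg:
  assumes "\<forall>x\<in>{0..T}. 0 \<le> q x" shows "0 \<le> X_energy T p q u g"
  unfolding X_energy_def set_lebesgue_integral_def using assms
  by (intro integral_nonneg_AE AE_I2) (auto simp: indicator_def)

lemma X_energy_minkowski:
  assumes p: "1 \<le> p" and q: "continuous_on {0..T} q" "\<forall>x\<in>{0..T}. 0 \<le> q x"
    and u: "continuous_on {0..T} u" "Lp_fun T p g" and v: "continuous_on {0..T} v" "Lp_fun T p h"
  shows "X_energy T p q (\<lambda>x. u x + v x) (\<lambda>x. g x + h x) powr (1 / p)
    \<le> X_energy T p q u g powr (1 / p) + X_energy T p q v h powr (1 / p)"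
proof (rule field_le_epsilon)
  fix e :: real assume "0 < e"
  \<comment> \<open>The summand e / 2 keeps both weights positive, even for a function of norm
    0.\<close>
  define A where "A = X_energy T p q u g powr (1 / p) + e / 2"
  define B where "B = X_energy T p q v h powr (1 / p) + e / 2"
  have AB: "0 < A" "0 < B"
    using \<open>0 < e\<close> by (auto simp: A_def B_def add_nonneg_pos)
  have bound: "X_energy T p q w k / C powr (p - 1) \<le> C"
    if "C = X_energy T p q w k powr (1 / p) + e / 2" for w k C
  proof -
    have "0 < C" using that \<open>0 < e\<close> by (simp add: add_nonneg_pos)
    have "X_energy T p q w k = (X_energy T p q w k powr (1 / p)) powr p"
      using p X_energy_nonneg[OF q(2), of p w k] by (simp add: powr_powr)
    also have "\<dots> \<le> C powr p"
      using p that \<open>0 < e\<close> by (intro powr_mono2) auto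
    also have "\<dots> = C * C powr (p - 1)"
      using \<open>0 < C\<close> by (simp add: powr_diff)
    finally show ?thesis
      using \<open>0 < C\<close> by (simp add: divide_le_eq)
  qed
  define F where "F = (\<lambda>x. \<bar>g x\<bar> powr p + q x * \<bar>u x\<bar> powr p)"
  define G where "G = (\<lambda>x. \<bar>h x\<bar> powr p + q x * \<bar>v x\<bar> powr p)"
  have FG: "set_integrable lborel {0<..<T} F" "set_integrable lborel {0<..<T} G"
    unfolding F_def G_def using p q u v by (auto intro!: set_integrable_X_energy)
  have "X_energy T p q (\<lambda>x. u x + v x) (\<lambda>x. g x + h x) \<le>
     (LINT x:{0<..<T}|lborel. (A + B) powr (p - 1) * (F x / A powr (p - 1) + G x / B powr (p - 1)))"
    unfolding X_energy_def
  proof (rule set_integral_mono)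
    show "set_integrable lborel {0<..<T} (\<lambda>x. \<bar>g x + h x\<bar> powr p + q x * \<bar>u x + v x\<bar> powr p)"
      using p q u v by (intro set_integrable_X_energy continuous_intros Lp_fun_add) auto
    show "set_integrable lborel {0<..<T}
        (\<lambda>x. (A + B) powr (p - 1) * (F x / A powr (p - 1) + G x / B powr (p - 1)))"
      using FG by (intro set_integrable_mult_right set_integral_add set_integrable_divide) auto
    fix x assume x: "x \<in> {0<..<T}"
    define a where "a = (A + B) powr (p - 1)"
    have "\<bar>g x + h x\<bar> powr p \<le> a * (\<bar>g x\<bar> powr p / A powr (p - 1) + \<bar>h x\<bar> powr p / B powr (p - 1))"
      unfolding a_def using powr_add_le[OF p AB] .
    moreover have "q x * \<bar>u x + v x\<bar> powr p \<le>
        q x * (a * (\<bar>u x\<bar> powr p / A powr (p - 1) + \<bar>v x\<bar> powr p / B powr (p - 1)))"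
      unfolding a_def using x q(2) powr_add_le[OF p AB] by (intro mult_left_mono) auto
    ultimately show "\<bar>g x + h x\<bar> powr p + q x * \<bar>u x + v x\<bar> powr p
        \<le> (A + B) powr (p - 1) * (F x / A powr (p - 1) + G x / B powr (p - 1))"
      unfolding F_def G_def a_def[symmetric] by (simp add: algebra_simps add_divide_distrib)
  qed
  also have "\<dots> = (A + B) powr (p - 1) * (X_energy T p q u g / A powr (p - 1) + X_energy T p q v h / B powr (p - 1))"
    using FG by (simp add: X_energy_def F_def G_def)
  also have "\<dots> \<le> (A + B) powr (p - 1) * (A + B)"
    using bound[OF A_def] bound[OF B_def] by (intro mult_left_mono add_mono) auto
  also have "\<dots> = (A + B) powr p"
    using AB by (simp add: powr_diff)
  finally have "X_energy T p q (\<lambda>x. u x + v x) (\<lambda>x. g x + h x) powr (1 / p) \<le> ((A + B) powr p) powr (1 / p)"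
    using p X_energy_nonneg[OF q(2)] by (intro powr_mono2) auto
  also have "\<dots> = A + B"
    using p AB by (simp add: powr_powr)
  finally show "X_energy T p q (\<lambda>x. u x + v x) (\<lambda>x. g x + h x) powr (1 / p)
    \<le> X_energy T p q u g powr (1 / p) + X_energy T p q v h powr (1 / p) + e"
    by (simp add: A_def B_def)
qed

lemma X_per_diff_weak_deriv:
  assumes "1 \<le> p" "u \<in> X_per T p" "v \<in> X_per T p"
  obtains g where "Lp_fun T p g" "has_weak_deriv T (\<lambda>x. u x - v x) g"
proof -
  obtain g h where g: "Lp_fun T p g" "has_weak_deriv T u g" and h: "Lp_fun T p h" "has_weak_deriv T v h"
    and uv: "Lp_fun T p u" "Lp_fun T p v"
    using assms by (auto simp: X_per_def)
  show ?thesis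
    by (rule that[OF Lp_fun_diff[OF assms(1) g(1) h(1)]])
      (intro has_weak_deriv_diff Lp_fun_integrable[OF assms(1)] g h uv)
qed

text \<open>The derivative term forces the difference to be constant. The potential term forces this
  constant to be 0, because \<open>q\<close> is nonzero on a nonempty open set, which is not a null
  set.\<close>

lemma X_dist_eq_0_imp:
  assumes T: "0 < T" and p: "1 \<le> p" and q: "continuous_on {0..T} q" "\<forall>x\<in>{0..T}. 0 \<le> q x"
    and q0: "\<exists>x\<in>{0..T}. q x \<noteq> 0"
    and u: "u \<in> X_per T p" and v: "v \<in> X_per T p" and 0: "X_dist T p q u v = 0"
  shows "u = v"
proof -
  obtain g where g: "Lp_fun T p g" "has_weak_deriv T (\<lambda>x. u x - v x) g"
    using X_per_diff_weak_deriv[OF p u v] .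
  define w where "w = (\<lambda>x. u x - v x)"
  have w: "continuous_on {0..T} w" and gi: "set_integrable lborel {0<..<T} g"
    using u v g p by (auto simp: w_def X_per_def intro!: continuous_intros Lp_fun_integrable)
  have "X_energy T p q w g = 0"
    using 0 p X_norm_eq[OF p g, of q] by (simp add: X_dist_def w_def)
  moreover have "set_integrable lborel {0<..<T} (\<lambda>x. \<bar>g x\<bar> powr p + q x * \<bar>w x\<bar> powr p)"
    using p q w g by (intro set_integrable_X_energy) auto
  ultimately have AE: "AE x in lborel. indicator {0<..<T} x * (\<bar>g x\<bar> powr p + q x * \<bar>w x\<bar> powr p) = 0"
    using q(2) integral_nonneg_eq_0_iff_AE[of lborel
        "\<lambda>x. indicator {0<..<T} x * (\<bar>g x\<bar> powr p + q x * \<bar>w x\<bar> powr p)"]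
    by (force simp: X_energy_def set_lebesgue_integral_def set_integrable_def indicator_def)
  have qx: "0 \<le> q x * \<bar>w x\<bar> powr p" if "x \<in> {0<..<T}" for x
    using q(2) that by auto
  have AEg: "AE x in lborel. x \<in> {0<..<T} \<longrightarrow> g x = 0"
    using AE
  proof eventually_elim
    case (elim x)
    show ?case
    proof
      assume x: "x \<in> {0<..<T}"
      then have "\<bar>g x\<bar> powr p = 0"
        using elim qx[OF x] by (simp add: add_nonneg_eq_0_iff)
      then show "g x = 0" by simp
    qed
  qed
  have AEw: "AE x in lborel. x \<in> {0<..<T} \<longrightarrow> q x * \<bar>w x\<bar> powr p = 0"
    using AE
  proof eventually_elim
    case (elim x)
    show ?case
    proof
      assume x: "x \<in> {0<..<T}"
      then show "q x * \<bar>w x\<bar> powr p = 0"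
        using elim qx[OF x] by (simp add: add_nonneg_eq_0_iff)
    qed
  qed
  have const: "w b = w a" if "a \<in> {0<..<T}" "b \<in> {0<..<T}" "a < b" for a b
  proof -
    have "w b - w a = (LINT x:{a<..b}|lborel. g x)"
      using weak_deriv_increment[OF w gi] g(2) that by (auto simp: w_def)
    also have "\<dots> = 0"
      unfolding set_lebesgue_integral_def
      by (rule integral_eq_zero_AE) (use AEg that in \<open>auto simp: indicator_def elim!: eventually_mono\<close>)
    finally show ?thesis by simp
  qed
  define c where "c = w (T / 2)"
  have wc: "w x = c" if "x \<in> {0<..<T}" for x
    using const[of x "T / 2"] const[of "T / 2" x] that T by (cases x "T / 2" rule: linorder_cases) (auto simp: c_def)
  have closure: "closure {0<..<T} = {0..T}"
    using T by simp
  have wc': "w x = c" if "x \<in> {0..T}" for x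
    by (rule continuous_constant_on_closure[where S = "{0<..<T}"]) (use w that wc closure in auto)
  have "c = 0"
  proof (rule ccontr)
    assume "c \<noteq> 0"
    obtain x0 where x0: "x0 \<in> {0..T}" "q x0 \<noteq> 0" using q0 by blast
    \<comment> \<open>The point where \<open>q\<close> is known to be nonzero may be an endpoint;
      continuity provides an interior one.\<close>
    have "\<exists>x\<in>{0<..<T}. q x \<noteq> 0"
    proof (rule ccontr)
      assume *: "\<not> (\<exists>x\<in>{0<..<T}. q x \<noteq> 0)"
      have "q x0 = 0"
        by (rule continuous_constant_on_closure[where S = "{0<..<T}"]) (use q x0 * closure in auto)
      then show False using x0 by simp
    qed
    then have ne: "{0<..<T} \<inter> q -` (- {0}) \<noteq> {}" by auto
    have op: "open ({0<..<T} \<inter> q -` (- {0}))"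
      using q(1) by (intro continuous_open_preimage) (auto intro: continuous_on_subset)
    have "AE x in lborel. x \<notin> {0<..<T} \<inter> q -` (- {0})"
      using AEw by eventually_elim (use wc \<open>c \<noteq> 0\<close> in auto)
    then have "{0<..<T} \<inter> q -` (- {0}) \<in> null_sets lborel"
      using op by (subst AE_iff_null_sets) auto
    then have "negligible ({0<..<T} \<inter> q -` (- {0}))"
      by (simp add: negligible_iff_null_sets null_sets_completionI)
    then show False
      using open_not_negligible[OF op ne] by simp
  qed
  show "u = v"
  proof (rule extensionalityI)
    show "u \<in> extensional {0..T}" "v \<in> extensional {0..T}"
      using u v by (auto simp: X_per_def)
    show "u x = v x" if "x \<in> {0..T}" for x
      using wc'[OF that] \<open>c = 0\<close> by (simp add: w_def)
  qed
qed

lemma Metric_space_X_per: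
  assumes T: "0 < T" and p: "1 \<le> p" and q: "continuous_on {0..T} q" "\<forall>x\<in>{0..T}. 0 \<le> q x"
    and q0: "\<exists>x\<in>{0..T}. q x \<noteq> 0"
  shows "Metric_space (X_per T p) (X_dist T p q)"
proof
  show "0 \<le> X_dist T p q u v" for u v
    by (simp add: X_dist_def X_norm_def)
  show "X_dist T p q u v = X_dist T p q v u" for u v
    using X_norm_minus[OF p, of T q "\<lambda>x. u x - v x"] by (simp add: X_dist_def)
  fix u v assume u: "u \<in> X_per T p" and v: "v \<in> X_per T p"
  have "X_dist T p q u u = 0"
  proof -
    have "Lp_fun T p (\<lambda>_. 0)"
      using p by (intro Lp_fun_continuous) auto
    moreover have "has_weak_deriv T (\<lambda>x. u x - u x) (\<lambda>_. 0)"
      by (simp add: has_weak_deriv_def)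
    ultimately show ?thesis
      using X_norm_eq[OF p, of T "\<lambda>_. 0" "\<lambda>x. u x - u x" q] by (simp add: X_dist_def X_energy_def)
  qed
  then show "X_dist T p q u v = 0 \<longleftrightarrow> u = v"
    using X_dist_eq_0_imp[OF T p q q0 u v] by auto
  fix w assume w: "w \<in> X_per T p"
  obtain g where g: "Lp_fun T p g" "has_weak_deriv T (\<lambda>x. u x - v x) g"
    using X_per_diff_weak_deriv[OF p u v] .
  obtain h where h: "Lp_fun T p h" "has_weak_deriv T (\<lambda>x. w x - v x) h"
    using X_per_diff_weak_deriv[OF p w v] .
  have cont: "continuous_on {0..T} (\<lambda>x. u x - v x)" "continuous_on {0..T} (\<lambda>x. w x - v x)"
    using u v w by (auto simp: X_per_def intro!: continuous_intros)
  have gh: "Lp_fun T p (\<lambda>x. g x - h x)" "has_weak_deriv T (\<lambda>x. u x - w x) (\<lambda>x. g x - h x)"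
    using Lp_fun_diff[OF p g(1) h(1)]
      has_weak_deriv_diff[OF set_integrable_continuous_Ioo[OF cont(1)] set_integrable_continuous_Ioo[OF cont(2)]
        Lp_fun_integrable[OF p g(1)] Lp_fun_integrable[OF p h(1)] g(2) h(2)]
    by simp_all
  have h': "Lp_fun T p (\<lambda>x. - h x)" "has_weak_deriv T (\<lambda>x. v x - w x) (\<lambda>x. - h x)"
    using h has_weak_deriv_minus[OF h(2)] by simp_all
  have "X_energy T p q (\<lambda>x. (u x - v x) + (v x - w x)) (\<lambda>x. g x + - h x) powr (1 / p)
      \<le> X_energy T p q (\<lambda>x. u x - v x) g powr (1 / p) + X_energy T p q (\<lambda>x. v x - w x) (\<lambda>x. - h x) powr (1 / p)"
    using u v w by (intro X_energy_minkowski p q g(1) h'(1)) (auto simp: X_per_def intro!: continuous_intros)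
  then show "X_dist T p q u w \<le> X_dist T p q u v + X_dist T p q v w"
    using X_norm_eq[OF p gh, of q] X_norm_eq[OF p g, of q] X_norm_eq[OF p h', of q]
    by (simp add: X_dist_def)
qed

section \<open>Continuously differentiable functions as elements of X\<close>

lemma C1_has_weak_deriv:
  assumes T: "0 < T"
    and u: "\<And>x. x \<in> {0..T} \<Longrightarrow> (u has_real_derivative du x) (at x within {0..T})"
    and du: "continuous_on {0..T} du"
  shows "has_weak_deriv T u du"
  unfolding has_weak_deriv_def
proof
  fix \<psi> assume \<psi>: "\<psi> \<in> C1c T"
  have cu: "continuous_on {0..T} u"
    using u by (meson DERIV_continuous continuous_on_eq_continuous_within)
  have ends: "\<psi> 0 = 0" "\<psi> T = 0"
    using \<psi> unfolding C1c_def by force+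
  have Ioo: "(LINT x:{0<..<T}|lborel. f x) = (LINT x:{0..T}|lborel. f x)" for f :: "real \<Rightarrow> real"
    by (rule set_integral_discrete_difference[where X = "{0, T}"]) auto
  have int: "set_integrable lborel {0..T} (\<lambda>x. u x * deriv \<psi> x)" "set_integrable lborel {0..T} (\<lambda>x. du x * \<psi> x)"
    by (intro borel_integrable_atLeastAtMost' continuous_intros cu du C1cD[OF \<psi>])+
  have "(\<integral>x. indicator {0..T} x *\<^sub>R (u x * deriv \<psi> x + du x * \<psi> x) \<partial>lborel) = u T * \<psi> T - u 0 * \<psi> 0"
  proof (rule integral_FTC_Icc)
    show "0 \<le> T" using T by simp
    show "continuous_on {0..T} (\<lambda>x. u x * deriv \<psi> x + du x * \<psi> x)"
      by (intro continuous_intros cu du C1cD[OF \<psi>])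
    fix x assume "0 \<le> x" "x \<le> T"
    then show "((\<lambda>x. u x * \<psi> x) has_vector_derivative u x * deriv \<psi> x + du x * \<psi> x) (at x within {0..T})"
      unfolding has_real_derivative_iff_has_vector_derivative[symmetric]
      using DERIV_mult[OF u[of x] has_field_derivative_at_within[OF C1cD(3)[OF \<psi>, of x], of "{0..T}"]]
      by (simp add: algebra_simps)
  qed
  then have "(LINT x:{0..T}|lborel. u x * deriv \<psi> x) + (LINT x:{0..T}|lborel. du x * \<psi> x) = 0"
    using set_integral_add(2)[OF int] by (simp add: ends set_lebesgue_integral_def)
  then show "(LINT x:{0<..<T}|lborel. u x * deriv \<psi> x) = - (LINT x:{0<..<T}|lborel. du x * \<psi> x)"
    unfolding Ioo by linarith
qed

lemma C1_in_X_per: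
  assumes "0 < T" "0 < p"
    and u: "\<And>x. x \<in> {0..T} \<Longrightarrow> (u has_real_derivative du x) (at x within {0..T})"
    and du: "continuous_on {0..T} du" and "u 0 = u T" "u \<in> extensional {0..T}"
  shows "u \<in> X_per T p"
proof -
  have "continuous_on {0..T} u"
    using u by (meson DERIV_continuous continuous_on_eq_continuous_within)
  then show ?thesis
    using assms Lp_fun_continuous[OF assms(2)] C1_has_weak_deriv[OF assms(1) u du]
    by (auto simp: X_per_def)
qed

text \<open>The form in which closeness of values and derivatives reaches the norm of X: the
  integrand is at most (1 + Q) e^p on an interval of length T.\<close>

lemma X_norm_C1_le:
  assumes T: "0 < T" and p: "1 \<le> p" and q: "continuous_on {0..T} q" "\<forall>x\<in>{0..T}. 0 \<le> q x"
    and Q: "\<And>x. x \<in> {0..T} \<Longrightarrow> q x \<le> Q"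
    and u: "\<And>x. x \<in> {0..T} \<Longrightarrow> (u has_real_derivative du x) (at x within {0..T})"
    and du: "continuous_on {0..T} du"
    and small: "\<And>x. x \<in> {0..T} \<Longrightarrow> \<bar>u x\<bar> \<le> e" "\<And>x. x \<in> {0..T} \<Longrightarrow> \<bar>du x\<bar> \<le> e"
  shows "X_norm T p q u \<le> (T * (1 + Q)) powr (1 / p) * e"
proof -
  have cu: "continuous_on {0..T} u"
    using u by (meson DERIV_continuous continuous_on_eq_continuous_within)
  have Lp: "Lp_fun T p du" using p du by (intro Lp_fun_continuous) auto
  have e: "0 \<le> e" using small(1)[of 0] T by simp
  have "0 \<le> Q" using Q[of 0] bspec[OF q(2), of 0] T by simp
  have "X_energy T p q u du \<le> (LINT x:{0<..<T}|lborel. (1 + Q) * e powr p)"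
    unfolding X_energy_def
  proof (rule set_integral_mono)
    show "set_integrable lborel {0<..<T} (\<lambda>x. \<bar>du x\<bar> powr p + q x * \<bar>u x\<bar> powr p)"
      using p by (intro set_integrable_X_energy q cu Lp) auto
    show "set_integrable lborel {0<..<T} (\<lambda>x. (1 + Q) * e powr p)"
      by (intro set_integrable_continuous_Ioo continuous_intros)
    fix x assume x: "x \<in> {0<..<T}"
    have "\<bar>du x\<bar> powr p \<le> e powr p" "\<bar>u x\<bar> powr p \<le> e powr p"
      using small[of x] x p by (auto intro!: powr_mono2)
    moreover from this have "q x * \<bar>u x\<bar> powr p \<le> Q * e powr p"
      using Q[of x] q(2) x \<open>0 \<le> Q\<close> by (intro mult_mono) auto
    ultimately show "\<bar>du x\<bar> powr p + q x * \<bar>u x\<bar> powr p \<le> (1 + Q) * e powr p"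
      by (simp add: algebra_simps)
  qed
  also have "\<dots> = T * (1 + Q) * e powr p"
    using T by (subst set_integral_const) auto
  finally have "X_energy T p q u du powr (1 / p) \<le> (T * (1 + Q) * e powr p) powr (1 / p)"
    using p X_energy_nonneg[OF q(2)] by (intro powr_mono2) auto
  also have "\<dots> = (T * (1 + Q)) powr (1 / p) * e"
    using p e T \<open>0 \<le> Q\<close> by (simp add: powr_mult powr_powr)
  finally show ?thesis
    using X_norm_eq[OF p Lp C1_has_weak_deriv[OF T u du], of q] by simp
qed

section \<open>Periodic solutions of a planar system\<close>

primrec euler :: "(real \<Rightarrow> 'a \<Rightarrow> 'a) \<Rightarrow> real \<Rightarrow> 'a \<Rightarrow> nat \<Rightarrow> 'a::real_vector" where
  "euler F h c 0 = c"
| "euler F h c (Suc k) = euler F h c k + h *\<^sub>R F (real k * h) (euler F h c k)"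

lemma euler_eq_sum: "euler F h c j = c + (\<Sum>k<j. h *\<^sub>R F (real k * h) (euler F h c k))"
  by (induction j) (simp_all add: add.assoc)

definition ramp :: "real \<Rightarrow> real \<Rightarrow> real" where
  "ramp h t = min h (max 0 t)"

text \<open>The piecewise linear interpolation of the Euler scheme. As
  \<open>ramp h (x - real k * h)\<close> is the time spent in step k up to x, increments are sums
  over steps and need no case distinction by the location of their endpoints.\<close>

definition polygon :: "(real \<Rightarrow> 'a \<Rightarrow> 'a) \<Rightarrow> real \<Rightarrow> 'a \<Rightarrow> nat \<Rightarrow> real \<Rightarrow> 'a::real_vector" where
  "polygon F h c N x = c + (\<Sum>k<N. ramp h (x - real k * h) *\<^sub>R F (real k * h) (euler F h c k))"

lemma sum_ramp:
  assumes "0 < h" shows "(\<Sum>k<N. ramp h (x - real k * h)) = min (real N * h) (max 0 x)"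
proof (induction N)
  case (Suc N)
  have N: "0 \<le> real N * h" "real (Suc N) * h = real N * h + h"
    using assms by (simp_all add: distrib_right)
  have "(\<Sum>k<Suc N. ramp h (x - real k * h)) = min (real N * h) (max 0 x) + ramp h (x - real N * h)"
    by (simp only: sum.lessThan_Suc Suc)
  also have "min a (max 0 x) + ramp h (x - a) = min (a + h) (max 0 x)" if "0 \<le> a" for a
    using assms that by (auto simp: ramp_def min_def max_def)
  then have "min (real N * h) (max 0 x) + ramp h (x - real N * h) = min (real (Suc N) * h) (max 0 x)"
    using N by metis
  finally show ?case .
qed simp

lemma polygon_at_node:
  assumes "0 < h" "j \<le> N"
  shows "polygon F h c N (real j * h) = euler F h c j"
proof -
  have "ramp h (real j * h - real k * h) = (if k < j then h else 0)" for k
  proof (cases "k < j")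
    case True
    then have "1 * h \<le> (real j - real k) * h"
      using assms by (intro mult_right_mono) auto
    then show ?thesis using True assms by (simp add: ramp_def algebra_simps)
  next
    case False
    then have "real j * h \<le> real k * h"
      using assms by (intro mult_right_mono) auto
    then show ?thesis using False assms by (simp add: ramp_def)
  qed
  then have "(\<Sum>k<N. ramp h (real j * h - real k * h) *\<^sub>R F (real k * h) (euler F h c k))
      = (\<Sum>k<N. if k < j then h *\<^sub>R F (real k * h) (euler F h c k) else 0)"
    by (intro sum.cong) auto
  also have "\<dots> = (\<Sum>k\<in>{..<N} \<inter> {k. k < j}. h *\<^sub>R F (real k * h) (euler F h c k))"
    by (simp add: sum.If_cases)
  also have "{..<N} \<inter> {k. k < j} = {..<j}" using assms by auto
  finally show ?thesis
    using euler_eq_sum[of F h c j] by (simp add: polygon_def)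
qed

text \<open>The increment is a sum of slopes weighted with the times spent in the steps between
  \<open>s\<close> and \<open>t\<close>. These weights are nonnegative, add up to t - s, and are 0
  for steps that do not meet the interval.\<close>

lemma polygon_increment:
  fixes F :: "real \<Rightarrow> 'a::real_normed_vector \<Rightarrow> 'a"
  assumes h: "0 < h" and st: "0 \<le> s" "s \<le> t" "t \<le> real N * h"
    and F: "\<And>k. k < N \<Longrightarrow> real k * h < t \<Longrightarrow> s < real k * h + h \<Longrightarrow>
             norm (F (real k * h) (euler F h c k) - v) \<le> e"
  shows "norm (polygon F h c N t - polygon F h c N s - (t - s) *\<^sub>R v) \<le> e * (t - s)"
proof -
  define d where "d = (\<lambda>k. ramp h (t - real k * h) - ramp h (s - real k * h))"
  define G where "G = (\<lambda>k. F (real k * h) (euler F h c k))"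
  have sum_d: "(\<Sum>k<N. d k) = t - s"
    using sum_ramp[OF h, of t N] sum_ramp[OF h, of s N] st by (simp add: d_def sum_subtractf)
  have d: "0 \<le> d k" for k
    using st by (auto simp: d_def ramp_def min_def max_def)
  have d0: "d k = 0" if "\<not> (real k * h < t \<and> s < real k * h + h)" for k
    using that st h by (auto simp: d_def ramp_def min_def max_def)
  have "polygon F h c N t - polygon F h c N s - (t - s) *\<^sub>R v = (\<Sum>k<N. d k *\<^sub>R (G k - v))"
    by (simp add: polygon_def d_def G_def scaleR_left_diff_distrib scaleR_right_diff_distrib
        sum_subtractf scaleR_left.sum sum_d[symmetric])
  also have "norm \<dots> \<le> (\<Sum>k<N. e * d k)"
  proof (rule order.trans[OF norm_sum sum_mono])
    fix k assume "k \<in> {..<N}"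
    then show "norm (d k *\<^sub>R (G k - v)) \<le> e * d k"
      using F[of k] d[of k] d0[of k]
      by (cases "real k * h < t \<and> s < real k * h + h") (auto simp: G_def mult.commute[of e] intro!: mult_left_mono)
  qed
  also have "\<dots> = e * (t - s)"
    by (simp add: sum_distrib_left[symmetric] sum_d)
  finally show ?thesis .
qed

text \<open>All polygons are Lipschitz with constant \<open>C\<close>, so the theorem of Arzela and
  Ascoli applies. The derivative of the limit is obtained directly, without an integral equation:
  near a point x0 every slope in use is close to \<open>F x0 (w x0)\<close>. The last two limits
  will carry periodicity over from the scheme.\<close>

lemma euler_compactness:
  fixes F :: "real \<Rightarrow> 'a::euclidean_space \<Rightarrow> 'a" and c :: "nat \<Rightarrow> 'a"
  assumes T: "0 < T"
    and contF: "continuous_on ({0..T} \<times> UNIV) (\<lambda>(x, v). F x v)"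
    and F: "\<And>x v. x \<in> {0..T} \<Longrightarrow> norm (F x v) \<le> C"
    and c: "\<And>n. norm (c n) \<le> B"
  obtains w r where "strict_mono (r :: nat \<Rightarrow> nat)"
    "\<And>x. x \<in> {0..T} \<Longrightarrow> (w has_vector_derivative F x (w x)) (at x within {0..T})"
    "(\<lambda>n. c (r n)) \<longlonglongrightarrow> w 0"
    "(\<lambda>n. euler F (T / real (Suc (r n))) (c (r n)) (Suc (r n))) \<longlonglongrightarrow> w T"
proof -
  define h where "h = (\<lambda>n. T / real (Suc n))"
  have h: "0 < h n" "real (Suc n) * h n = T" for n
    using T by (auto simp: h_def simp del: of_nat_Suc)
  define P where "P = (\<lambda>n. polygon F (h n) (c n) (Suc n))"
  have "0 \<le> C" using F[of 0 0] T norm_ge_zero[of "F 0 0"] by (simp del: norm_ge_zero)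
  have node: "real k * h n \<in> {0..T}" if "k \<le> Suc n" for k n
    using that h[of n] mult_right_mono[of "real k" "real (Suc n)" "h n"] by auto
  have P0: "P n 0 = c n" for n
    using polygon_at_node[OF h(1), of 0 "Suc n" F n "c n"] by (simp add: P_def)
  have PT: "P n T = euler F (h n) (c n) (Suc n)" for n
    using polygon_at_node[OF h(1), of "Suc n" "Suc n" F n "c n"] unfolding P_def h(2) by simp
  have P_lip: "norm (P n t - P n s) \<le> C * (t - s)" if "0 \<le> s" "s \<le> t" "t \<le> T" for n s t
  proof -
    have "norm (P n t - P n s - (t - s) *\<^sub>R 0) \<le> C * (t - s)"
      unfolding P_def
    proof (rule polygon_increment)
      show "norm (F (real k * h n) (euler F (h n) (c n) k) - 0) \<le> C" if "k < Suc n" for k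
        using F[OF node[of k n]] that by simp
    qed (use h[of n] that in auto)
    then show ?thesis by simp
  qed
  have P_lip': "norm (P n t - P n s) \<le> C * \<bar>t - s\<bar>" if "s \<in> {0..T}" "t \<in> {0..T}" for n s t
    using P_lip[of s t n] P_lip[of t s n] that by (cases "s \<le> t") (auto simp: norm_minus_commute)
  obtain w r where w: "continuous_on {0..T} w" and r: "strict_mono (r :: nat \<Rightarrow> nat)"
    and lim: "\<And>e. 0 < e \<Longrightarrow> \<exists>N. \<forall>n x. n \<ge> N \<and> x \<in> {0..T} \<longrightarrow> norm (P (r n) x - w x) < e"
  proof (rule Arzela_Ascoli[of "{0..T}" P "B + C * T"])
    show "compact {0..T}" by simp
    fix n x assume x: "x \<in> {0..T}"
    have "norm (P n x) \<le> norm (P n 0) + norm (P n x - P n 0)"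
      by (rule norm_triangle_sub)
    also have "norm (P n x - P n 0) \<le> C * x"
      using P_lip[of 0 x n] x by simp
    also have "C * x \<le> C * T"
      using x \<open>0 \<le> C\<close> by (intro mult_left_mono) auto
    finally show "norm (P n x) \<le> B + C * T"
      using c[of n] by (simp add: P0)
  next
    fix x e :: real assume x: "x \<in> {0..T}" and "0 < e"
    show "\<exists>d>0. \<forall>n y. y \<in> {0..T} \<and> norm (x - y) < d \<longrightarrow> norm (P n x - P n y) < e"
    proof (intro exI conjI allI impI)
      show "0 < e / (C + 1)" using \<open>0 < e\<close> \<open>0 \<le> C\<close> by simp
      fix n y assume y: "y \<in> {0..T} \<and> norm (x - y) < e / (C + 1)"
      then have "norm (P n x - P n y) \<le> C * \<bar>x - y\<bar>"
        using P_lip'[of y x n] x by simp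
      also have "\<dots> \<le> (C + 1) * \<bar>x - y\<bar>" by (simp add: distrib_right)
      also have "\<dots> < e"
        using y \<open>0 \<le> C\<close> by (simp add: less_divide_eq mult.commute)
      finally show "norm (P n x - P n y) < e" .
    qed
  next
    fix w r assume "continuous_on {0..T} w" "strict_mono (r :: nat \<Rightarrow> nat)"
      "\<And>e. 0 < e \<Longrightarrow> \<exists>N. \<forall>n x. n \<ge> N \<and> x \<in> {0..T} \<longrightarrow> norm (P (r n) x - w x) < e"
    then show thesis by (rule that)
  qed
  have lim_at: "(\<lambda>n. P (r n) x) \<longlonglongrightarrow> w x" if "x \<in> {0..T}" for x
    unfolding LIMSEQ_iff using lim that by meson
  have h_lim: "(\<lambda>n. h (r n)) \<longlonglongrightarrow> 0"
  proof -
    have "(\<lambda>n. T * inverse (real (Suc n))) \<longlonglongrightarrow> T * 0"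
      by (intro tendsto_mult tendsto_const LIMSEQ_inverse_real_of_nat)
    then have "h \<longlonglongrightarrow> 0" by (simp add: h_def[abs_def] divide_inverse)
    then show ?thesis
      using LIMSEQ_subseq_LIMSEQ[OF _ r] by (simp add: comp_def)
  qed
  have deriv: "(w has_vector_derivative F x0 (w x0)) (at x0 within {0..T})" if x0: "x0 \<in> {0..T}" for x0
  proof -
    define v where "v = F x0 (w x0)"
    have key: "\<exists>\<delta>>0. \<forall>s\<in>{0..T}. \<forall>t\<in>{0..T}. s \<le> t \<longrightarrow> \<bar>s - x0\<bar> < \<delta> \<longrightarrow> \<bar>t - x0\<bar> < \<delta> \<longrightarrow>
        norm (w t - w s - (t - s) *\<^sub>R v) \<le> e * (t - s)" if "0 < e" for e
    proof -
      obtain \<eta> where "0 < \<eta>" and \<eta>: "\<And>y z. y \<in> {0..T} \<Longrightarrow> dist (y, z) (x0, w x0) < \<eta> \<Longrightarrow> dist (F y z) v < e"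
        using contF x0 \<open>0 < e\<close> unfolding continuous_on_iff v_def by (force simp: mem_Times_iff)
      obtain \<delta>' where "0 < \<delta>'" and \<delta>': "\<And>y. y \<in> {0..T} \<Longrightarrow> dist y x0 < \<delta>' \<Longrightarrow> dist (w y) (w x0) < \<eta> / 3"
        using w x0 \<open>0 < \<eta>\<close> unfolding continuous_on_iff by (metis zero_less_divide_iff zero_less_numeral)
      \<comment> \<open>A step that meets [s, t] may begin almost 2 \<delta> before x0, hence the
        halving. Of the three thirds of \<eta>, one covers the distance in time, one the polygon
        against its limit and one the variation of \<open>w\<close>.\<close>
      define \<delta> where "\<delta> = min \<delta>' (\<eta> / 3) / 2"
      have "0 < \<delta>" using \<open>0 < \<delta>'\<close> \<open>0 < \<eta>\<close> by (simp add: \<delta>_def)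
      have "norm (w t - w s - (t - s) *\<^sub>R v) \<le> e * (t - s)"
        if s: "s \<in> {0..T}" "\<bar>s - x0\<bar> < \<delta>" and t: "t \<in> {0..T}" "\<bar>t - x0\<bar> < \<delta>" and "s \<le> t" for s t
      proof (rule LIMSEQ_le_const2)
        show "(\<lambda>n. norm (P (r n) t - P (r n) s - (t - s) *\<^sub>R v)) \<longlonglongrightarrow> norm (w t - w s - (t - s) *\<^sub>R v)"
          by (intro tendsto_intros lim_at s t)
        obtain N1 where N1: "\<And>n x. n \<ge> N1 \<Longrightarrow> x \<in> {0..T} \<Longrightarrow> norm (P (r n) x - w x) < \<eta> / 3"
          using lim[of "\<eta> / 3"] \<open>0 < \<eta>\<close> by auto
        obtain N2 where N2: "\<And>n. n \<ge> N2 \<Longrightarrow> h (r n) < \<delta>"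
          using order_tendstoD(2)[OF h_lim \<open>0 < \<delta>\<close>] unfolding eventually_sequentially by blast
        show "\<exists>N. \<forall>n\<ge>N. norm (P (r n) t - P (r n) s - (t - s) *\<^sub>R v) \<le> e * (t - s)"
        proof (intro exI allI impI)
          fix n assume n: "n \<ge> max N1 N2"
          show "norm (P (r n) t - P (r n) s - (t - s) *\<^sub>R v) \<le> e * (t - s)"
            unfolding P_def
          proof (rule polygon_increment)
            fix k assume k: "k < Suc (r n)" "real k * h (r n) < t" "s < real k * h (r n) + h (r n)"
            define y where "y = real k * h (r n)"
            have y: "y \<in> {0..T}" unfolding y_def using node k by simp
            have "h (r n) < \<delta>" using N2 n by simp
            then have "\<bar>y - x0\<bar> < 2 * \<delta>"
              using k s t unfolding y_def[symmetric] by (auto simp: abs_less_iff)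
            then have y': "\<bar>y - x0\<bar> < \<delta>'" "\<bar>y - x0\<bar> < \<eta> / 3" by (auto simp: \<delta>_def)
            have Py: "P (r n) y = euler F (h (r n)) (c (r n)) k"
              unfolding P_def y_def using k by (intro polygon_at_node h) simp
            have "dist (P (r n) y) (w x0) \<le> dist (P (r n) y) (w y) + dist (w y) (w x0)"
              by (rule dist_triangle)
            also have "\<dots> < \<eta> / 3 + \<eta> / 3"
              using N1[of n y] n y \<delta>'[OF y] y' by (intro add_strict_mono) (auto simp: dist_norm)
            finally have "dist (P (r n) y) (w x0) < 2 * \<eta> / 3" by simp
            then have "dist (y, P (r n) y) (x0, w x0) < \<eta>"
              using y' sqrt_sum_squares_le_sum_abs[of "dist y x0" "dist (P (r n) y) (w x0)"]
              by (simp add: dist_Pair_Pair dist_real_def)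
            then show "norm (F (real k * h (r n)) (euler F (h (r n)) (c (r n)) k) - v) \<le> e"
              using \<eta>[OF y] unfolding Py y_def[symmetric] dist_norm by (simp add: less_imp_le)
          qed (use h[of "r n"] s t \<open>s \<le> t\<close> in auto)
        qed
      qed
      then show ?thesis using \<open>0 < \<delta>\<close> by blast
    qed
    show ?thesis
      unfolding has_vector_derivative_def has_derivative_within_alt v_def[symmetric]
    proof (intro conjI allI impI)
      show "bounded_linear (\<lambda>x. x *\<^sub>R v)" by (rule bounded_linear_scaleR_left)
      fix e :: real assume "0 < e"
      obtain \<delta> where "0 < \<delta>" and \<delta>: "\<And>s t. s \<in> {0..T} \<Longrightarrow> t \<in> {0..T} \<Longrightarrow> s \<le> t \<Longrightarrow> \<bar>s - x0\<bar> < \<delta> \<Longrightarrow>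
          \<bar>t - x0\<bar> < \<delta> \<Longrightarrow> norm (w t - w s - (t - s) *\<^sub>R v) \<le> e * (t - s)"
        using key[OF \<open>0 < e\<close>] by blast
      have "norm (w y - w x0 - (y - x0) *\<^sub>R v) \<le> e * norm (y - x0)"
        if y: "y \<in> {0..T}" "norm (y - x0) < \<delta>" for y
      proof (cases "x0 \<le> y")
        case True
        then show ?thesis using \<delta>[OF x0 y(1)] y \<open>0 < \<delta>\<close> by simp
      next
        case False
        have "norm (w y - w x0 - (y - x0) *\<^sub>R v) = norm (w x0 - w y - (x0 - y) *\<^sub>R v)"
          by (subst norm_minus_cancel[symmetric]) (simp add: algebra_simps)
        then show ?thesis using \<delta>[OF y(1) x0] y False \<open>0 < \<delta>\<close> by simp
      qed
      then show "\<exists>d>0. \<forall>y\<in>{0..T}. norm (y - x0) < d \<longrightarrow> norm (w y - w x0 - (y - x0) *\<^sub>R v) \<le> e * norm (y - x0)"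
        using \<open>0 < \<delta>\<close> by blast
    qed
  qed
  have "(\<lambda>n. c (r n)) \<longlonglongrightarrow> w 0"
    using lim_at[of 0] T by (simp add: P0)
  moreover have "(\<lambda>n. euler F (T / real (Suc (r n))) (c (r n)) (Suc (r n))) \<longlonglongrightarrow> w T"
    using lim_at[of T] T by (simp add: PT h_def del: euler.simps)
  ultimately show ?thesis
    using that[OF r deriv] by blast
qed

text \<open>A finite composition of continuous maps, hence continuous in the initial value even
  where exact solutions are not unique. The bound \<open>real k * h \<le> T\<close> keeps the nodes
  in the domain where \<open>F\<close> is continuous.\<close>

lemma continuous_on_euler:
  fixes F :: "real \<Rightarrow> 'a::real_normed_vector \<Rightarrow> 'a"
  assumes contF: "continuous_on ({0..T} \<times> UNIV) (\<lambda>(x, v). F x v)"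
    and "0 \<le> h" "real k * h \<le> T"
  shows "continuous_on S (\<lambda>c. euler F h c k)"
  using assms(3)
proof (induction k)
  case (Suc k)
  have "0 \<le> real k * h" "real k * h \<le> T"
    using Suc.prems assms(2) by (auto simp: distrib_right)
  moreover from this have IH: "continuous_on S (\<lambda>c. euler F h c k)"
    using Suc.IH by simp
  ultimately have "continuous_on S (\<lambda>c. case (real k * h, euler F h c k) of (x, v) \<Rightarrow> F x v)"
    by (intro continuous_on_compose2[OF contF] continuous_intros) auto
  then show ?case
    using IH by (auto intro!: continuous_intros)
qed simp

section \<open>Periodic orbits of planar systems\<close>

definition clamp_abs :: "real \<Rightarrow> real \<Rightarrow> real" where
  "clamp_abs B t = max (- B) (min B t)"

lemma clamp_abs_in: "0 \<le> B \<Longrightarrow> clamp_abs B t \<in> {- B..B}"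
  by (auto simp: clamp_abs_def)

lemma abs_clamp_abs_le: "0 \<le> B \<Longrightarrow> \<bar>clamp_abs B t\<bar> \<le> B"
  by (auto simp: clamp_abs_def)

lemma clamp_abs_eq: "\<bar>t\<bar> \<le> B \<Longrightarrow> clamp_abs B t = t"
  by (auto simp: clamp_abs_def)

lemma clamp_abs_pos_iff [simp]: "0 < B \<Longrightarrow> 0 < clamp_abs B t \<longleftrightarrow> 0 < t"
  "0 < B \<Longrightarrow> clamp_abs B t < 0 \<longleftrightarrow> t < 0"
  by (auto simp: clamp_abs_def)

lemma continuous_on_clamp_abs [continuous_intros]:
  "continuous_on S f \<Longrightarrow> continuous_on S (\<lambda>x. clamp_abs B (f x))"
  unfolding clamp_abs_def by (intro continuous_intros)

text \<open>A Poincare--Miranda argument: on the boundary of a large rectangle of initial values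
  \<open>(a, b)\<close> of the Euler scheme the sign of \<open>b\<close> controls \<open>u(T) - u(0)\<close> and the sign of
  \<open>a\<close> controls \<open>y(T) - y(0)\<close>; hence the crossed components in the map to which Brouwer's
  theorem is applied.\<close>

lemma euler_periodic:
  fixes \<psi> :: "real \<Rightarrow> real" and r :: "real \<Rightarrow> real \<Rightarrow> real"
  defines "F \<equiv> \<lambda>x v. (\<psi> (snd v), r x (fst v))"
  assumes T: "0 < T"
    and \<psi>: "continuous_on UNIV \<psi>" "\<And>t. \<bar>\<psi> t\<bar> \<le> L" "\<And>t. 0 < t \<Longrightarrow> 0 < \<psi> t" "\<And>t. t < 0 \<Longrightarrow> \<psi> t < 0"
    and r: "continuous_on ({0..T} \<times> UNIV) (\<lambda>(x, u). r x u)" "\<And>x u. x \<in> {0..T} \<Longrightarrow> \<bar>r x u\<bar> \<le> C"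
      "\<And>x u. x \<in> {0..T} \<Longrightarrow> A \<le> u \<Longrightarrow> 0 < r x u" "\<And>x u. x \<in> {0..T} \<Longrightarrow> u \<le> - A \<Longrightarrow> r x u < 0"
    and A0: "A + L * T \<le> A0" "0 \<le> A0" and B0: "C * T < B0"
  shows "\<exists>c \<in> {- A0..A0} \<times> {- B0..B0}. euler F (T / real (Suc n)) c (Suc n) = c"
proof -
  define h where "h = T / real (Suc n)"
  have h: "0 < h" "real (Suc n) * h = T"
    using T by (auto simp: h_def simp del: of_nat_Suc)
  have L: "0 \<le> L" using order.trans[OF abs_ge_zero \<psi>(2)] .
  have C: "0 \<le> C" using order.trans[OF abs_ge_zero r(2)[of 0]] T by simp
  have "0 < B0" using B0 C T by (meson less_le_trans mult_nonneg_nonneg less_imp_le not_le)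
  have node: "real k * h \<in> {0..T}" "real k * h \<le> T" if "k \<le> Suc n" for k
    using that h mult_right_mono[of "real k" "real (Suc n)" h] by auto
  define E where "E = (\<lambda>c. euler F h c (Suc n))"
  have contF: "continuous_on ({0..T} \<times> UNIV) (\<lambda>(x, v). F x v)"
  proof -
    have "continuous_on ({0..T} \<times> (UNIV :: (real \<times> real) set)) (\<lambda>z. (\<lambda>(x, u). r x u) (fst z, fst (snd z)))"
      by (rule continuous_on_compose2[OF r(1)]) (auto intro!: continuous_intros)
    moreover have "continuous_on ({0..T} \<times> (UNIV :: (real \<times> real) set)) (\<lambda>z. \<psi> (snd (snd z)))"
      by (rule continuous_on_compose2[OF \<psi>(1)]) (auto intro!: continuous_intros)
    ultimately show ?thesis
      by (auto simp: F_def case_prod_beta intro!: continuous_intros)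
  qed
  have contE: "continuous_on S E" for S
    unfolding E_def using h by (intro continuous_on_euler[OF contF]) auto
  have fst_sum: "fst (euler F h c k) - fst c = (\<Sum>j<k. h * \<psi> (snd (euler F h c j)))" for c k
    using arg_cong[OF euler_eq_sum[of F h c k], of fst] by (simp add: F_def fst_sum)
  have snd_sum: "snd (euler F h c k) - snd c = (\<Sum>j<k. h * r (real j * h) (fst (euler F h c j)))" for c k
    using arg_cong[OF euler_eq_sum[of F h c k], of snd] by (simp add: F_def snd_sum)
  have fst_bound: "\<bar>fst (euler F h c k) - fst c\<bar> \<le> L * T" if "k \<le> Suc n" for c k
  proof -
    have "\<bar>fst (euler F h c k) - fst c\<bar> \<le> (\<Sum>j<k. h * L)"
      unfolding fst_sum using \<psi>(2) h
      by (intro order.trans[OF sum_abs sum_mono]) (simp add: abs_mult)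
    also have "\<dots> = L * (real k * h)" by simp
    also have "\<dots> \<le> L * T"
      using node(2)[OF that] L by (rule mult_left_mono)
    finally show ?thesis .
  qed
  have snd_bound: "\<bar>snd (euler F h c k) - snd c\<bar> \<le> C * T" if "k \<le> Suc n" for c k
  proof -
    have "\<bar>snd (euler F h c k) - snd c\<bar> \<le> (\<Sum>j<k. h * C)"
      unfolding snd_sum using r(2)[OF node(1)] h that
      by (intro order.trans[OF sum_abs sum_mono]) (simp add: abs_mult)
    also have "\<dots> = C * (real k * h)" by simp
    also have "\<dots> \<le> C * T"
      using node(2)[OF that] C by (rule mult_left_mono)
    finally show ?thesis .
  qed
  \<comment> \<open>Along the scheme the second component moves by at most \<open>C * T\<close>,
    which is less than \<open>B0\<close>; it therefore keeps its sign and drives the first component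
    in one direction.\<close>
  have b_pos: "fst c < fst (E c)" if "snd c = B0" for c
  proof -
    have "0 < fst (euler F h c (Suc n)) - fst c"
      unfolding fst_sum
    proof (rule sum_pos)
      fix j assume "j \<in> {..<Suc n}"
      then have "0 < snd (euler F h c j)"
        using snd_bound[of j c] B0 that by (auto simp: abs_le_iff)
      then show "0 < h * \<psi> (snd (euler F h c j))" using \<psi>(3) h by simp
    qed auto
    then show ?thesis by (simp add: E_def)
  qed
  have b_neg: "fst (E c) < fst c" if "snd c = - B0" for c
  proof -
    have "fst (euler F h c (Suc n)) - fst c < (\<Sum>j<Suc n. 0)"
      unfolding fst_sum
    proof (rule sum_strict_mono)
      fix j assume "j \<in> {..<Suc n}"
      then have "snd (euler F h c j) < 0"
        using snd_bound[of j c] B0 that by (auto simp: abs_le_iff)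
      then show "h * \<psi> (snd (euler F h c j)) < 0"
        using \<psi>(4) h by (simp add: mult_pos_neg)
    qed auto
    then show ?thesis by (simp add: E_def)
  qed
  \<comment> \<open>Likewise the first component moves by at most \<open>L * T\<close>, so it stays
    in the range where \<open>r\<close> has a fixed sign.\<close>
  have a_pos: "snd c < snd (E c)" if "fst c = A0" for c
  proof -
    have "0 < snd (euler F h c (Suc n)) - snd c"
      unfolding snd_sum
    proof (rule sum_pos)
      fix j assume j: "j \<in> {..<Suc n}"
      then have "A \<le> fst (euler F h c j)"
        using fst_bound[of j c] A0 that by (auto simp: abs_le_iff)
      then show "0 < h * r (real j * h) (fst (euler F h c j))"
        using r(3) node(1)[of j] j h by simp
    qed auto
    then show ?thesis by (simp add: E_def)
  qed
  have a_neg: "snd (E c) < snd c" if "fst c = - A0" for c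
  proof -
    have "snd (euler F h c (Suc n)) - snd c < (\<Sum>j<Suc n. 0)"
      unfolding snd_sum
    proof (rule sum_strict_mono)
      fix j assume j: "j \<in> {..<Suc n}"
      then have "fst (euler F h c j) \<le> - A"
        using fst_bound[of j c] A0 that by (auto simp: abs_le_iff)
      then show "h * r (real j * h) (fst (euler F h c j)) < 0"
        using r(4) node(1)[of j] j h by (simp add: mult_pos_neg)
    qed auto
    then show ?thesis by (simp add: E_def)
  qed
  \<comment> \<open>With the minus signs the unclamped map points into the rectangle on each of the
    four faces, so a fixed point cannot be an effect of the clamping.\<close>
  define G where "G = (\<lambda>c. (clamp_abs A0 (fst c - (snd (E c) - snd c)), clamp_abs B0 (snd c - (fst (E c) - fst c))))"
  define S where "S = {- A0..A0} \<times> {- B0..B0}"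
  obtain c where c: "c \<in> S" "G c = c"
  proof (rule brouwer[of S G])
    show "compact S" "convex S" unfolding S_def by (auto intro: compact_Times convex_Times)
    show "S \<noteq> {}" unfolding S_def using \<open>0 < B0\<close> A0 by auto
    show "continuous_on S G" unfolding G_def by (intro continuous_intros contE)
    show "G \<in> S \<rightarrow> S"
      unfolding S_def G_def using clamp_abs_in[of A0] clamp_abs_in[of B0] \<open>0 < B0\<close> A0 by auto
  qed
  have "fst (E c) = fst c"
  proof (rule ccontr)
    assume "fst (E c) \<noteq> fst c"
    moreover have "snd c = clamp_abs B0 (snd c - (fst (E c) - fst c))"
      using c(2) by (metis G_def snd_conv)
    ultimately have "snd c = - B0 \<and> fst c < fst (E c) \<or> snd c = B0 \<and> fst (E c) < fst c"
      using c(1) by (auto simp: clamp_abs_def S_def mem_Times_iff max_def min_def split: if_splits)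
    then show False using b_pos[of c] b_neg[of c] by auto
  qed
  moreover have "snd (E c) = snd c"
  proof (rule ccontr)
    assume "snd (E c) \<noteq> snd c"
    moreover have "fst c = clamp_abs A0 (fst c - (snd (E c) - snd c))"
      using c(2) by (metis G_def fst_conv)
    ultimately have "fst c = - A0 \<and> snd c < snd (E c) \<or> fst c = A0 \<and> snd (E c) < snd c"
      using c(1) by (auto simp: clamp_abs_def S_def mem_Times_iff max_def min_def split: if_splits)
    then show False using a_pos[of c] a_neg[of c] by auto
  qed
  ultimately have "E c = c" by (simp add: prod_eq_iff)
  then show ?thesis
    using c(1) unfolding E_def h_def S_def by blast
qed

text \<open>\<open>\<psi>\<close> may be unbounded, whereas the Euler argument needs a bounded speed
  \<open>L\<close>. The component y starts in [-B0, B0] and varies by at most \<open>C * T\<close>,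
  so cutting \<open>\<psi>\<close> off at \<open>Y\<close> does not affect the solution that is
  found.\<close>

lemma periodic_system_solution:
  fixes \<psi> :: "real \<Rightarrow> real" and r :: "real \<Rightarrow> real \<Rightarrow> real"
  assumes T: "0 < T"
    and \<psi>: "continuous_on UNIV \<psi>" "\<And>t. 0 < t \<Longrightarrow> 0 < \<psi> t" "\<And>t. t < 0 \<Longrightarrow> \<psi> t < 0"
    and r: "continuous_on ({0..T} \<times> UNIV) (\<lambda>(x, u). r x u)" "\<And>x u. x \<in> {0..T} \<Longrightarrow> \<bar>r x u\<bar> \<le> C"
      "\<And>x u. x \<in> {0..T} \<Longrightarrow> A \<le> u \<Longrightarrow> 0 < r x u" "\<And>x u. x \<in> {0..T} \<Longrightarrow> u \<le> - A \<Longrightarrow> r x u < 0"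
  obtains u y where
    "\<And>x. x \<in> {0..T} \<Longrightarrow> (u has_real_derivative \<psi> (y x)) (at x within {0..T})"
    "\<And>x. x \<in> {0..T} \<Longrightarrow> (y has_real_derivative r x (u x)) (at x within {0..T})"
    "u 0 = u T" "y 0 = y T"
proof -
  have C: "0 \<le> C" using order.trans[OF abs_ge_zero r(2)[of 0]] T by simp
  define B0 where "B0 = C * T + 1"
  define Y where "Y = B0 + C * T"
  have "0 \<le> C * T" using C T by simp
  then have B0: "0 < B0" "0 < Y" by (auto simp: B0_def Y_def)
  define \<psi>' where "\<psi>' = (\<lambda>t. \<psi> (clamp_abs Y t))"
  obtain L where L: "0 < L" "\<And>t. t \<in> {- Y..Y} \<Longrightarrow> \<bar>\<psi> t\<bar> \<le> L"
    using continuous_on_Icc_bounded[of "- Y" Y \<psi>] continuous_on_subset[OF \<psi>(1)] by blast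
  have cont\<psi>': "continuous_on S \<psi>'" for S
    unfolding \<psi>'_def by (rule continuous_on_compose2[OF \<psi>(1)]) (auto intro!: continuous_intros)
  have \<psi>': "\<bar>\<psi>' t\<bar> \<le> L" "0 < t \<Longrightarrow> 0 < \<psi>' t" "t < 0 \<Longrightarrow> \<psi>' t < 0" for t
    using L(2)[OF clamp_abs_in] \<psi> B0 by (auto simp: \<psi>'_def)
  define A0 where "A0 = max 0 (A + L * T)"
  define F where "F = (\<lambda>x v. (\<psi>' (snd v), r x (fst v)))"
  have "\<exists>c \<in> {- A0..A0} \<times> {- B0..B0}. euler F (T / real (Suc n)) c (Suc n) = c" for n
    unfolding F_def
    by (rule euler_periodic[OF T cont\<psi>' \<psi>' r]) (auto simp: A0_def B0_def)
  then obtain c where c: "\<And>n. c n \<in> {- A0..A0} \<times> {- B0..B0}"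
    "\<And>n. euler F (T / real (Suc n)) (c n) (Suc n) = c n"
    by metis
  have contF: "continuous_on ({0..T} \<times> UNIV) (\<lambda>(x, v). F x v)"
  proof -
    have "continuous_on ({0..T} \<times> (UNIV :: (real \<times> real) set)) (\<lambda>z. (\<lambda>(x, u). r x u) (fst z, fst (snd z)))"
      by (rule continuous_on_compose2[OF r(1)]) (auto intro!: continuous_intros)
    moreover have "continuous_on ({0..T} \<times> (UNIV :: (real \<times> real) set)) (\<lambda>z. \<psi>' (snd (snd z)))"
      by (rule continuous_on_compose2[OF cont\<psi>']) (auto intro!: continuous_intros)
    ultimately show ?thesis
      by (auto simp: F_def case_prod_beta intro!: continuous_intros)
  qed
  have normF: "norm (F x v) \<le> L + C" if "x \<in> {0..T}" for x v
    using norm_Pair_le[of "\<psi>' (snd v)" "r x (fst v)"] \<psi>'(1)[of "snd v"] r(2)[OF that, of "fst v"]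
    by (simp add: F_def)
  have normc: "norm (c n) \<le> A0 + B0" for n
    using norm_Pair_le[of "fst (c n)" "snd (c n)"] c(1)[of n] by (auto simp: mem_Times_iff abs_le_iff)
  obtain w s where s: "strict_mono (s :: nat \<Rightarrow> nat)"
    and w: "\<And>x. x \<in> {0..T} \<Longrightarrow> (w has_vector_derivative F x (w x)) (at x within {0..T})"
    and w0: "(\<lambda>n. c (s n)) \<longlonglongrightarrow> w 0"
    and wT: "(\<lambda>n. euler F (T / real (Suc (s n))) (c (s n)) (Suc (s n))) \<longlonglongrightarrow> w T"
  proof (rule euler_compactness[where c = c, OF T contF])
    show "x \<in> {0..T} \<Longrightarrow> norm (F x v) \<le> L + C" for x v by (rule normF)
    show "norm (c n) \<le> A0 + B0" for n by (rule normc)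
  qed (rule that)
  have per: "w 0 = w T"
    using LIMSEQ_unique[OF w0] wT unfolding c(2) by blast
  have "closed ({- A0..A0} \<times> {- B0..B0})"
    by (intro closed_Times) auto
  then have "w 0 \<in> {- A0..A0} \<times> {- B0..B0}"
    using c(1) w0 by (rule closed_sequentially)
  then have snd0: "\<bar>snd (w 0)\<bar> \<le> B0" by (auto simp: mem_Times_iff)
  have u: "((\<lambda>x. fst (w x)) has_real_derivative \<psi>' (snd (w x))) (at x within {0..T})"
    and y: "((\<lambda>x. snd (w x)) has_real_derivative r x (fst (w x))) (at x within {0..T})"
    if "x \<in> {0..T}" for x
    using bounded_linear.has_vector_derivative[OF bounded_linear_fst w[OF that]]
      bounded_linear.has_vector_derivative[OF bounded_linear_snd w[OF that]]
    by (simp_all add: F_def has_real_derivative_iff_has_vector_derivative)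
  have y_bound: "\<bar>snd (w x)\<bar> \<le> Y" if x: "x \<in> {0..T}" for x
  proof -
    have "norm (snd (w x) - snd (w 0)) \<le> C * norm (x - 0)"
      by (rule field_differentiable_bound[OF _ y]) (use r(2) x T in auto)
    also have "\<dots> \<le> C * T" using x C by (auto intro: mult_left_mono)
    finally show ?thesis using snd0 unfolding Y_def by (simp add: abs_le_iff)
  qed
  show ?thesis
  proof (rule that)
    show "((\<lambda>x. fst (w x)) has_real_derivative \<psi> (snd (w x))) (at x within {0..T})" if "x \<in> {0..T}" for x
      using u[OF that] clamp_abs_eq[OF y_bound[OF that]] by (simp add: \<psi>'_def)
    show "((\<lambda>x. snd (w x)) has_real_derivative r x (fst (w x))) (at x within {0..T})" if "x \<in> {0..T}" for x
      using y[OF that] .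
  qed (use per in auto)
qed

section \<open>Sub- and supersolutions\<close>

lemma periodic_C1_scale:
  assumes "periodic_C1 T p u du w"
  shows "periodic_C1 T p (\<lambda>x. c * u x) (\<lambda>x. c * du x) (\<lambda>x. phi p c * w x)"
  using assms unfolding periodic_C1_def phi_mult
  by (auto intro!: DERIV_cmult continuous_intros)

text \<open>Here \<open>u = exp z\<close> with \<open>\<phi>\<^sub>p(z') = y\<close> and \<open>y' = k\<close>; the constant of integration
  in \<open>y\<close> is chosen such that \<open>z\<close> is periodic.\<close>

lemma periodic_profile:
  assumes T: "0 < T" and p: "1 < p" and k: "continuous_on {0..T} k" "integral {0..T} k = 0"
    and K: "\<And>x. x \<in> {0..T} \<Longrightarrow> \<bar>k x\<bar> \<le> K"
  obtains u du w y where "periodic_C1 T p u du w"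
    "\<And>x. x \<in> {0..T} \<Longrightarrow> 0 < u x" "\<And>x. x \<in> {0..T} \<Longrightarrow> \<bar>y x\<bar> \<le> 2 * T * K"
    "\<And>x. x \<in> {0<..<T} \<Longrightarrow> w x / phi p (u x) = k x + (p - 1) * \<bar>y x\<bar> powr conj_exp p"
proof -
  define \<psi> where "\<psi> = phi (conj_exp p)"
  have \<psi>1: "1 < conj_exp p" using p by (rule conj_exp_gt_1)
  define k1 where "k1 = (\<lambda>x. integral {0..x} k)"
  have k1: "(k1 has_real_derivative k x) (at x within {0..T})" if "x \<in> {0..T}" for x
    unfolding k1_def using integral_has_real_derivative[OF k(1) that] .
  have k1_0: "k1 0 = 0" "k1 T = 0" by (simp_all add: k1_def k(2))
  have cont_k1: "continuous_on {0..T} k1"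
    using k1 by (meson DERIV_continuous continuous_on_eq_continuous_within)
  have K0: "0 \<le> K" using K[of 0] T by simp
  have k1_bound: "\<bar>k1 x\<bar> \<le> T * K" if x: "x \<in> {0..T}" for x
  proof -
    have "norm (k1 x - k1 0) \<le> K * norm (x - 0)"
      by (rule field_differentiable_bound[OF _ k1]) (use K x T in auto)
    also have "\<dots> \<le> K * T" using x K0 by (auto intro: mult_left_mono)
    finally show ?thesis by (simp add: k1_0 mult.commute)
  qed
  \<comment> \<open>The increment of z over [0, T] as a function of the constant c in y = c +
    k1.\<close>
  define I where "I = (\<lambda>c. integral {0..T} (\<lambda>x. \<psi> (c + k1 x)))"
  have cont_I: "continuous_on S I" for S
  proof -
    have "continuous_on (S \<times> cbox 0 T) (\<lambda>z. \<psi> (fst z + k1 (snd z)))"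
      unfolding \<psi>_def
      by (intro continuous_intros \<psi>1 continuous_on_compose2[OF cont_k1]) auto
    then have "continuous_on S (\<lambda>c. integral (cbox 0 T) (\<lambda>x. \<psi> (c + k1 x)))"
      by (intro integral_continuous_on_param) (simp add: case_prod_beta)
    then show ?thesis by (simp add: I_def)
  qed
  have cont_arg: "continuous_on {0..T} (\<lambda>x. \<psi> (c + k1 x))" for c
    unfolding \<psi>_def by (intro continuous_intros \<psi>1 cont_k1)
  \<comment> \<open>As |k1| <= T K, the integrand has a fixed sign at c = -T K and at c = T K. A
    root in between also yields the factor 2 in the bound for y.\<close>
  have "\<exists>c. - (T * K) \<le> c \<and> c \<le> T * K \<and> I c = 0"
  proof (rule IVT')
    show "- (T * K) \<le> T * K" using T K0 by simp
    show "continuous_on {- (T * K)..T * K} I" by (rule cont_I)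
    have "\<psi> (- (T * K) + k1 x) \<le> \<psi> 0" if "x \<in> {0..T}" for x
      using k1_bound[OF that] \<psi>1 by (simp add: \<psi>_def del: phi_0)
    then have "I (- (T * K)) \<le> integral {0..T} (\<lambda>x. 0)"
      unfolding I_def by (intro integral_le integrable_continuous_real cont_arg) (auto simp: \<psi>_def)
    then show "I (- (T * K)) \<le> 0" by simp
    have "\<psi> 0 \<le> \<psi> (T * K + k1 x)" if "x \<in> {0..T}" for x
      using k1_bound[OF that] \<psi>1 by (simp add: \<psi>_def del: phi_0)
    then have "integral {0..T} (\<lambda>x. 0) \<le> I (T * K)"
      unfolding I_def by (intro integral_le integrable_continuous_real cont_arg) (auto simp: \<psi>_def)
    then show "0 \<le> I (T * K)" by simp
  qed
  then obtain c where c: "- (T * K) \<le> c" "c \<le> T * K" "I c = 0" by blast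
  define y where "y = (\<lambda>x. c + k1 x)"
  define z where "z = (\<lambda>x. integral {0..x} (\<lambda>s. \<psi> (y s)))"
  have y: "(y has_real_derivative k x) (at x within {0..T})" if "x \<in> {0..T}" for x
    unfolding y_def using k1[OF that] by (auto intro!: derivative_eq_intros)
  have z: "(z has_real_derivative \<psi> (y x)) (at x within {0..T})" if "x \<in> {0..T}" for x
    unfolding z_def using integral_has_real_derivative[OF cont_arg that, of c] by (simp add: y_def)
  have z_T: "z 0 = z T" using c(3) by (simp add: z_def I_def y_def)
  have at: "at x within {0..T} = at x" if "x \<in> {0<..<T}" for x
    using at_within_interior[of x "{0..T}"] that by simp
  define u where "u = (\<lambda>x. exp (z x))"
  define du where "du = (\<lambda>x. exp (z x) * \<psi> (y x))"
  define w where "w = (\<lambda>x. phi p (u x) * (k x + (p - 1) * \<bar>y x\<bar> powr conj_exp p))"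
  have phi_u: "phi p (u x) = exp ((p - 1) * z x)" for x
    by (simp add: u_def phi_pos_eq powr_def)
  have phi_du: "phi p (du x) = exp ((p - 1) * z x) * y x" for x
    using p phi_u[of x] by (simp add: du_def phi_mult \<psi>_def u_def)
  show ?thesis
  proof (rule that[of u du w y])
    have cont_z: "continuous_on {0..T} z"
      using z by (meson DERIV_continuous continuous_on_eq_continuous_within)
    show "periodic_C1 T p u du w"
      unfolding periodic_C1_def
    proof (intro conjI ballI)
      show "(u has_real_derivative du x) (at x within {0..T})" if "x \<in> {0..T}" for x
        unfolding u_def du_def using z[OF that] by (auto intro!: derivative_eq_intros)
      show "continuous_on {0..T} du"
        unfolding du_def using cont_arg[of c] by (auto simp: y_def intro!: continuous_intros cont_z)
      show "u 0 = u T" "du 0 = du T" by (simp_all add: u_def du_def z_T y_def k1_0)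
      fix x assume x: "x \<in> {0<..<T}"
      then have x': "x \<in> {0..T}" by simp
      have "((\<lambda>x. exp ((p - 1) * z x) * y x) has_real_derivative
          exp ((p - 1) * z x) * (k x + (p - 1) * (\<psi> (y x) * y x))) (at x)"
        using z[OF x'] y[OF x'] unfolding at[OF x]
        by (auto intro!: derivative_eq_intros simp: algebra_simps)
      then show "((\<lambda>x. phi p (du x)) has_real_derivative w x) (at x)"
        by (simp add: phi_du w_def phi_u \<psi>_def phi_mult_self)
    qed
    show "0 < u x" for x by (simp add: u_def)
    show "\<bar>y x\<bar> \<le> 2 * T * K" if "x \<in> {0..T}" for x
      using k1_bound[OF that] c by (auto simp: y_def abs_le_iff)
    show "w x / phi p (u x) = k x + (p - 1) * \<bar>y x\<bar> powr conj_exp p" for x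
      by (simp add: w_def phi_u)
  qed
qed

lemma divide_le_divide_mult_iff:
  fixes a b v w :: real
  assumes "0 < a" "0 < b"
  shows "v / b \<le> w / (a * b) \<longleftrightarrow> a * v \<le> w" "w / (a * b) \<le> v / b \<longleftrightarrow> w \<le> a * v"
  using assms by (simp_all add: field_simps)

locale p_laplace_problem =
  fixes T p :: real and q m f :: "real \<Rightarrow> real"
  assumes T: "0 < T" and p: "1 < p"
    and q: "continuous_on {0..T} q" "\<forall>x\<in>{0..T}. 0 \<le> q x" "\<exists>x\<in>{0..T}. q x \<noteq> 0"
    and f: "continuous_on {0..} f" "\<forall>s>0. 0 < f s"
    and m: "continuous_on {0..T} m" "\<forall>x\<in>{0..T}. 0 \<le> m x" "\<exists>x\<in>{0..T}. m x \<noteq> 0"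
    and anti: "strict_antimono_on {0<..} (\<lambda>s. f s / phi p s)"
    and f0: "filterlim (\<lambda>s. f s / phi p s) at_top (at_right 0)"
    and f_inf: "((\<lambda>s. f s / phi p s) \<longlongrightarrow> 0) at_top"
begin

definition G :: "real \<Rightarrow> real" where "G s = f s / phi p s"

text \<open>With this function the equation reads w = \<open>R \<mu> x (u x)\<close>, where w is the
  derivative of the flux.\<close>

definition R :: "real \<Rightarrow> real \<Rightarrow> real \<Rightarrow> real" where
  "R \<mu> x s = q x * phi p s - \<mu> * m x * f s"

lemma G_pos: "0 < s \<Longrightarrow> 0 < G s"
  using f(2) by (simp add: G_def phi_pos)

lemma G_less: "0 < s \<Longrightarrow> s < t \<Longrightarrow> G t < G s"
  using anti by (auto simp: G_def monotone_on_def)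

lemma G_le: "0 < s \<Longrightarrow> s \<le> t \<Longrightarrow> G t \<le> G s"
  using G_less[of s t] by (cases "s = t") auto

lemma continuous_on_G: "continuous_on {0<..} G"
  unfolding G_def[abs_def] using phi_pos p
  by (intro continuous_intros continuous_on_phi continuous_on_subset[OF f(1)])
    (auto simp: less_imp_neq[symmetric])

lemma R_div: "0 < s \<Longrightarrow> R \<mu> x s / phi p s = q x - \<mu> * m x * G s"
  using phi_pos[of s p] by (simp add: R_def G_def diff_divide_distrib)

lemma continuous_on_R:
  "continuous_on (UNIV \<times> {0..T} \<times> {0<..}) (\<lambda>(\<mu>, x, s). R \<mu> x s)"
proof -
  have 1: "continuous_on (UNIV \<times> {0..T} \<times> {0<..}) (\<lambda>z. q (fst (snd z)))"
    "continuous_on (UNIV \<times> {0..T} \<times> {0<..}) (\<lambda>z. m (fst (snd z)))"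
    by (rule continuous_on_compose2[OF q(1)] continuous_on_compose2[OF m(1)];
        auto intro!: continuous_intros)+
  have 2: "continuous_on (UNIV \<times> {0..T} \<times> {0<..}) (\<lambda>z. f (snd (snd z)))"
    by (rule continuous_on_compose2[OF f(1)]) (auto intro!: continuous_intros)
  show ?thesis
    unfolding R_def case_prod_beta by (intro continuous_intros 1 2 p)
qed

lemma continuous_not_0_interior:
  assumes "continuous_on {0..T} h" "\<exists>x\<in>{0..T}. h x \<noteq> (0 :: real)"
  shows "\<exists>x\<in>{0<..<T}. h x \<noteq> 0"
proof (rule ccontr)
  assume *: "\<not> ?thesis"
  obtain x0 where x0: "x0 \<in> {0..T}" "h x0 \<noteq> 0" using assms(2) by blast
  have "h x0 = 0"
    by (rule continuous_constant_on_closure[where S = "{0<..<T}"]) (use assms(1) T x0 * in auto)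
  with x0 show False by simp
qed

lemma positive_mean:
  assumes h: "continuous_on {0..T} h" "\<forall>x\<in>{0..T}. 0 \<le> h x" "\<exists>x\<in>{0..T}. h x \<noteq> (0 :: real)"
  shows "0 < integral {0..T} h / T"
proof -
  have "integral {0..T} h \<noteq> 0"
    using integral_eq_0_iff[OF h(1), of] h(2,3) T by auto
  moreover have "0 \<le> integral {0..T} h"
    using h by (intro integral_nonneg integrable_continuous_real) auto
  ultimately show ?thesis using T by simp
qed

text \<open>Where \<open>q\<close> vanishes constants are not supersolutions. With \<open>a\<close> the mean of \<open>q\<close>, take
  the profile of \<open>k = \<delta> (q - a)\<close>: its term \<open>\<bar>y\<bar>\<^sup>p\<^sup>'\<close> is of order \<open>\<delta>\<^sup>p\<^sup>'\<close> and thus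
  dominated by \<open>\<delta> a\<close> for small \<open>\<delta>\<close>. A large multiple makes \<open>G\<close> negligible.\<close>

lemma supersolution_exists:
  assumes "0 < \<mu>"
  obtains B dB wB where "periodic_C1 T p B dB wB" "\<And>x. x \<in> {0..T} \<Longrightarrow> 1 \<le> B x"
    "\<And>x. x \<in> {0<..<T} \<Longrightarrow> wB x \<le> R \<mu> x (B x)"
proof -
  define a where "a = integral {0..T} q / T"
  have a: "0 < a" unfolding a_def by (rule positive_mean[OF q])
  obtain Q where Q: "0 < Q" "\<And>x. x \<in> {0..T} \<Longrightarrow> \<bar>q x - a\<bar> \<le> Q"
    using continuous_on_Icc_bounded[OF continuous_on_diff[OF q(1) continuous_on_const[of _ a]]] by blast
  obtain M where M: "0 < M" "\<And>x. x \<in> {0..T} \<Longrightarrow> \<bar>m x\<bar> \<le> M"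
    using continuous_on_Icc_bounded[OF m(1)] by blast
  \<comment> \<open>The bound for (p - 1) |y|^{p'} that belongs to \<delta> = 1; it scales with
    \<delta>^{p'}.\<close>
  define b where "b = (p - 1) * (2 * T * Q) powr conj_exp p"
  have b: "0 < b" using p T Q by (simp add: b_def)
  \<comment> \<open>The second entry gives b \<delta>^{p'} <= \<delta> a / 2, as p' > 1; the entry 1
    gives \<delta> q <= q.\<close>
  define \<delta> where "\<delta> = min 1 ((a / (2 * b)) powr (1 / (conj_exp p - 1)))"
  have \<delta>: "0 < \<delta>" "\<delta> \<le> 1" using a b by (simp_all add: \<delta>_def)
  have "\<delta> powr (conj_exp p - 1) \<le> ((a / (2 * b)) powr (1 / (conj_exp p - 1))) powr (conj_exp p - 1)"
    using conj_exp_gt_1[OF p] \<delta> by (intro powr_mono2) (auto simp: \<delta>_def)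
  also have "\<dots> = a / (2 * b)"
    using conj_exp_gt_1[OF p] a b by (simp add: powr_powr)
  finally have "\<delta> powr conj_exp p / \<delta> \<le> a / (2 * b)"
    using \<delta> by (simp add: powr_diff)
  then have small: "b * \<delta> powr conj_exp p \<le> \<delta> * a / 2"
    using \<delta> b by (simp add: field_simps)
  obtain u du w y where u: "periodic_C1 T p u du w" and upos: "\<And>x. x \<in> {0..T} \<Longrightarrow> 0 < u x"
    and y: "\<And>x. x \<in> {0..T} \<Longrightarrow> \<bar>y x\<bar> \<le> 2 * T * (\<delta> * Q)"
    and w: "\<And>x. x \<in> {0<..<T} \<Longrightarrow> w x / phi p (u x) = \<delta> * (q x - a) + (p - 1) * \<bar>y x\<bar> powr conj_exp p"
  proof (rule periodic_profile[OF T p])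
    show "continuous_on {0..T} (\<lambda>x. \<delta> * (q x - a))" by (intro continuous_intros q)
    show "integral {0..T} (\<lambda>x. \<delta> * (q x - a)) = 0"
      using T q(1) by (simp add: integral_diff integrable_continuous_real a_def)
    show "\<bar>\<delta> * (q x - a)\<bar> \<le> \<delta> * Q" if "x \<in> {0..T}" for x
      using Q(2)[OF that] \<delta> by (simp add: abs_mult)
  qed (rule that)
  obtain l where l: "0 < l" "\<And>x. x \<in> {0..T} \<Longrightarrow> l \<le> u x"
  proof -
    obtain x0 where "x0 \<in> {0..T}" "\<And>x. x \<in> {0..T} \<Longrightarrow> u x0 \<le> u x"
      using continuous_attains_inf[OF compact_Icc _ periodic_C1D(6)[OF u]] T by auto
    then show ?thesis using that[of "u x0"] upos by blast
  qed
  have "\<forall>\<^sub>F s in at_top. G s < \<delta> * a / (2 * \<mu> * M)"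
    unfolding G_def using a \<delta> M \<open>0 < \<mu>\<close> by (intro order_tendstoD(2)[OF f_inf]) simp
  then obtain s where s: "1 \<le> s" "G s < \<delta> * a / (2 * \<mu> * M)"
    using eventually_happens'[OF _ eventually_conj[OF eventually_ge_at_top[of 1]], of "\<lambda>s. G s < \<delta> * a / (2 * \<mu> * M)"]
    by auto
  \<comment> \<open>Lifts the lower bound l of u to s, from where on \<mu> m G takes at most the
    remaining half of \<delta> a.\<close>
  define c where "c = s / l"
  have c: "0 < c" using s l by (simp add: c_def)
  have cu: "s \<le> c * u x" if "x \<in> {0..T}" for x
    using l that s by (simp add: c_def field_simps mult_left_mono)
  show ?thesis
  proof (rule that[OF periodic_C1_scale[OF u, of c]])
    show "1 \<le> c * u x" if "x \<in> {0..T}" for x using cu[OF that] s by simp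
    fix x assume x: "x \<in> {0<..<T}"
    then have x': "x \<in> {0..T}" by simp
    have "\<mu> * m x * G (c * u x) \<le> \<mu> * M * (\<delta> * a / (2 * \<mu> * M))"
      using M(2)[OF x'] m(2) x' \<open>0 < \<mu>\<close> G_le[of s "c * u x"] cu[OF x'] s G_pos[of "c * u x"] M(1)
      by (intro mult_mono) auto
    then have 1: "\<mu> * m x * G (c * u x) \<le> \<delta> * a / 2"
      using \<open>0 < \<mu>\<close> M by simp
    have "(p - 1) * \<bar>y x\<bar> powr conj_exp p \<le> (p - 1) * (2 * T * (\<delta> * Q)) powr conj_exp p"
      using y[OF x'] p conj_exp_gt_1[OF p] by (intro mult_left_mono powr_mono2) auto
    also have "\<dots> = b * \<delta> powr conj_exp p"
      using T Q \<delta> by (simp add: b_def powr_mult)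
    finally have 2: "(p - 1) * \<bar>y x\<bar> powr conj_exp p \<le> \<delta> * a / 2" using small by simp
    have 3: "\<delta> * q x \<le> q x"
      using q(2) x' \<delta> by (simp add: mult_left_le_one_le)
    have "w x / phi p (u x) \<le> q x - \<mu> * m x * G (c * u x)"
      unfolding w[OF x] using 1 2 3 by (simp add: right_diff_distrib)
    also have "\<dots> = R \<mu> x (c * u x) / phi p (c * u x)"
      using R_div[of "c * u x"] c upos[OF x'] by simp
    finally show "phi p c * w x \<le> R \<mu> x (c * u x)"
      using phi_pos[OF c, of p] phi_pos[OF upos[OF x'], of p]
      unfolding phi_mult by (simp add: divide_le_divide_mult_iff(1))
  qed
qed

text \<open>\<open>\<Lambda>\<close> is chosen to give q - \<Lambda> m the mean 0 that a profile
  requires. Here the term (p - 1) |y|^{p'} has the favourable sign, so no smallness has to be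
  arranged; a small multiple of the profile lies where \<open>G\<close> is at least
  \<open>\<Lambda> / \<mu>\<close>, because \<open>G\<close> tends to infinity at 0.\<close>

lemma subsolution_exists:
  assumes "0 < \<mu>"
  obtains A dA wA where "periodic_C1 T p A dA wA" "\<And>x. x \<in> {0..T} \<Longrightarrow> 0 < A x \<and> A x \<le> 1"
    "\<And>x. x \<in> {0<..<T} \<Longrightarrow> R \<mu> x (A x) \<le> wA x"
proof -
  define \<Lambda> where "\<Lambda> = integral {0..T} q / integral {0..T} m"
  have qm: "0 < integral {0..T} q" "0 < integral {0..T} m"
    using positive_mean[OF q] positive_mean[OF m] T by (simp_all add: zero_less_divide_iff)
  have \<Lambda>: "0 < \<Lambda>" using qm by (simp add: \<Lambda>_def)
  have cont: "continuous_on {0..T} (\<lambda>x. q x - \<Lambda> * m x)" by (intro continuous_intros q m)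
  obtain Q where Q: "0 < Q" "\<And>x. x \<in> {0..T} \<Longrightarrow> \<bar>q x - \<Lambda> * m x\<bar> \<le> Q"
    using continuous_on_Icc_bounded[OF cont] by blast
  obtain u du w y where u: "periodic_C1 T p u du w" and upos: "\<And>x. x \<in> {0..T} \<Longrightarrow> 0 < u x"
    and w: "\<And>x. x \<in> {0<..<T} \<Longrightarrow> w x / phi p (u x) = q x - \<Lambda> * m x + (p - 1) * \<bar>y x\<bar> powr conj_exp p"
  proof (rule periodic_profile[OF T p cont])
    show "integral {0..T} (\<lambda>x. q x - \<Lambda> * m x) = 0"
      using qm q(1) m(1) by (simp add: integral_diff integrable_continuous_real continuous_on_mult_left \<Lambda>_def)
    show "\<bar>q x - \<Lambda> * m x\<bar> \<le> Q" if "x \<in> {0..T}" for x using Q(2)[OF that] .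
  qed (rule that)
  obtain l where l: "0 < l" "\<And>x. x \<in> {0..T} \<Longrightarrow> \<bar>u x\<bar> \<le> l"
    using continuous_on_Icc_bounded[OF periodic_C1D(6)[OF u]] by blast
  have "\<forall>\<^sub>F s in at_right 0. \<Lambda> / \<mu> \<le> G s"
    unfolding G_def using f0 by (simp add: filterlim_at_top)
  moreover have "\<forall>\<^sub>F s in at_right 0. s \<in> {0<..<1::real}"
    by (rule eventually_at_right_real) simp
  ultimately obtain s where s: "0 < s" "s < 1" "\<Lambda> / \<mu> \<le> G s"
    using eventually_happens'[OF _ eventually_conj[of "\<lambda>s. \<Lambda> / \<mu> \<le> G s" "at_right 0" "\<lambda>s. s \<in> {0<..<1}"]]
    by (auto simp: trivial_limit_at_right_real)
  define c where "c = s / l"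
  have c: "0 < c" using s l by (simp add: c_def)
  have cu: "c * u x \<le> s" if "x \<in> {0..T}" for x
    using l(1) l(2)[OF that] s by (simp add: c_def field_simps abs_le_iff)
  show ?thesis
  proof (rule that[OF periodic_C1_scale[OF u, of c]])
    show "0 < c * u x \<and> c * u x \<le> 1" if "x \<in> {0..T}" for x
      using cu[OF that] s c upos[OF that] by simp
    fix x assume x: "x \<in> {0<..<T}"
    then have x': "x \<in> {0..T}" by simp
    have "\<Lambda> / \<mu> \<le> G (c * u x)"
      using s(3) G_le[of "c * u x" s] cu[OF x'] c upos[OF x'] by simp
    then have "\<Lambda> \<le> \<mu> * G (c * u x)" using \<open>0 < \<mu>\<close> by (simp add: field_simps)
    then have "m x * \<Lambda> \<le> m x * (\<mu> * G (c * u x))"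
      using m(2) x' by (intro mult_left_mono) auto
    moreover have "0 \<le> (p - 1) * \<bar>y x\<bar> powr conj_exp p" using p by simp
    ultimately have "q x - \<mu> * m x * G (c * u x) \<le> w x / phi p (u x)"
      unfolding w[OF x] by (simp add: algebra_simps)
    moreover have "q x - \<mu> * m x * G (c * u x) = R \<mu> x (c * u x) / phi p (c * u x)"
      using R_div[of "c * u x"] c upos[OF x'] by simp
    ultimately show "R \<mu> x (c * u x) \<le> phi p c * w x"
      using phi_pos[OF c, of p] phi_pos[OF upos[OF x'], of p]
      unfolding phi_mult by (simp add: divide_le_divide_mult_iff(2))
  qed
qed

end

section \<open>Existence, uniqueness and continuity\<close>

text \<open>Solutions of the truncated system are not known to be positive in advance, so plain
  differences replace logarithms. The strict inequality, later due to the restoring term, allows K =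
  0 and rules out a constant gap; the sign \<open>s\<close> covers bounds from above and from
  below.\<close>

lemma periodic_C1_max_0:
  assumes "0 < T" "1 < p" and u: "periodic_C1 T p u du w"
    and v: "\<And>x. x \<in> {0..T} \<Longrightarrow> (v has_real_derivative phi (conj_exp p) (y x)) (at x within {0..T})"
      "\<And>x. x \<in> {0..T} \<Longrightarrow> (y has_real_derivative r x) (at x within {0..T})" "v 0 = v T" "y 0 = y T"
    and s: "s = 1 \<or> s = - 1"
    and ineq: "\<And>x. x \<in> {0<..<T} \<Longrightarrow> 0 < s * (v x - u x) \<Longrightarrow> 0 < s * (r x - w x)"
    and x: "x \<in> {0..T}"
  shows "s * (v x - u x) \<le> 0"
proof (rule ccontr)
  assume neg: "\<not> s * (v x - u x) \<le> 0"
  have s2: "s * s = 1" using s by auto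
  have der: "((\<lambda>x. s * (y x - phi p (du x))) has_real_derivative s * (r x - w x)) (at x)"
    if "x \<in> {0<..<T}" for x
    using DERIV_cmult[OF DERIV_diff[OF v(2)[of x] has_field_derivative_at_within[OF periodic_C1D(3)[OF u that], of "{0..T}"]], of s]
      at_within_interior[of x "{0..T}"] that by simp
  have "\<exists>M>0. \<forall>x\<in>{0..T}. s * (v x - u x) = M \<and> s * (y x - phi p (du x)) = 0"
  proof (rule maximum_principle_periodic[where K = 0
        and D' = "\<lambda>x. s * (phi (conj_exp p) (y x) - du x)"])
    show "0 < T" by fact
    show "((\<lambda>x. s * (v x - u x)) has_real_derivative s * (phi (conj_exp p) (y x) - du x)) (at x within {0..T})"
      if "x \<in> {0..T}" for x
      using DERIV_cmult[OF DERIV_diff[OF v(1)[OF that] periodic_C1D(1)[OF u that]]] .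
    have "continuous_on {0..T} y"
      using v(2) by (meson DERIV_continuous continuous_on_eq_continuous_within)
    then show "continuous_on {0..T} (\<lambda>x. s * (y x - phi p (du x)))"
      using periodic_C1D(2)[OF u] \<open>1 < p\<close> by (intro continuous_intros)
    show "sgn (s * (phi (conj_exp p) (y x) - du x)) = sgn (s * (y x - phi p (du x)))" for x
      using sgn_phi_diff[OF \<open>1 < p\<close>, of "phi (conj_exp p) (y x)" "du x"] \<open>1 < p\<close> by (simp add: sgn_mult)
    show "\<exists>e. ((\<lambda>x. s * (y x - phi p (du x))) has_real_derivative e) (at x) \<and>
        - 0 * \<bar>s * (y x - phi p (du x))\<bar> \<le> e" if "x \<in> {0<..<T}" "0 < s * (v x - u x)" for x
      using der[OF that(1)] ineq[OF that] by (intro exI[of _ "s * (r x - w x)"]) simp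
    show "s * (v 0 - u 0) = s * (v T - u T)" "s * (y 0 - phi p (du 0)) = s * (y T - phi p (du T))"
      using v periodic_C1D(4,5)[OF u] by simp_all
    show "\<exists>x\<in>{0..T}. 0 < s * (v x - u x)" using x neg by (intro bexI[of _ x]) auto
  qed
  then obtain M where M: "0 < M" "\<And>x. x \<in> {0..T} \<Longrightarrow> s * (v x - u x) = M"
    "\<And>x. x \<in> {0..T} \<Longrightarrow> s * (y x - phi p (du x)) = 0" by blast
  have mid: "T / 2 \<in> {0<..<T}" using \<open>0 < T\<close> by simp
  have "((\<lambda>x. s * (y x - phi p (du x))) has_real_derivative 0) (at (T / 2))"
    by (rule has_field_derivative_transform_within_open[of "\<lambda>_. 0", where S = "{0<..<T}"])
      (use mid M(3) in auto)
  then have "s * (r (T / 2) - w (T / 2)) = 0"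
    using DERIV_unique[OF der[OF mid]] by blast
  moreover have "0 < s * (r (T / 2) - w (T / 2))"
    using ineq[OF mid] M(1) M(2)[of "T / 2"] mid by simp
  ultimately show False by (metis less_irrefl)
qed

context p_laplace_problem
begin

text \<open>A positive solution together with its derivative, without any condition outside [0, T];
  \<open>positive_solution_iff\<close> adds extensionality.\<close>

definition sol :: "real \<Rightarrow> (real \<Rightarrow> real) \<Rightarrow> (real \<Rightarrow> real) \<Rightarrow> bool" where
  "sol \<mu> u du \<longleftrightarrow> periodic_C1 T p u du (\<lambda>x. R \<mu> x (u x)) \<and> (\<forall>x\<in>{0..T}. 0 < u x)"

text \<open>Outside the sector between \<open>A\<close> and \<open>B\<close> the right-hand side is frozen and a bounded
  restoring term is added that keeps periodic solutions inside the sector.\<close>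

lemma sol_exists:
  assumes "0 < \<mu>" shows "\<exists>u du. sol \<mu> u du"
proof -
  obtain B dB wB where B: "periodic_C1 T p B dB wB" and B1: "\<And>x. x \<in> {0..T} \<Longrightarrow> 1 \<le> B x"
    and RB: "\<And>x. x \<in> {0<..<T} \<Longrightarrow> wB x \<le> R \<mu> x (B x)"
    using supersolution_exists[OF assms] by blast
  obtain A dA wA where A: "periodic_C1 T p A dA wA" and A1: "\<And>x. x \<in> {0..T} \<Longrightarrow> 0 < A x \<and> A x \<le> 1"
    and RA: "\<And>x. x \<in> {0<..<T} \<Longrightarrow> R \<mu> x (A x) \<le> wA x"
    using subsolution_exists[OF assms] by blast
  have AB: "A x \<le> B x" if "x \<in> {0..T}" for x using A1[OF that] B1[OF that] by linarith
  note contA = periodic_C1D(6)[OF A] and contB = periodic_C1D(6)[OF B]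
  obtain b where b: "0 < b" "\<And>x. x \<in> {0..T} \<Longrightarrow> \<bar>B x\<bar> \<le> b"
    using continuous_on_Icc_bounded[OF contB] by blast
  obtain a where a: "0 < a" "\<And>x. x \<in> {0..T} \<Longrightarrow> a \<le> A x"
  proof -
    obtain x0 where "x0 \<in> {0..T}" "\<And>x. x \<in> {0..T} \<Longrightarrow> A x0 \<le> A x"
      using continuous_attains_inf[OF compact_Icc _ contA] T by auto
    then show ?thesis using that[of "A x0"] A1 by blast
  qed
  \<comment> \<open>Projection of s onto the sector; its values lie in [a, b] with a > 0, where
    \<open>R\<close> is continuous and bounded.\<close>
  define cl where "cl = (\<lambda>x s. max (A x) (min (B x) s))"
  have cl_in: "cl x s \<in> {a..b}" if "x \<in> {0..T}" for x s
    using a(2)[OF that] b(2)[OF that] AB[OF that] by (auto simp: cl_def)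
  have cont_cl: "continuous_on ({0..T} \<times> UNIV) (\<lambda>z. cl (fst z) (snd z))"
    unfolding cl_def
    by (intro continuous_intros continuous_on_compose2[OF contA] continuous_on_compose2[OF contB]) auto
  have contR: "continuous_on ({0..T} \<times> UNIV) (\<lambda>z. R \<mu> (fst z) (cl (fst z) (snd z)))"
  proof -
    have "continuous_on ({0..T} \<times> UNIV)
        (\<lambda>z. (\<lambda>(\<mu>, x, s). R \<mu> x s) (\<mu>, fst z, cl (fst z) (snd z)))"
    proof (rule continuous_on_compose2[OF continuous_on_R])
      show "continuous_on ({0..T} \<times> UNIV) (\<lambda>z. (\<mu>, fst z, cl (fst z) (snd z)))"
        by (intro continuous_intros cont_cl)
      show "(\<lambda>z. (\<mu>, fst z, cl (fst z) (snd z))) ` ({0..T} \<times> UNIV) \<subseteq> UNIV \<times> {0..T} \<times> {0<..}"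
        using cl_in a(1) by (auto simp: mem_Times_iff) (meson less_le_trans)
    qed
    then show ?thesis by simp
  qed
  have "bounded ((\<lambda>(\<mu>, x, s). R \<mu> x s) ` ({\<mu>} \<times> {0..T} \<times> {a..b}))"
    using a(1) by (intro compact_imp_bounded compact_continuous_image continuous_on_subset[OF continuous_on_R] compact_Times)
      auto
  then obtain C where C: "0 < C" "\<forall>z\<in>(\<lambda>(\<mu>, x, s). R \<mu> x s) ` ({\<mu>} \<times> {0..T} \<times> {a..b}). \<bar>z\<bar> \<le> C"
    unfolding bounded_pos real_norm_def by blast
  have RC: "\<bar>R \<mu> x (cl x s)\<bar> \<le> C" if "x \<in> {0..T}" for x s
    using C(2) cl_in[OF that] that by auto
  define \<Theta> where "\<Theta> = C + 1"
  have \<Theta>: "0 < \<Theta>" "C < \<Theta>" using C by (auto simp: \<Theta>_def)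
  define r where "r = (\<lambda>x s. R \<mu> x (cl x s) + clamp_abs \<Theta> (s - cl x s))"
  obtain u y where u: "\<And>x. x \<in> {0..T} \<Longrightarrow> (u has_real_derivative phi (conj_exp p) (y x)) (at x within {0..T})"
    and y: "\<And>x. x \<in> {0..T} \<Longrightarrow> (y has_real_derivative r x (u x)) (at x within {0..T})"
    and per: "u 0 = u T" "y 0 = y T"
  proof (rule periodic_system_solution[OF T, where \<psi> = "phi (conj_exp p)" and r = r and C = "C + \<Theta>" and A = "b + \<Theta>"])
    show "continuous_on UNIV (phi (conj_exp p))"
      by (rule continuous_on_phi[OF conj_exp_gt_1[OF p]])
    show "0 < phi (conj_exp p) t" if "0 < t" for t using phi_pos[OF that] .
    show "phi (conj_exp p) t < 0" if "t < 0" for t using phi_pos[of "- t" "conj_exp p"] that by simp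
    show "continuous_on ({0..T} \<times> UNIV) (\<lambda>(x, u). r x u)"
      unfolding r_def case_prod_beta by (intro continuous_intros contR cont_cl)
    fix x s assume x: "x \<in> {0..T}"
    show "\<bar>r x s\<bar> \<le> C + \<Theta>"
      unfolding r_def using RC[OF x, of s] abs_clamp_abs_le[of \<Theta> "s - cl x s"] \<Theta> by linarith
    show "0 < r x s" if "b + \<Theta> \<le> s"
    proof -
      have "clamp_abs \<Theta> (s - cl x s) = \<Theta>"
        using that cl_in[OF x, of s] \<Theta> by (auto simp: clamp_abs_def)
      then show ?thesis unfolding r_def using RC[OF x, of s] \<Theta> by linarith
    qed
    show "r x s < 0" if "s \<le> - (b + \<Theta>)"
    proof -
      have "clamp_abs \<Theta> (s - cl x s) = - \<Theta>"
        using that cl_in[OF x, of s] \<Theta> a(1) by (auto simp: clamp_abs_def)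
      then show ?thesis unfolding r_def using RC[OF x, of s] \<Theta> by linarith
    qed
  qed (rule that)
  have uB: "u x \<le> B x" if "x \<in> {0..T}" for x
  proof -
    have "1 * (u x - B x) \<le> 0"
    proof (rule periodic_C1_max_0[OF T p B u y per _ _ that])
      fix x assume x: "x \<in> {0<..<T}" and "0 < 1 * (u x - B x)"
      then have "cl x (u x) = B x" "B x < u x" using AB[of x] by (auto simp: cl_def)
      then show "0 < 1 * (r x (u x) - wB x)"
        using RB[OF x] clamp_abs_pos_iff(1)[OF \<Theta>(1), of "u x - B x"] by (simp add: r_def)
    qed auto
    then show ?thesis by simp
  qed
  have uA: "A x \<le> u x" if "x \<in> {0..T}" for x
  proof -
    have "- 1 * (u x - A x) \<le> 0"
    proof (rule periodic_C1_max_0[OF T p A u y per _ _ that])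
      fix x assume x: "x \<in> {0<..<T}" and "0 < - 1 * (u x - A x)"
      then have "cl x (u x) = A x" "u x < A x" using AB[of x] by (auto simp: cl_def)
      then show "0 < - 1 * (r x (u x) - wA x)"
        using RA[OF x] clamp_abs_pos_iff(2)[OF \<Theta>(1), of "u x - A x"] by (simp add: r_def)
    qed auto
    then show ?thesis by simp
  qed
  have ru: "r x (u x) = R \<mu> x (u x)" if "x \<in> {0..T}" for x
    using uA[OF that] uB[OF that] \<Theta>(1) by (simp add: r_def cl_def clamp_abs_def)
  have "sol \<mu> u (\<lambda>x. phi (conj_exp p) (y x))"
    unfolding sol_def periodic_C1_def
  proof (intro conjI ballI)
    show "(u has_real_derivative phi (conj_exp p) (y x)) (at x within {0..T})" if "x \<in> {0..T}" for x
      using u[OF that] .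
    have "continuous_on {0..T} y"
      using y by (meson DERIV_continuous continuous_on_eq_continuous_within)
    then show "continuous_on {0..T} (\<lambda>x. phi (conj_exp p) (y x))"
      by (intro continuous_intros conj_exp_gt_1 p)
    show "((\<lambda>x. phi p (phi (conj_exp p) (y x))) has_real_derivative R \<mu> x (u x)) (at x)"
      if "x \<in> {0<..<T}" for x
      using y[of x] ru[of x] at_within_interior[of x "{0..T}"] that p by simp
    show "u 0 = u T" "phi (conj_exp p) (y 0) = phi (conj_exp p) (y T)" using per by simp_all
    show "0 < u x" if "x \<in> {0..T}" for x using uA[OF that] A1[OF that] by simp
  qed
  then show ?thesis by blast
qed

text \<open>If the bound fails, \<open>comparison\<close> leaves only the case v < u throughout with
  equal quotients. At a point with m > 0 the strict decrease of \<open>G\<close> is incompatible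
  with this equality.\<close>

lemma sol_le_supersolution:
  assumes "0 < \<mu>" and u: "sol \<mu> u du" and v: "periodic_C1 T p v dv z"
    and vpos: "\<And>x. x \<in> {0..T} \<Longrightarrow> 0 < v x"
    and super: "\<And>x. x \<in> {0<..<T} \<Longrightarrow> z x / phi p (v x) \<le> q x - \<mu> * m x * G (v x)"
    and x: "x \<in> {0..T}"
  shows "u x \<le> v x"
proof (rule ccontr)
  have upos: "\<And>x. x \<in> {0..T} \<Longrightarrow> 0 < u x" and u': "periodic_C1 T p u du (\<lambda>x. R \<mu> x (u x))"
    using u by (auto simp: sol_def)
  assume "\<not> u x \<le> v x"
  moreover have "z x / phi p (v x) \<le> R \<mu> x (u x) / phi p (u x)" if "x \<in> {0<..<T}" "v x < u x" for x
  proof -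
    have "\<mu> * m x * G (u x) \<le> \<mu> * m x * G (v x)"
      using that vpos[of x] \<open>0 < \<mu>\<close> m(2) by (intro mult_left_mono G_le) auto
    then show ?thesis using super[OF that(1)] R_div[of "u x" \<mu> x] upos[of x] that by simp
  qed
  ultimately have less: "\<And>x. x \<in> {0..T} \<Longrightarrow> v x < u x"
    and eq: "\<And>x. x \<in> {0<..<T} \<Longrightarrow> R \<mu> x (u x) / phi p (u x) = z x / phi p (v x)"
    using comparison[OF T p u' v upos vpos] x by blast+
  \<comment> \<open>The point has to be interior, since the quotients are compared on the open
    interval.\<close>
  obtain x1 where x1: "x1 \<in> {0<..<T}" "m x1 \<noteq> 0"
    using continuous_not_0_interior[OF m(1,3)] by blast
  then have "0 < \<mu> * m x1" using m(2) \<open>0 < \<mu>\<close> by (simp add: less_le)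
  then have "\<mu> * m x1 * G (u x1) < \<mu> * m x1 * G (v x1)"
    using vpos[of x1] less[of x1] x1 by (intro mult_strict_left_mono G_less) auto
  then show False
    using eq[OF x1(1)] super[OF x1(1)] R_div[of "u x1" \<mu> x1] upos[of x1] x1 by simp
qed

text \<open>The same dichotomy, with \<open>v\<close> now in the place of the upper
  function.\<close>

lemma subsolution_le_sol:
  assumes "0 < \<mu>" and u: "sol \<mu> u du" and v: "periodic_C1 T p v dv z"
    and vpos: "\<And>x. x \<in> {0..T} \<Longrightarrow> 0 < v x"
    and sub: "\<And>x. x \<in> {0<..<T} \<Longrightarrow> q x - \<mu> * m x * G (v x) \<le> z x / phi p (v x)"
    and x: "x \<in> {0..T}"
  shows "v x \<le> u x"
proof (rule ccontr)
  have upos: "\<And>x. x \<in> {0..T} \<Longrightarrow> 0 < u x" and u': "periodic_C1 T p u du (\<lambda>x. R \<mu> x (u x))"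
    using u by (auto simp: sol_def)
  assume "\<not> v x \<le> u x"
  moreover have "R \<mu> x (u x) / phi p (u x) \<le> z x / phi p (v x)" if "x \<in> {0<..<T}" "u x < v x" for x
  proof -
    have "\<mu> * m x * G (v x) \<le> \<mu> * m x * G (u x)"
      using that upos[of x] \<open>0 < \<mu>\<close> m(2) by (intro mult_left_mono G_le) auto
    then show ?thesis using sub[OF that(1)] R_div[of "u x" \<mu> x] upos[of x] that by simp
  qed
  ultimately have less: "\<And>x. x \<in> {0..T} \<Longrightarrow> u x < v x"
    and eq: "\<And>x. x \<in> {0<..<T} \<Longrightarrow> z x / phi p (v x) = R \<mu> x (u x) / phi p (u x)"
    using comparison[OF T p v u' vpos upos] x by blast+
  obtain x1 where x1: "x1 \<in> {0<..<T}" "m x1 \<noteq> 0"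
    using continuous_not_0_interior[OF m(1,3)] by blast
  then have "0 < \<mu> * m x1" using m(2) \<open>0 < \<mu>\<close> by (simp add: less_le)
  then have "\<mu> * m x1 * G (v x1) < \<mu> * m x1 * G (u x1)"
    using upos[of x1] less[of x1] x1 by (intro mult_strict_left_mono G_less) auto
  then show False
    using eq[OF x1(1)] sub[OF x1(1)] R_div[of "u x1" \<mu> x1] upos[of x1] x1 by simp
qed

text \<open>Each of the two solutions is a supersolution for the other.\<close>

lemma sol_unique:
  assumes "0 < \<mu>" "sol \<mu> u du" "sol \<mu> v dv" "x \<in> {0..T}"
  shows "u x = v x"
proof -
  have "u x \<le> v x" if "sol \<mu> u du" "sol \<mu> v dv" for u du v dv
    using assms(1) that(1) _ _ _ assms(4)
  proof (rule sol_le_supersolution)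
    show "periodic_C1 T p v dv (\<lambda>x. R \<mu> x (v x))" "\<And>x. x \<in> {0..T} \<Longrightarrow> 0 < v x"
      using that by (auto simp: sol_def)
    then show "R \<mu> x (v x) / phi p (v x) \<le> q x - \<mu> * m x * G (v x)" if "x \<in> {0<..<T}" for x
      using that by (simp add: R_div)
  qed
  then show ?thesis using assms(2,3) by (meson antisym)
qed

lemma positive_solution_iff:
  "positive_solution T p q m f \<mu> u \<longleftrightarrow> u \<in> extensional {0..T} \<and> (\<exists>du. sol \<mu> u du)"
proof
  assume "positive_solution T p q m f \<mu> u"
  then obtain du w where u: "u \<in> X_per T p" "\<forall>x\<in>{0..T}. 0 < u x"
    and d: "\<forall>x\<in>{0..T}. (u has_real_derivative du x) (at x within {0..T})" "continuous_on {0..T} du"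
    and w: "\<forall>x\<in>{0<..<T}. ((\<lambda>y. phi p (du y)) has_real_derivative w x) (at x) \<and>
           - w x + q x * phi p (u x) = \<mu> * m x * f (u x)"
    and per: "u 0 = u T" "du 0 = du T"
    unfolding positive_solution_def solution_N_def by blast
  have "w x = R \<mu> x (u x)" if "x \<in> {0<..<T}" for x
    using bspec[OF w that] by (simp add: R_def)
  then have "sol \<mu> u du"
    unfolding sol_def periodic_C1_def using u d w per by auto
  then show "u \<in> extensional {0..T} \<and> (\<exists>du. sol \<mu> u du)"
    using u by (auto simp: X_per_def)
next
  assume *: "u \<in> extensional {0..T} \<and> (\<exists>du. sol \<mu> u du)"
  then obtain du where u: "periodic_C1 T p u du (\<lambda>x. R \<mu> x (u x))" "\<forall>x\<in>{0..T}. 0 < u x"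
    by (auto simp: sol_def)
  have "u \<in> X_per T p"
    using p * by (intro C1_in_X_per[OF T _ periodic_C1D(1,2,4)[OF u(1)]]) auto
  then show "positive_solution T p q m f \<mu> u"
    unfolding positive_solution_def solution_N_def
    using u periodic_C1D[OF u(1)]
    by (intro conjI exI[of _ du] exI[of _ "\<lambda>x. R \<mu> x (u x)"]) (auto simp: R_def)
qed

lemma sol_restrict:
  assumes "sol \<mu> u du" shows "sol \<mu> (restrict u {0..T}) du"
proof -
  have "(restrict u {0..T} has_real_derivative du x) (at x within {0..T})" if "x \<in> {0..T}" for x
    by (rule has_field_derivative_transform_within[where d = 1 and f = u])
      (use assms that in \<open>auto simp: sol_def periodic_C1_def\<close>)
  then show ?thesis
    using assms T by (simp add: sol_def periodic_C1_def)
qed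

lemma ex1_positive_solution:
  assumes "0 < \<mu>" shows "\<exists>!u. positive_solution T p q m f \<mu> u"
proof -
  obtain u du where "sol \<mu> u du" using sol_exists[OF assms] by blast
  then have "positive_solution T p q m f \<mu> (restrict u {0..T})"
    using sol_restrict unfolding positive_solution_iff by blast
  moreover have "u = v" if "positive_solution T p q m f \<mu> u" "positive_solution T p q m f \<mu> v" for u v
    using that sol_unique[OF assms] unfolding positive_solution_iff by (blast intro: extensionalityI)
  ultimately show ?thesis by blast
qed

text \<open>For \<mu> <= 0 the flux has a nonnegative derivative and is periodic, hence constant;
  but its derivative is at least \<open>q x * phi p (u x)\<close>, which is positive
  somewhere.\<close>

lemma sol_imp_pos:
  assumes "sol \<mu> u du" shows "0 < \<mu>"
proof (rule ccontr)
  assume "\<not> 0 < \<mu>"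
  have u: "periodic_C1 T p u du (\<lambda>x. R \<mu> x (u x))" and upos: "\<And>x. x \<in> {0..T} \<Longrightarrow> 0 < u x"
    using assms by (auto simp: sol_def)
  have "0 \<le> - \<mu> * m x * f (u x)" if "x \<in> {0..T}" for x
    using \<open>\<not> 0 < \<mu>\<close> m(2) f(2) upos[OF that] that by (intro mult_nonneg_nonneg) (auto simp: less_imp_le)
  then have R: "q x * phi p (u x) \<le> R \<mu> x (u x)" if "x \<in> {0..T}" for x
    using that by (fastforce simp: R_def)
  have qphi: "0 \<le> q x * phi p (u x)" if "x \<in> {0..T}" for x
    using q(2) phi_pos[OF upos[OF that], of p] that by simp
  define Y where "Y = (\<lambda>x. phi p (du x))"
  have contY: "continuous_on {0..T} Y"
    unfolding Y_def using periodic_C1D(2)[OF u] p by (intro continuous_intros)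
  have mono: "Y a \<le> Y b" if "0 \<le> a" "a \<le> b" "b \<le> T" for a b
  proof (rule DERIV_nonneg_imp_increasing_open[where f = Y])
    show "a \<le> b" by fact
    show "continuous_on {a..b} Y" using contY by (rule continuous_on_subset) (use that in auto)
    fix x assume x: "a < x" "x < b"
    then have "x \<in> {0<..<T}" using that by auto
    then have "(Y has_real_derivative R \<mu> x (u x)) (at x)" "0 \<le> R \<mu> x (u x)"
      using periodic_C1D(3)[OF u] R[of x] qphi[of x] by (auto simp: Y_def)
    then show "\<exists>y. (Y has_real_derivative y) (at x) \<and> 0 \<le> y" by blast
  qed
  have "Y 0 = Y T" using periodic_C1D(5)[OF u] by (simp add: Y_def)
  then have const: "Y x = Y 0" if "x \<in> {0..T}" for x
    using mono[of 0 x] mono[of x T] that by simp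
  obtain x1 where x1: "x1 \<in> {0<..<T}" "q x1 \<noteq> 0"
    using continuous_not_0_interior[OF q(1,3)] by blast
  have "(Y has_real_derivative 0) (at x1)"
    by (rule has_field_derivative_transform_within_open[of "\<lambda>_. Y 0", where S = "{0<..<T}"])
      (use x1 in \<open>auto intro: const[symmetric]\<close>)
  then have "R \<mu> x1 (u x1) = 0"
    using DERIV_unique periodic_C1D(3)[OF u x1(1)] unfolding Y_def by blast
  moreover have "0 < q x1 * phi p (u x1)"
    using x1 q(2) phi_pos[OF upos[of x1], of p] by (simp add: less_le)
  ultimately show False using R[of x1] x1 by simp
qed

end

section \<open>Continuous dependence on the parameter\<close>

lemma abs_diff_le_deriv_bound:
  fixes g g' :: "real \<Rightarrow> real"
  assumes g: "continuous_on {a..b} g"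
    and d: "\<And>x. x \<in> {a<..<b} \<Longrightarrow> (g has_real_derivative g' x) (at x)"
    and B: "\<And>x. x \<in> {a<..<b} \<Longrightarrow> \<bar>g' x\<bar> \<le> B"
    and st: "s \<in> {a..b}" "t \<in> {a..b}"
  shows "\<bar>g s - g t\<bar> \<le> B * \<bar>s - t\<bar>"
proof -
  have *: "\<bar>g t - g s\<bar> \<le> B * \<bar>t - s\<bar>" if st: "a \<le> s" "s < t" "t \<le> b" for s t
  proof -
    have "continuous_on {s..t} g"
      using g st by (rule_tac continuous_on_subset[OF g]) auto
    moreover have "g differentiable (at x)" if "s < x" "x < t" for x
      using d[of x] that st by (auto simp: real_differentiable_def)
    ultimately obtain l z where z: "s < z" "z < t" "(g has_real_derivative l) (at z)" "g t - g s = (t - s) * l"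
      using MVT[OF st(2)] by blast
    then have "l = g' z" using DERIV_unique[OF z(3) d[of z]] st by simp
    then have "\<bar>l\<bar> \<le> B" using B[of z] z st by simp
    then show ?thesis using z(4) st by (simp add: abs_mult mult.commute mult_right_mono)
  qed
  show ?thesis
    using *[of s t] *[of t s] st
    by (cases s t rule: linorder_cases) (auto simp: abs_minus_commute)
qed

lemma less_1_gap:
  fixes h :: "real \<Rightarrow> real"
  assumes "continuous_on {a..b} h" "\<And>s. s \<in> {a..b} \<Longrightarrow> h s < 1"
  obtains \<rho> where "0 < \<rho>" "\<rho> < 1" "\<And>s. s \<in> {a..b} \<Longrightarrow> h s \<le> \<rho>"
proof (cases "a \<le> b")
  case True
  then obtain s0 where s0: "s0 \<in> {a..b}" "\<And>s. s \<in> {a..b} \<Longrightarrow> h s \<le> h s0"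
    using continuous_attains_sup[OF compact_Icc _ assms(1)] by auto
  \<comment> \<open>The entry 1 / 2 makes the constant positive whatever the maximum of
    \<open>h\<close> is; it will serve as a divisor.\<close>
  show ?thesis
    by (rule that[of "max (1 / 2) (h s0)"]) (use s0 assms(2) in \<open>auto simp: le_max_iff_disj\<close>)
next
  case False
  then show ?thesis using that[of "1 / 2"] by simp
qed

context p_laplace_problem
begin

lemma sol_range:
  assumes "sol \<mu> u du"
  obtains a b where "0 < a" "0 < b" "\<And>x. x \<in> {0..T} \<Longrightarrow> u x \<in> {a..b}"
proof -
  have u: "continuous_on {0..T} u" and upos: "\<And>x. x \<in> {0..T} \<Longrightarrow> 0 < u x"
    using assms periodic_C1D(6) by (auto simp: sol_def)
  obtain x0 where x0: "x0 \<in> {0..T}" "\<And>x. x \<in> {0..T} \<Longrightarrow> u x0 \<le> u x"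
    using continuous_attains_inf[OF compact_Icc _ u] T by auto
  obtain b where b: "0 < b" "\<And>x. x \<in> {0..T} \<Longrightarrow> \<bar>u x\<bar> \<le> b"
    using continuous_on_Icc_bounded[OF u] by blast
  show ?thesis
  proof (rule that[of "u x0" b])
    show "u x \<in> {u x0..b}" if "x \<in> {0..T}" for x
      using x0(2)[OF that] b(2)[OF that] by (simp add: abs_le_iff)
  qed (use upos x0 b in auto)
qed

text \<open>For \<open>\<nu>\<close> close to \<open>\<mu>\<close> the multiples \<open>c u\<close> and \<open>u / c\<close> of the solution for \<open>\<mu>\<close> are a
  supersolution and a subsolution for \<open>\<nu>\<close>, because \<open>G\<close> is strictly decreasing.\<close>

lemma sol_ratio_near_1:
  assumes u: "sol \<mu> u du" and c: "1 < c"
  obtains \<delta> where "0 < \<delta>" "\<And>\<nu> v dv x. \<bar>\<nu> - \<mu>\<bar> < \<delta> \<Longrightarrow> sol \<nu> v dv \<Longrightarrow> x \<in> {0..T} \<Longrightarrow>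
    u x / c \<le> v x \<and> v x \<le> c * u x"
proof -
  obtain a b where ab: "0 < a" "0 < b" "\<And>x. x \<in> {0..T} \<Longrightarrow> u x \<in> {a..b}"
    using sol_range[OF u] by blast
  have upos: "0 < u x" if "x \<in> {0..T}" for x using ab(1) ab(3)[OF that] by simp
  have u': "periodic_C1 T p u du (\<lambda>x. R \<mu> x (u x))" using u by (simp add: sol_def)
  have "0 < \<mu>" using u by (rule sol_imp_pos)
  have cont1: "continuous_on {a..b} (\<lambda>s. G (c * s) / G s)"
  proof (intro continuous_on_divide ballI)
    show "continuous_on {a..b} (\<lambda>s. G (c * s))" "continuous_on {a..b} G"
      using ab(1) c by (auto intro!: continuous_on_compose2[OF continuous_on_G] continuous_intros mult_pos_pos
          continuous_on_subset[OF continuous_on_G])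
    show "G s \<noteq> 0" if "s \<in> {a..b}" for s using G_pos[of s] ab(1) that by simp
  qed
  have cont2: "continuous_on {a..b} (\<lambda>s. G s / G (s / c))"
  proof (intro continuous_on_divide ballI)
    show "continuous_on {a..b} (\<lambda>s. G (s / c))" "continuous_on {a..b} G"
      using ab(1) c by (auto intro!: continuous_on_compose2[OF continuous_on_G] continuous_intros
          continuous_on_subset[OF continuous_on_G])
    show "G (s / c) \<noteq> 0" if "s \<in> {a..b}" for s using G_pos[of "s / c"] ab(1) c that by simp
  qed
  have "G (c * s) / G s < 1" if "s \<in> {a..b}" for s
    using G_less[of s "c * s"] G_pos[of s] ab(1) c that by simp
  then obtain \<rho> where \<rho>: "0 < \<rho>" "\<rho> < 1" "\<And>s. s \<in> {a..b} \<Longrightarrow> G (c * s) / G s \<le> \<rho>"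
    using less_1_gap[OF cont1] by blast
  have "G s / G (s / c) < 1" if "s \<in> {a..b}" for s
    using G_less[of "s / c" s] G_pos[of "s / c"] ab(1) c that by (simp add: divide_less_eq)
  then obtain \<sigma> where \<sigma>: "0 < \<sigma>" "\<sigma> < 1" "\<And>s. s \<in> {a..b} \<Longrightarrow> G s / G (s / c) \<le> \<sigma>"
    using less_1_gap[OF cont2] by blast
  \<comment> \<open>Chosen such that \<nu> \<rho> <= \<mu> and \<mu> \<sigma> <= \<nu>; with these,
    the decrease of \<open>G\<close> between u and c u, or between u / c and u, outweighs the change
    of the parameter.\<close>
  define \<delta> where "\<delta> = min (\<mu> / \<rho> - \<mu>) (\<mu> - \<mu> * \<sigma>)"
  show ?thesis
  proof (rule that[of \<delta>])
    show "0 < \<delta>" using \<open>0 < \<mu>\<close> \<rho> \<sigma> by (simp add: \<delta>_def field_simps)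
    fix \<nu> v dv x
    assume \<nu>: "\<bar>\<nu> - \<mu>\<bar> < \<delta>" and v: "sol \<nu> v dv" and x: "x \<in> {0..T}"
    have "0 < \<nu>" using v by (rule sol_imp_pos)
    have "\<nu> < \<mu> / \<rho>" "\<mu> * \<sigma> < \<nu>" using \<nu> by (auto simp: \<delta>_def)
    then have \<nu>': "\<nu> * \<rho> \<le> \<mu>" "\<mu> * \<sigma> \<le> \<nu>" using \<rho> by (simp_all add: field_simps)
    show "u x / c \<le> v x \<and> v x \<le> c * u x"
    proof
      show "v x \<le> c * u x"
        using \<open>0 < \<nu>\<close> v periodic_C1_scale[OF u', of c] _ _ x
      proof (rule sol_le_supersolution)
        show "0 < c * u x" if "x \<in> {0..T}" for x using upos[OF that] c by simp
        fix x assume "x \<in> {0<..<T}"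
        then have x: "x \<in> {0..T}" by simp
        have "G (c * u x) \<le> \<rho> * G (u x)"
          using \<rho>(3)[OF ab(3)[OF x]] G_pos[OF upos[OF x]] by (simp add: divide_le_eq)
        then have "\<nu> * G (c * u x) \<le> \<nu> * \<rho> * G (u x)"
          using \<open>0 < \<nu>\<close> by simp
        also have "\<dots> \<le> \<mu> * G (u x)"
          using \<nu>'(1) G_pos[OF upos[OF x]] by (intro mult_right_mono) auto
        finally have "m x * (\<nu> * G (c * u x)) \<le> m x * (\<mu> * G (u x))"
          using m(2) x by (intro mult_left_mono) auto
        then show "phi p c * R \<mu> x (u x) / phi p (c * u x) \<le> q x - \<nu> * m x * G (c * u x)"
          using R_div[OF upos[OF x], of \<mu> x] c phi_pos[of c p] by (simp add: phi_mult algebra_simps)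
      qed
      have "1 / c * u x \<le> v x"
        using \<open>0 < \<nu>\<close> v periodic_C1_scale[OF u', of "1 / c"] _ _ x
      proof (rule subsolution_le_sol)
        show "0 < 1 / c * u x" if "x \<in> {0..T}" for x using upos[OF that] c by simp
        fix x assume "x \<in> {0<..<T}"
        then have x: "x \<in> {0..T}" by simp
        have "G (u x) \<le> \<sigma> * G (u x / c)"
          using \<sigma>(3)[OF ab(3)[OF x]] G_pos[of "u x / c"] upos[OF x] c by (simp add: divide_le_eq)
        then have "\<mu> * G (u x) \<le> \<mu> * \<sigma> * G (u x / c)"
          using \<open>0 < \<mu>\<close> by simp
        also have "\<dots> \<le> \<nu> * G (u x / c)"
          using \<nu>'(2) G_pos[of "u x / c"] upos[OF x] c by (intro mult_right_mono) auto
        finally have "m x * (\<mu> * G (u x)) \<le> m x * (\<nu> * G (u x / c))"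
          using m(2) x by (intro mult_left_mono) auto
        then show "q x - \<nu> * m x * G (1 / c * u x) \<le> phi p (1 / c) * R \<mu> x (u x) / phi p (1 / c * u x)"
          using R_div[OF upos[OF x], of \<mu> x] c phi_pos[of "1 / c" p]
          unfolding phi_mult by (simp add: algebra_simps)
      qed
      then show "u x / c \<le> v x" by simp
    qed
  qed
qed

text \<open>Uniform closeness of the solutions makes the derivatives of their fluxes uniformly
  close. The fluxes agree at one point by Rolle's theorem, as both solutions are periodic, so they
  are close everywhere; uniform continuity of \<open>phi (conj_exp p)\<close> on a compact interval
  transfers this to the derivatives.\<close>

lemma sol_continuous:
  assumes u: "sol \<mu> u du" and e: "0 < e"
  obtains \<delta> where "0 < \<delta>" "\<And>\<nu> v dv x. \<bar>\<nu> - \<mu>\<bar> < \<delta> \<Longrightarrow> sol \<nu> v dv \<Longrightarrow> x \<in> {0..T} \<Longrightarrow>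
    \<bar>v x - u x\<bar> \<le> e \<and> \<bar>dv x - du x\<bar> \<le> e"
proof -
  obtain a b where ab: "0 < a" "0 < b" "\<And>x. x \<in> {0..T} \<Longrightarrow> u x \<in> {a..b}"
    using sol_range[OF u] by blast
  have u': "periodic_C1 T p u du (\<lambda>x. R \<mu> x (u x))" using u by (simp add: sol_def)
  have cont_flux: "continuous_on {0..T} (\<lambda>x. phi p (dv x))" if "sol \<nu> v dv" for \<nu> v dv
    using that periodic_C1D(2) p by (auto simp: sol_def intro!: continuous_intros)
  obtain Y where Y: "0 < Y" "\<And>x. x \<in> {0..T} \<Longrightarrow> \<bar>phi p (du x)\<bar> \<le> Y"
    using continuous_on_Icc_bounded[OF cont_flux[OF u]] by blast
  \<comment> \<open>The margin 1 leaves room for the flux of the nearby solution, which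
    \<open>\<eta>'\<close> will keep within 1 of the flux of u.\<close>
  obtain \<eta> where \<eta>: "0 < \<eta>" "\<And>s t. s \<in> {- (Y + 1)..Y + 1} \<Longrightarrow> t \<in> {- (Y + 1)..Y + 1} \<Longrightarrow>
      \<bar>s - t\<bar> < \<eta> \<Longrightarrow> \<bar>phi (conj_exp p) s - phi (conj_exp p) t\<bar> < e"
    using compact_uniformly_continuous[OF continuous_on_phi[OF conj_exp_gt_1[OF p]], of "{- (Y + 1)..Y + 1}"] e
    unfolding uniformly_continuous_on_def dist_real_def by (metis compact_Icc)
  define \<eta>' where "\<eta>' = min \<eta> 1 / (2 * T)"
  have \<eta>': "0 < \<eta>'" "\<eta>' * T < \<eta>" "\<eta>' * T < 1"
    using \<eta>(1) T by (auto simp: \<eta>'_def min_def)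
  define K where "K = {\<mu> - 1..\<mu> + 1} \<times> {0..T} \<times> {a / 2..2 * b}"
  have "uniformly_continuous_on K (\<lambda>(\<mu>, x, s). R \<mu> x s)"
    unfolding K_def using ab(1)
    by (intro compact_uniformly_continuous continuous_on_subset[OF continuous_on_R] compact_Times) auto
  then obtain d where d: "0 < d" "\<forall>z\<in>K. \<forall>z'\<in>K. dist z' z < d \<longrightarrow>
      dist ((\<lambda>(\<mu>, x, s). R \<mu> x s) z') ((\<lambda>(\<mu>, x, s). R \<mu> x s) z) < \<eta>'"
    unfolding uniformly_continuous_on_def using \<eta>'(1) by blast
  define \<epsilon> where "\<epsilon> = min (min b e) (d / 3)"
  have \<epsilon>: "0 < \<epsilon>" "\<epsilon> \<le> b" "\<epsilon> \<le> e" "\<epsilon> \<le> d / 3" using ab e d by (auto simp: \<epsilon>_def)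
  \<comment> \<open>As u <= b, the bounds u / c <= v <= c u give |v - u| <= \<epsilon>; since c <=
    2, the values of v stay in [a / 2, 2 b].\<close>
  define c where "c = 1 + \<epsilon> / b"
  have c: "1 < c" "c \<le> 2" "(c - 1) * b = \<epsilon>" using \<epsilon> ab by (auto simp: c_def)
  obtain \<delta>' where \<delta>': "0 < \<delta>'" "\<And>\<nu> v dv x. \<bar>\<nu> - \<mu>\<bar> < \<delta>' \<Longrightarrow> sol \<nu> v dv \<Longrightarrow> x \<in> {0..T} \<Longrightarrow>
      u x / c \<le> v x \<and> v x \<le> c * u x"
    using sol_ratio_near_1[OF u c(1)] by blast
  show ?thesis
  proof (rule that[of "min \<delta>' (min 1 (d / 3))"])
    show "0 < min \<delta>' (min 1 (d / 3))" using \<delta>' d by simp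
    fix \<nu> v dv x
    assume \<nu>: "\<bar>\<nu> - \<mu>\<bar> < min \<delta>' (min 1 (d / 3))" and v: "sol \<nu> v dv" and x: "x \<in> {0..T}"
    have v': "periodic_C1 T p v dv (\<lambda>x. R \<nu> x (v x))" using v by (simp add: sol_def)
    have close: "\<bar>v x - u x\<bar> \<le> \<epsilon>" and range: "v x \<in> {a / 2..2 * b}" if x: "x \<in> {0..T}" for x
    proof -
      have uv: "u x / c \<le> v x" "v x \<le> c * u x" and ux: "a \<le> u x" "u x \<le> b"
        using \<delta>'(2)[of \<nu> v dv x] \<nu> v x ab(3)[OF x] by auto
      have "0 < u x" using ux ab by simp
      have 1: "(c - 1) * u x \<le> \<epsilon>"
        unfolding c(3)[symmetric] using ux c by (intro mult_left_mono) auto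
      have "u x - u x / c = (c - 1) * u x / c"
        using c by (simp add: field_simps)
      also have "\<dots> \<le> (c - 1) * u x"
        using c \<open>0 < u x\<close> mult_left_mono[of 1 c "(c - 1) * u x"] by (simp add: divide_le_eq)
      finally have 2: "u x - u x / c \<le> \<epsilon>" using 1 by simp
      show "\<bar>v x - u x\<bar> \<le> \<epsilon>"
        using 1 2 uv by (simp add: abs_le_iff algebra_simps)
      have "u x / 2 \<le> u x / c" using c \<open>0 < u x\<close> by (intro divide_left_mono) auto
      then have "a / 2 \<le> v x" using uv(1) ux(1) by linarith
      moreover have "c * u x \<le> 2 * u x" using c \<open>0 < u x\<close> by (intro mult_right_mono) auto
      then have "v x \<le> 2 * b" using uv(2) ux(2) by linarith
      ultimately show "v x \<in> {a / 2..2 * b}" by simp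
    qed
    have Rdiff: "\<bar>R \<nu> x (v x) - R \<mu> x (u x)\<bar> \<le> \<eta>'" if x: "x \<in> {0..T}" for x
    proof -
      have "u x \<in> {a / 2..2 * b}" using ab(1,2) ab(3)[OF x] by simp
      then have "(\<nu>, x, v x) \<in> K" "(\<mu>, x, u x) \<in> K"
        using \<nu> x range[OF x] by (auto simp: K_def abs_less_iff)
      moreover have "dist (\<nu>, x, v x) (\<mu>, x, u x) < d"
      proof -
        have "dist (\<nu>, x, v x) (\<mu>, x, u x) \<le> \<bar>\<nu> - \<mu>\<bar> + \<bar>v x - u x\<bar>"
          using sqrt_sum_squares_le_sum_abs[of "\<nu> - \<mu>" "v x - u x"]
          by (simp add: dist_Pair_Pair dist_real_def)
        then show ?thesis using \<nu> close[OF x] \<epsilon>(4) d(1) by simp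
      qed
      ultimately show ?thesis using d(2) by (fastforce simp: dist_real_def)
    qed
    define g where "g = (\<lambda>x. phi p (dv x) - phi p (du x))"
    have contg: "continuous_on {0..T} g"
      unfolding g_def by (intro continuous_intros cont_flux[OF u] cont_flux[OF v])
    have derg: "(g has_real_derivative R \<nu> x (v x) - R \<mu> x (u x)) (at x)" if "x \<in> {0<..<T}" for x
      unfolding g_def using periodic_C1D(3)[OF u' that] periodic_C1D(3)[OF v' that] by (rule_tac DERIV_diff)
    have dvu: "((\<lambda>x. v x - u x) has_real_derivative dv x - du x) (at x)" if "x \<in> {0<..<T}" for x
      using periodic_C1_deriv_at[OF v' that] periodic_C1_deriv_at[OF u' that] by (rule DERIV_diff)
    have "\<exists>\<xi>. 0 < \<xi> \<and> \<xi> < T \<and> ((\<lambda>x. v x - u x) has_real_derivative 0) (at \<xi>)"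
    proof (rule Rolle)
      show "0 < T" by (rule T)
      show "v 0 - u 0 = v T - u T" using periodic_C1D(4)[OF u'] periodic_C1D(4)[OF v'] by simp
      show "continuous_on {0..T} (\<lambda>x. v x - u x)"
        by (intro continuous_intros periodic_C1D(6)[OF u'] periodic_C1D(6)[OF v'])
      show "(\<lambda>x. v x - u x) differentiable (at x)" if "0 < x" "x < T" for x
        using dvu[of x] that by (auto simp: real_differentiable_def)
    qed
    then obtain \<xi> where \<xi>: "\<xi> \<in> {0<..<T}" "dv \<xi> - du \<xi> = 0"
      using dvu DERIV_unique by (metis greaterThanLessThan_iff)
    have "\<bar>g x - g \<xi>\<bar> \<le> \<eta>' * \<bar>x - \<xi>\<bar>"
      by (rule abs_diff_le_deriv_bound[OF contg derg]) (use Rdiff x \<xi> in auto)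
    also have "\<dots> \<le> \<eta>' * T"
      using x \<xi>(1) \<eta>' by (intro mult_left_mono) auto
    finally have gx: "\<bar>g x\<bar> \<le> \<eta>' * T" using \<xi>(2) by (simp add: g_def)
    have "\<bar>phi (conj_exp p) (phi p (dv x)) - phi (conj_exp p) (phi p (du x))\<bar> < e"
      using gx \<eta>' Y(2)[OF x] by (intro \<eta>(2)) (auto simp: g_def abs_le_iff)
    then show "\<bar>v x - u x\<bar> \<le> e \<and> \<bar>dv x - du x\<bar> \<le> e"
      using p close[OF x] \<epsilon>(3) by simp
  qed
qed

section \<open>The curve of positive solutions\<close>

definition U :: "real \<Rightarrow> real \<Rightarrow> real" where
  "U \<mu> = (THE u. positive_solution T p q m f \<mu> u)"

lemma positive_solution_U: "0 < \<mu> \<Longrightarrow> positive_solution T p q m f \<mu> (U \<mu>)"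
  unfolding U_def by (rule theI'[OF ex1_positive_solution])

lemma X_norm_U_tendsto:
  assumes "0 < \<mu>\<^sub>0"
  shows "((\<lambda>\<mu>. X_norm T p q (\<lambda>x. U \<mu> x - U \<mu>\<^sub>0 x)) \<longlongrightarrow> 0) (at \<mu>\<^sub>0 within {0<..})"
proof (rule tendstoI)
  fix e :: real assume e: "0 < e"
  obtain Q where Q: "0 < Q" "\<And>x. x \<in> {0..T} \<Longrightarrow> \<bar>q x\<bar> \<le> Q"
    using continuous_on_Icc_bounded[OF q(1)] by blast
  define k where "k = (T * (1 + Q)) powr (1 / p)"
  have k: "0 < k" using T Q by (simp add: k_def)
  obtain du where du: "sol \<mu>\<^sub>0 (U \<mu>\<^sub>0) du"
    using positive_solution_U[OF assms] positive_solution_iff by blast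
  have "0 < e / (2 * k)" using e k by simp
  then obtain \<delta> where \<delta>: "0 < \<delta>" "\<And>\<nu> v dv x. \<bar>\<nu> - \<mu>\<^sub>0\<bar> < \<delta> \<Longrightarrow> sol \<nu> v dv \<Longrightarrow> x \<in> {0..T} \<Longrightarrow>
    \<bar>v x - U \<mu>\<^sub>0 x\<bar> \<le> e / (2 * k) \<and> \<bar>dv x - du x\<bar> \<le> e / (2 * k)"
    using sol_continuous[OF du] by blast
  have "dist (X_norm T p q (\<lambda>x. U \<mu> x - U \<mu>\<^sub>0 x)) 0 < e" if \<mu>: "0 < \<mu>" "\<bar>\<mu> - \<mu>\<^sub>0\<bar> < \<delta>" for \<mu>
  proof -
    obtain dv where dv: "sol \<mu> (U \<mu>) dv"
      using positive_solution_U[OF \<mu>(1)] positive_solution_iff by blast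
    have C1: "periodic_C1 T p (U \<mu>) dv (\<lambda>x. R \<mu> x (U \<mu> x))" "periodic_C1 T p (U \<mu>\<^sub>0) du (\<lambda>x. R \<mu>\<^sub>0 x (U \<mu>\<^sub>0 x))"
      using du dv by (simp_all add: sol_def)
    have "X_norm T p q (\<lambda>x. U \<mu> x - U \<mu>\<^sub>0 x) \<le> k * (e / (2 * k))"
      unfolding k_def
    proof (rule X_norm_C1_le[OF T _ q(1,2), where du = "\<lambda>x. dv x - du x"])
      show "1 \<le> p" using p by simp
      show "q x \<le> Q" if "x \<in> {0..T}" for x using Q(2)[OF that] by simp
      show "((\<lambda>x. U \<mu> x - U \<mu>\<^sub>0 x) has_real_derivative dv x - du x) (at x within {0..T})" if "x \<in> {0..T}" for x
        using periodic_C1D(1)[OF C1(1) that] periodic_C1D(1)[OF C1(2) that] by (rule DERIV_diff)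
      show "continuous_on {0..T} (\<lambda>x. dv x - du x)"
        by (intro continuous_intros periodic_C1D(2)[OF C1(1)] periodic_C1D(2)[OF C1(2)])
    qed (use \<delta>(2)[OF \<mu>(2) dv] in \<open>auto simp: k_def\<close>)
    also have "\<dots> < e" using k e by simp
    finally show ?thesis by (simp add: X_norm_def)
  qed
  then show "\<forall>\<^sub>F \<mu> in at \<mu>\<^sub>0 within {0<..}. dist (X_norm T p q (\<lambda>x. U \<mu> x - U \<mu>\<^sub>0 x)) 0 < e"
    unfolding eventually_at using \<delta>(1) by (intro exI[of _ \<delta>]) (auto simp: dist_real_def)
qed

lemma positive_set_eq: "positive_set T p q m f = (\<lambda>\<mu>. (\<mu>, U \<mu>)) ` {0<..}"
proof -
  have "u = U \<mu> \<and> 0 < \<mu>" if "positive_solution T p q m f \<mu> u" for \<mu> u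
  proof -
    have "0 < \<mu>" using that sol_imp_pos unfolding positive_solution_iff by blast
    then show ?thesis using ex1_positive_solution positive_solution_U that by blast
  qed
  then show ?thesis
    using positive_solution_U by (auto simp: positive_set_def)
qed

lemma connectedin_positive_set: "connectedin (RX_top T p q) (positive_set T p q m f)"
proof -
  interpret X: Metric_space "X_per T p" "X_dist T p q"
    using p by (intro Metric_space_X_per T q) simp
  have U_X: "U \<mu> \<in> X_per T p" if "0 < \<mu>" for \<mu>
    using positive_solution_U[OF that] by (simp add: positive_solution_def solution_N_def)
  have "continuous_map (top_of_set {0<..}) X.mtopology U"
    unfolding X.continuous_map_to_metric
  proof (intro ballI allI impI)
    fix \<mu>\<^sub>0 e :: real assume "\<mu>\<^sub>0 \<in> topspace (top_of_set {0<..})" and "0 < e"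
    then have pos: "0 < \<mu>\<^sub>0" by simp
    have "\<forall>\<^sub>F \<mu> in at \<mu>\<^sub>0 within {0<..}. X_norm T p q (\<lambda>x. U \<mu> x - U \<mu>\<^sub>0 x) < e"
      using X_norm_U_tendsto[OF pos] \<open>0 < e\<close> by (rule order_tendstoD(2))
    then obtain d where d: "0 < d" "\<And>\<mu>. 0 < \<mu> \<Longrightarrow> \<mu> \<noteq> \<mu>\<^sub>0 \<Longrightarrow> dist \<mu> \<mu>\<^sub>0 < d \<Longrightarrow>
        X_dist T p q (U \<mu>) (U \<mu>\<^sub>0) < e"
      unfolding eventually_at X_dist_def by auto
    show "\<exists>V. openin (top_of_set {0<..}) V \<and> \<mu>\<^sub>0 \<in> V \<and> (\<forall>\<mu>\<in>V. U \<mu> \<in> X.mball (U \<mu>\<^sub>0) e)"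
    proof (intro exI conjI ballI)
      show "openin (top_of_set {0<..}) ({0<..} \<inter> ball \<mu>\<^sub>0 d)" by (simp add: openin_open_Int)
      show "\<mu>\<^sub>0 \<in> {0<..} \<inter> ball \<mu>\<^sub>0 d" using pos d by simp
      fix \<mu> assume "\<mu> \<in> {0<..} \<inter> ball \<mu>\<^sub>0 d"
      then show "U \<mu> \<in> X.mball (U \<mu>\<^sub>0) e"
        using d(2)[of \<mu>] U_X[OF pos] U_X[of \<mu>] \<open>0 < e\<close> X.commute[of "U \<mu>\<^sub>0" "U \<mu>"]
        by (cases "\<mu> = \<mu>\<^sub>0") (auto simp: dist_commute)
    qed
  qed
  then have "continuous_map (top_of_set {0<..}) (RX_top T p q) (\<lambda>\<mu>. (\<mu>, U \<mu>))"
    unfolding RX_top_def by (intro continuous_map_pairedI) auto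
  moreover have "connectedin (top_of_set {0<..}) {0::real<..}"
    by (simp add: connectedin_subtopology)
  ultimately show ?thesis
    unfolding positive_set_eq by (rule connectedin_continuous_map_image)
qed

text \<open>A component contains every connected set that it meets; here that set consists of all
  positive solutions.\<close>

lemma component_eq_positive_set:
  assumes "is_C_plus T p q m f C" "0 < \<mu>"
  shows "(\<mu>, U \<mu>) \<in> C"
proof -
  let ?S = "positive_set T p q m f"
  have C: "C \<in> connected_components_of (subtopology (RX_top T p q) ?S)"
    using assms(1) by (simp add: is_C_plus_def)
  have "C \<noteq> {}" "C \<subseteq> ?S"
    using nonempty_connected_components_of[OF C] connected_components_of_subset[OF C] by auto
  moreover have "connectedin (subtopology (RX_top T p q) ?S) ?S"
    using connectedin_positive_set by (simp add: connectedin_subtopology)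
  ultimately have "?S \<subseteq> C"
    by (intro connected_components_of_maximal[OF C]) (auto simp: disjnt_def)
  then show ?thesis using assms(2) unfolding positive_set_eq by auto
qed

end

theorem theorem6p1:
  fixes T p :: real and q m f :: "real \<Rightarrow> real"
  assumes "0 < T" and "1 < p"
    and "continuous_on {0..T} q" and "\<forall>x\<in>{0..T}. 0 \<le> q x" and "\<exists>x\<in>{0..T}. q x \<noteq> 0"
    and "continuous_on {0..} f" and "0 \<le> f 0" and "\<forall>s>0. 0 < f s"
    and "continuous_on {0..T} m" and "\<forall>x\<in>{0..T}. 0 \<le> m x" and "\<exists>x\<in>{0..T}. m x \<noteq> 0"
    and "strict_antimono_on {0<..} (\<lambda>s. f s / phi p s)"
    and "filterlim (\<lambda>s. f s / phi p s) at_top (at_right 0)"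
    and "((\<lambda>s. f s / phi p s) \<longlongrightarrow> 0) at_top"
  shows "(\<forall>\<mu>>0. \<exists>!u. positive_solution T p q m f \<mu> u) \<and>
    (let U = (\<lambda>\<mu>. THE u. positive_solution T p q m f \<mu> u) in
       (\<forall>C. is_C_plus T p q m f C \<longrightarrow> (\<forall>\<mu>>0. (\<mu>, U \<mu>) \<in> C)) \<and>
       (\<forall>\<mu>\<^sub>0>0. ((\<lambda>\<mu>. X_norm T p q (\<lambda>x. U \<mu> x - U \<mu>\<^sub>0 x)) \<longlongrightarrow> 0) (at \<mu>\<^sub>0 within {0<..})))"
proof -
  interpret p_laplace_problem T p q m f
    using assms by unfold_locales auto
  show ?thesis
    using ex1_positive_solution component_eq_positive_set X_norm_U_tendsto
    unfolding Let_def U_def[symmetric] by blast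
qed

end
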